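(* Let $\mathcal{C}$ be a left-Ore category, and let $\mathcal{G}$ be the groupoid of fractions (enveloping groupoid) of $\mathcal{C}$. For every $\mathcal{C}$-module $M$ and every $n\geqslant 0$ we have $H_n(\mathcal{C},M)\cong H_n(\mathcal{G},\mathbb{Z}\mathcal{G}\otimes_{\mathcal{C}} M)$. Furthermore, if $G$ is a group (viewed as a one-object category) and $\varphi:G\to\mathcal{G}$ is an equivalence of categories, let $M'$ be the $G$-module induced from $M$ by $\varphi$, i.e. the restriction along $\varphi$ of the $\mathcal{G}$-module $\mathbb{Z}\mathcal{G}\otimes_{\mathcal{C}}M$; then $H_n(\mathcal{C},M)\cong H_n(G,M')$ for every $n\geqslant 0$.
   Context: All categories are small; the composite of $f:x\to y$ and $g:y\to z$ is written $fg:x\to z$. A category is left-Ore if it is cancellative ($fg=fg'$ implies $g=g'$, and $gf=g'f$ implies $g=g'$) and any two morphisms $f,g$ with the same target admit a common left-multiple (there are $u,v$ with $uf=vg$). The enveloping groupoid $\mathcal{G}(\mathcal{C})$ is obtained by formally inverting all morphisms of $\mathcal{C}$; it has the same objects as $\mathcal{C}$. When $\mathcal{C}$ is left-Ore it is called the groupoid of fractions. A $\mathcal{C}$-module (or $\mathbb{Z}\mathcal{C}$-module) is a contravariant functor $M$ from $\mathcal{C}$ to abelian groups; write $M_x$ for its value at $x$ and, for $f:x\to y$ and $a\in M_y$, write $f.a:=M(f)(a)\in M_x$, so that $(fg).a=f.(g.a)$. Morphisms of modules are natural transformations. A right $\mathcal{C}$-module is a covariant functor from $\mathcal{C}$ to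 abelian groups. If $R$ is a right $\mathcal{C}$-module and $M$ a $\mathcal{C}$-module, then $R\otimes_{\mathcal{C}}M$ is the quotient of $\bigoplus_{z}R_z\otimes_{\mathbb{Z}}M_z$ by all relations $ad\otimes b=a\otimes db$ for $d\in\mathcal{C}(z,z')$, $a\in R_z$, $b\in M_{z'}$. The trivial module $\mathbb{Z}$ (left or right) sends every object to $\mathbb{Z}$ and every morphism to the identity. $H_n(\mathcal{C},M):=\operatorname{Tor}_n^{\mathbb{Z}\mathcal{C}}(\mathbb{Z},M)$, where $\operatorname{Tor}_n^{\mathbb{Z}\mathcal{C}}$ denotes the $n$-th left-derived functor of $\otimes_{\mathcal{C}}$; for a group this is ordinary group homology. $\mathbb{Z}\mathcal{G}\otimes_{\mathcal{C}}M$ is the $\mathcal{G}$-module sending $x$ to $\mathbb{Z}\mathcal{G}(x,-)\otimes_{\mathcal{C}}M$, where $\mathbb{Z}\mathcal{G}(x,-)$ is the right $\mathcal{C}$-module $y\mapsto\mathbb{Z}\mathcal{G}(x,y)$ (free abelian group on $\mathcal{G}(x,y)$), with $\mathcal{G}$ acting by composition on the left. *)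

theory Defs
  imports "HOL-Algebra.Free_Abelian_Groups"
begin

section \<open>Small categories\<close>

text \<open>Composition is written in diagrammatic order: \<open>cmp C f g\<close> is first \<open>f\<close>, then \<open>g\<close>.\<close>

record ('o, 'm) cat =
  obj :: "'o set"
  mor :: "'m set"
  src :: "'m \<Rightarrow> 'o"
  tgt :: "'m \<Rightarrow> 'o"
  idn :: "'o \<Rightarrow> 'm"
  cmp :: "'m \<Rightarrow> 'm \<Rightarrow> 'm"

definition Hom :: "('o, 'm) cat \<Rightarrow> 'o \<Rightarrow> 'o \<Rightarrow> 'm set"
  where "Hom C x y = {f \<in> mor C. src C f = x \<and> tgt C f = y}"

locale category =
  fixes C :: "('o, 'm) cat"
  assumes src_obj: "f \<in> mor C \<Longrightarrow> src C f \<in> obj C"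
    and tgt_obj: "f \<in> mor C \<Longrightarrow> tgt C f \<in> obj C"
    and idn_Hom: "x \<in> obj C \<Longrightarrow> idn C x \<in> Hom C x x"
    and cmp_Hom: "\<lbrakk>f \<in> Hom C x y; g \<in> Hom C y z\<rbrakk> \<Longrightarrow> cmp C f g \<in> Hom C x z"
    and cmp_assoc: "\<lbrakk>f \<in> Hom C w x; g \<in> Hom C x y; h \<in> Hom C y z\<rbrakk>
          \<Longrightarrow> cmp C (cmp C f g) h = cmp C f (cmp C g h)"
    and idn_left: "f \<in> Hom C x y \<Longrightarrow> cmp C (idn C x) f = f"
    and idn_right: "f \<in> Hom C x y \<Longrightarrow> cmp C f (idn C y) = f"

locale left_ore = category +
  assumes left_cancel:
      "\<lbrakk>f \<in> Hom C x y; g \<in> Hom C y z; g' \<in> Hom C y z; cmp C f g = cmp C f g'\<rbrakk> \<Longrightarrow> g = g'"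
    and right_cancel:
      "\<lbrakk>g \<in> Hom C x y; g' \<in> Hom C x y; f \<in> Hom C y z; cmp C g f = cmp C g' f\<rbrakk> \<Longrightarrow> g = g'"
    and common_left_multiple:
      "\<lbrakk>f \<in> Hom C x z; g \<in> Hom C y z\<rbrakk>
        \<Longrightarrow> \<exists>w. \<exists>u \<in> Hom C w x. \<exists>v \<in> Hom C w y. cmp C u f = cmp C v g"

locale cat_functor = A: category A + B: category B
  for A :: "('o, 'm) cat" and B :: "('p, 'n) cat" +
  fixes Fo :: "'o \<Rightarrow> 'p" and Fm :: "'m \<Rightarrow> 'n"
  assumes map_Hom: "f \<in> Hom A x y \<Longrightarrow> Fm f \<in> Hom B (Fo x) (Fo y)"
    and map_obj: "x \<in> obj A \<Longrightarrow> Fo x \<in> obj B"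
    and map_idn: "x \<in> obj A \<Longrightarrow> Fm (idn A x) = idn B (Fo x)"
    and map_cmp: "\<lbrakk>f \<in> Hom A x y; g \<in> Hom A y z\<rbrakk> \<Longrightarrow> Fm (cmp A f g) = cmp B (Fm f) (Fm g)"

definition natural_iso ::
  "('o, 'm) cat \<Rightarrow> ('p, 'n) cat \<Rightarrow> ('o \<Rightarrow> 'p) \<Rightarrow> ('m \<Rightarrow> 'n) \<Rightarrow> ('o \<Rightarrow> 'p) \<Rightarrow> ('m \<Rightarrow> 'n)
    \<Rightarrow> ('o \<Rightarrow> 'n) \<Rightarrow> bool"
  where "natural_iso A B Fo Fm Go Gm \<eta> \<longleftrightarrow>
    (\<forall>x \<in> obj A. \<eta> x \<in> Hom B (Fo x) (Go x) \<and>
       (\<exists>h \<in> Hom B (Go x) (Fo x). cmp B (\<eta> x) h = idn B (Fo x) \<and> cmp B h (\<eta> x) = idn B (Go x))) \<and>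
    (\<forall>x y. \<forall>f \<in> Hom A x y. cmp B (Fm f) (\<eta> y) = cmp B (\<eta> x) (Gm f))"

definition cat_equivalence ::
  "('o, 'm) cat \<Rightarrow> ('p, 'n) cat \<Rightarrow> ('o \<Rightarrow> 'p) \<Rightarrow> ('m \<Rightarrow> 'n) \<Rightarrow> bool"
  where "cat_equivalence A B Fo Fm \<longleftrightarrow> cat_functor A B Fo Fm \<and>
    (\<exists>Go Gm \<eta> \<epsilon>. cat_functor B A Go Gm \<and>
       natural_iso A A (\<lambda>x. x) (\<lambda>f. f) (Go \<circ> Fo) (Gm \<circ> Fm) \<eta> \<and>
       natural_iso B B (Fo \<circ> Go) (Fm \<circ> Gm) (\<lambda>x. x) (\<lambda>f. f) \<epsilon>)"

definition group_cat :: "'g monoid \<Rightarrow> (unit, 'g) cat"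
  where "group_cat G = \<lparr>obj = UNIV, mor = carrier G, src = (\<lambda>_. ()), tgt = (\<lambda>_. ()),
    idn = (\<lambda>_. \<one>\<^bsub>G\<^esub>), cmp = (\<lambda>f g. f \<otimes>\<^bsub>G\<^esub> g)\<rparr>"


section \<open>The enveloping groupoid\<close>

text \<open>The letter \<open>(f, True)\<close> stands for \<open>f\<close> and \<open>(f, False)\<close> for its formal inverse. A word is a
  path of such letters; morphisms of the enveloping groupoid are words with fixed end points modulo
  the congruence generated by the relations of the category and \<open>f f\<^sup>-\<^sup>1 = 1\<close>, \<open>f\<^sup>-\<^sup>1 f = 1\<close>.\<close>

type_synonym 'm word = "('m \<times> bool) list"

inductive zigzag :: "('o, 'm) cat \<Rightarrow> 'o \<Rightarrow> 'm word \<Rightarrow> 'o \<Rightarrow> bool" for C where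
  zz_Nil: "x \<in> obj C \<Longrightarrow> zigzag C x [] x"
| zz_pos: "\<lbrakk>f \<in> Hom C x y; zigzag C y w z\<rbrakk> \<Longrightarrow> zigzag C x ((f, True) # w) z"
| zz_neg: "\<lbrakk>f \<in> Hom C y x; zigzag C y w z\<rbrakk> \<Longrightarrow> zigzag C x ((f, False) # w) z"

inductive word_eq :: "('o, 'm) cat \<Rightarrow> 'o \<Rightarrow> 'm word \<Rightarrow> 'm word \<Rightarrow> 'o \<Rightarrow> bool" for C where
  we_refl: "zigzag C x w y \<Longrightarrow> word_eq C x w w y"
| we_sym: "word_eq C x v w y \<Longrightarrow> word_eq C x w v y"
| we_trans: "\<lbrakk>word_eq C x u v y; word_eq C x v w y\<rbrakk> \<Longrightarrow> word_eq C x u w y"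
| we_append: "\<lbrakk>word_eq C x u u' y; word_eq C y v v' z\<rbrakk> \<Longrightarrow> word_eq C x (u @ v) (u' @ v') z"
| we_idn: "x \<in> obj C \<Longrightarrow> word_eq C x [(idn C x, True)] [] x"
| we_cmp: "\<lbrakk>f \<in> Hom C x y; g \<in> Hom C y z\<rbrakk>
    \<Longrightarrow> word_eq C x [(f, True), (g, True)] [(cmp C f g, True)] z"
| we_inv_right: "\<lbrakk>x \<in> obj C; f \<in> Hom C x y\<rbrakk> \<Longrightarrow> word_eq C x [(f, True), (f, False)] [] x"
| we_inv_left: "\<lbrakk>y \<in> obj C; f \<in> Hom C x y\<rbrakk> \<Longrightarrow> word_eq C y [(f, False), (f, True)] [] y"

type_synonym ('o, 'm) fraction = "'o \<times> 'm word set \<times> 'o"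

definition word_class :: "('o, 'm) cat \<Rightarrow> 'o \<Rightarrow> 'm word \<Rightarrow> 'o \<Rightarrow> ('o, 'm) fraction"
  where "word_class C x w y = (x, {v. word_eq C x w v y}, y)"

definition env_groupoid :: "('o, 'm) cat \<Rightarrow> ('o, ('o, 'm) fraction) cat"
  where "env_groupoid C = \<lparr>
    obj = obj C,
    mor = {word_class C x w y | x w y. zigzag C x w y},
    src = (\<lambda>(x, _, _). x),
    tgt = (\<lambda>(_, _, y). y),
    idn = (\<lambda>x. word_class C x [] x),
    cmp = (\<lambda>(x, U, _) (_, V, z). (x, {w. \<exists>u \<in> U. \<exists>v \<in> V. word_eq C x (u @ v) w z}, z))\<rparr>"

definition env_map :: "('o, 'm) cat \<Rightarrow> 'm \<Rightarrow> ('o, 'm) fraction"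
  where "env_map C f = word_class C (src C f) [(f, True)] (tgt C f)"


section \<open>Modules over a category\<close>

text \<open>Abelian groups are commutative groups of HOL-Algebra, hence written multiplicatively.
  The same record serves for left (contravariant) and right (covariant) modules.\<close>

record ('o, 'm, 'a) cmod =
  val :: "'o \<Rightarrow> 'a monoid"
  act :: "'m \<Rightarrow> 'a \<Rightarrow> 'a"

locale left_module = category C for C :: "('o, 'm) cat" +
  fixes M :: "('o, 'm, 'a) cmod"
  assumes val_comm_group: "x \<in> obj C \<Longrightarrow> comm_group (val M x)"
    and act_hom: "f \<in> Hom C x y \<Longrightarrow> act M f \<in> hom (val M y) (val M x)"
    and act_idn: "\<lbrakk>x \<in> obj C; a \<in> carrier (val M x)\<rbrakk> \<Longrightarrow> act M (idn C x) a = a"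
    and act_cmp: "\<lbrakk>f \<in> Hom C x y; g \<in> Hom C y z; a \<in> carrier (val M z)\<rbrakk>
          \<Longrightarrow> act M (cmp C f g) a = act M f (act M g a)"

locale right_module = category C for C :: "('o, 'm) cat" +
  fixes R :: "('o, 'm, 'a) cmod"
  assumes val_comm_group: "x \<in> obj C \<Longrightarrow> comm_group (val R x)"
    and act_hom: "f \<in> Hom C x y \<Longrightarrow> act R f \<in> hom (val R x) (val R y)"
    and act_idn: "\<lbrakk>x \<in> obj C; a \<in> carrier (val R x)\<rbrakk> \<Longrightarrow> act R (idn C x) a = a"
    and act_cmp: "\<lbrakk>f \<in> Hom C x y; g \<in> Hom C y z; a \<in> carrier (val R x)\<rbrakk>
          \<Longrightarrow> act R (cmp C f g) a = act R g (act R f a)"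

definition module_hom ::
  "('o, 'm) cat \<Rightarrow> ('o, 'm, 'a) cmod \<Rightarrow> ('o, 'm, 'b) cmod \<Rightarrow> ('o \<Rightarrow> 'a \<Rightarrow> 'b) \<Rightarrow> bool"
  where "module_hom C M N \<theta> \<longleftrightarrow>
    (\<forall>x \<in> obj C. \<theta> x \<in> hom (val M x) (val N x)) \<and>
    (\<forall>x y. \<forall>f \<in> Hom C x y. \<forall>a \<in> carrier (val M y). \<theta> x (act M f a) = act N f (\<theta> y a))"

definition module_epi ::
  "('o, 'm) cat \<Rightarrow> ('o, 'm, 'a) cmod \<Rightarrow> ('o, 'm, 'b) cmod \<Rightarrow> ('o \<Rightarrow> 'a \<Rightarrow> 'b) \<Rightarrow> bool"
  where "module_epi C M N \<theta> \<longleftrightarrow> module_hom C M N \<theta> \<and>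
    (\<forall>x \<in> obj C. \<theta> x ` carrier (val M x) = carrier (val N x))"

definition trivial_module :: "('o, 'm, int) cmod"
  where "trivial_module = \<lparr>val = (\<lambda>_. integer_group), act = (\<lambda>_ a. a)\<rparr>"

definition restrict_module ::
  "('o \<Rightarrow> 'p) \<Rightarrow> ('m \<Rightarrow> 'n) \<Rightarrow> ('p, 'n, 'a) cmod \<Rightarrow> ('o, 'm, 'a) cmod"
  where "restrict_module Fo Fm N = \<lparr>val = (\<lambda>x. val N (Fo x)), act = (\<lambda>f. act N (Fm f))\<rparr>"


section \<open>Tensor products\<close>

subsection \<open>Tensor product of abelian groups\<close>

definition bilinear_rels ::
  "'a monoid \<Rightarrow> 'b monoid \<Rightarrow> ('a \<times> 'b \<Rightarrow>\<^sub>0 int) set"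
  where "bilinear_rels A B = generate (free_Abelian_group (carrier A \<times> carrier B))
    ({frag_of (a \<otimes>\<^bsub>A\<^esub> a', b) - (frag_of (a, b) + frag_of (a', b)) | a a' b.
        a \<in> carrier A \<and> a' \<in> carrier A \<and> b \<in> carrier B} \<union>
     {frag_of (a, b \<otimes>\<^bsub>B\<^esub> b') - (frag_of (a, b) + frag_of (a, b')) | a b b'.
        a \<in> carrier A \<and> b \<in> carrier B \<and> b' \<in> carrier B})"

definition tensor_group :: "'a monoid \<Rightarrow> 'b monoid \<Rightarrow> ('a \<times> 'b \<Rightarrow>\<^sub>0 int) set monoid"
  where "tensor_group A B = free_Abelian_group (carrier A \<times> carrier B) Mod bilinear_rels A B"

definition pure_tensor :: "'a monoid \<Rightarrow> 'b monoid \<Rightarrow> 'a \<Rightarrow> 'b \<Rightarrow> ('a \<times> 'b \<Rightarrow>\<^sub>0 int) set"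
  where "pure_tensor A B a b =
    bilinear_rels A B #>\<^bsub>free_Abelian_group (carrier A \<times> carrier B)\<^esub> frag_of (a, b)"

text \<open>The homomorphism \<open>f \<otimes> g\<close> into \<open>tensor_group A' B'\<close>. If \<open>h\<close> is a homomorphism with
  \<open>h ` K \<subseteq> K'\<close>, then \<open>K' <#> h ` (K #> x) = K' #> h x\<close>, so this is the map induced on cosets.\<close>

definition tensor_group_map ::
  "'c monoid \<Rightarrow> 'd monoid \<Rightarrow> ('a \<Rightarrow> 'c) \<Rightarrow> ('b \<Rightarrow> 'd)
    \<Rightarrow> ('a \<times> 'b \<Rightarrow>\<^sub>0 int) set \<Rightarrow> ('c \<times> 'd \<Rightarrow>\<^sub>0 int) set"
  where "tensor_group_map A' B' f g X =
    bilinear_rels A' B' <#>\<^bsub>free_Abelian_group (carrier A' \<times> carrier B')\<^esub>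
      (frag_extend (\<lambda>(a, b). frag_of (f a, g b)) ` X)"

subsection \<open>Tensor product over a category\<close>

definition tensor_sum ::
  "('o, 'm) cat \<Rightarrow> ('o, 'm, 'r) cmod \<Rightarrow> ('o, 'm, 'a) cmod \<Rightarrow> ('o \<Rightarrow> ('r \<times> 'a \<Rightarrow>\<^sub>0 int) set) monoid"
  where "tensor_sum C R M = sum_group (obj C) (\<lambda>z. tensor_group (val R z) (val M z))"

definition summand ::
  "('o, 'm) cat \<Rightarrow> ('o, 'm, 'r) cmod \<Rightarrow> ('o, 'm, 'a) cmod \<Rightarrow> 'o \<Rightarrow> 'r \<Rightarrow> 'a
    \<Rightarrow> 'o \<Rightarrow> ('r \<times> 'a \<Rightarrow>\<^sub>0 int) set"
  where "summand C R M z a b =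
    (\<lambda>i \<in> obj C. if i = z then pure_tensor (val R z) (val M z) a b
                 else \<one>\<^bsub>tensor_group (val R i) (val M i)\<^esub>)"

definition balancing_rels ::
  "('o, 'm) cat \<Rightarrow> ('o, 'm, 'r) cmod \<Rightarrow> ('o, 'm, 'a) cmod \<Rightarrow> ('o \<Rightarrow> ('r \<times> 'a \<Rightarrow>\<^sub>0 int) set) set"
  where "balancing_rels C R M = generate (tensor_sum C R M)
    {summand C R M z' (act R d a) b \<otimes>\<^bsub>tensor_sum C R M\<^esub>
       inv\<^bsub>tensor_sum C R M\<^esub> (summand C R M z a (act M d b)) | d z z' a b.
     d \<in> Hom C z z' \<and> a \<in> carrier (val R z) \<and> b \<in> carrier (val M z')}"

definition tensor ::
  "('o, 'm) cat \<Rightarrow> ('o, 'm, 'r) cmod \<Rightarrow> ('o, 'm, 'a) cmod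
    \<Rightarrow> ('o \<Rightarrow> ('r \<times> 'a \<Rightarrow>\<^sub>0 int) set) set monoid"
  where "tensor C R M = tensor_sum C R M Mod balancing_rels C R M"

definition tensor_map ::
  "('o, 'm) cat \<Rightarrow> ('o, 'm, 's) cmod \<Rightarrow> ('o, 'm, 'b) cmod \<Rightarrow> ('o \<Rightarrow> 'r \<Rightarrow> 's) \<Rightarrow> ('o \<Rightarrow> 'a \<Rightarrow> 'b)
    \<Rightarrow> ('o \<Rightarrow> ('r \<times> 'a \<Rightarrow>\<^sub>0 int) set) set \<Rightarrow> ('o \<Rightarrow> ('s \<times> 'b \<Rightarrow>\<^sub>0 int) set) set"
  where "tensor_map C R' M' \<rho> \<mu> X =
    balancing_rels C R' M' <#>\<^bsub>tensor_sum C R' M'\<^esub>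
      ((\<lambda>t. \<lambda>z \<in> obj C. tensor_group_map (val R' z) (val M' z) (\<rho> z) (\<mu> z) (t z)) ` X)"


section \<open>The induced module over the enveloping groupoid\<close>

definition free_hom_module :: "('o, 'm) cat \<Rightarrow> 'o \<Rightarrow> ('o, 'm, ('o, 'm) fraction \<Rightarrow>\<^sub>0 int) cmod"
  where "free_hom_module C x = \<lparr>
    val = (\<lambda>y. free_Abelian_group (Hom (env_groupoid C) x y)),
    act = (\<lambda>d. frag_extend (\<lambda>g. frag_of (cmp (env_groupoid C) g (env_map C d))))\<rparr>"

definition induced_module ::
  "('o, 'm) cat \<Rightarrow> ('o, 'm, 'a) cmod
    \<Rightarrow> ('o, ('o, 'm) fraction, ('o \<Rightarrow> ((('o, 'm) fraction \<Rightarrow>\<^sub>0 int) \<times> 'a \<Rightarrow>\<^sub>0 int) set) set) cmod"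
  where "induced_module C M = \<lparr>
    val = (\<lambda>x. tensor C (free_hom_module C x) M),
    act = (\<lambda>h. tensor_map C (free_hom_module C (src (env_groupoid C) h)) M
                 (\<lambda>_. frag_extend (\<lambda>g. frag_of (cmp (env_groupoid C) h g))) (\<lambda>_ b. b))\<rparr>"


section \<open>Projective resolutions and derived functors\<close>

text \<open>Projectivity is the lifting property against epimorphisms. HOL forces the modules in such a
  definition to live in a fixed type, so a type is used that is closed under forming free modules:
  formal integral combinations of pairs of a morphism and an element of \<open>('m, 'a) univ\<close> can again be
  encoded in \<open>('m, 'a) univ\<close>. Therefore nothing is lost: the lifting property within
  this type implies it for modules in arbitrary types (\<open>projective_lift\<close>), and every module with
  elements in \<open>'a\<close> has a projective resolution in this type (\<open>projective_resolution_exists\<close>).\<close>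

datatype ('m, 'a) univ = Base 'a | Comb "(('m \<times> ('m, 'a) univ) \<times> int) list"

type_synonym ('o, 'm, 'a) umod = "('o, 'm, ('m, 'a) univ) cmod"

definition projective :: "('o, 'm) cat \<Rightarrow> ('o, 'm, 'a) umod \<Rightarrow> bool"
  where "projective C P \<longleftrightarrow> left_module C P \<and>
    (\<forall>(A :: ('o, 'm, 'a) umod) (B :: ('o, 'm, 'a) umod) p \<theta>.
       left_module C A \<and> left_module C B \<and> module_epi C A B p \<and> module_hom C P B \<theta> \<longrightarrow>
       (\<exists>\<psi>. module_hom C P A \<psi> \<and> (\<forall>x \<in> obj C. \<forall>a \<in> carrier (val P x). p x (\<psi> x a) = \<theta> x a)))"

text \<open>\<open>\<dots> \<rightarrow> P 2 \<rightarrow> P 1 \<rightarrow> P 0 \<rightarrow> M \<rightarrow> 0\<close> with \<open>\<delta> n : P (Suc n) \<rightarrow> P n\<close> and augmentation \<open>\<epsilon>\<close>\<close>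

definition projective_resolution ::
  "('o, 'm) cat \<Rightarrow> ('o, 'm, 'a) cmod \<Rightarrow> (nat \<Rightarrow> ('o, 'm, 'a) umod)
    \<Rightarrow> (nat \<Rightarrow> 'o \<Rightarrow> ('m, 'a) univ \<Rightarrow> ('m, 'a) univ) \<Rightarrow> ('o \<Rightarrow> ('m, 'a) univ \<Rightarrow> 'a) \<Rightarrow> bool"
  where "projective_resolution C M P \<delta> \<epsilon> \<longleftrightarrow>
    (\<forall>n. projective C (P n)) \<and>
    (\<forall>n. module_hom C (P (Suc n)) (P n) (\<delta> n)) \<and>
    module_epi C (P 0) M \<epsilon> \<and>
    (\<forall>x \<in> obj C. \<delta> 0 x ` carrier (val (P (Suc 0)) x) = kernel (val (P 0) x) (val M x) (\<epsilon> x)) \<and>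
    (\<forall>n. \<forall>x \<in> obj C. \<delta> (Suc n) x ` carrier (val (P (Suc (Suc n))) x) =
            kernel (val (P (Suc n)) x) (val (P n) x) (\<delta> n x))"

definition chosen_resolution ::
  "('o, 'm) cat \<Rightarrow> ('o, 'm, 'a) cmod
    \<Rightarrow> (nat \<Rightarrow> ('o, 'm, 'a) umod) \<times> (nat \<Rightarrow> 'o \<Rightarrow> ('m, 'a) univ \<Rightarrow> ('m, 'a) univ)"
  where "chosen_resolution C M = (SOME (P, \<delta>). \<exists>\<epsilon>. projective_resolution C M P \<delta> \<epsilon>)"

fun cycles :: "(nat \<Rightarrow> 'a monoid) \<Rightarrow> (nat \<Rightarrow> 'a \<Rightarrow> 'a) \<Rightarrow> nat \<Rightarrow> 'a set" where
  "cycles A d 0 = carrier (A 0)"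
| "cycles A d (Suc n) = kernel (A (Suc n)) (A n) (d n)"

definition homology_group :: "(nat \<Rightarrow> 'a monoid) \<Rightarrow> (nat \<Rightarrow> 'a \<Rightarrow> 'a) \<Rightarrow> nat \<Rightarrow> 'a set monoid"
  where "homology_group A d n =
    (A n)\<lparr>carrier := cycles A d n\<rparr> Mod (d n ` carrier (A (Suc n)))"

text \<open>The \<open>n\<close>-th left-derived functor of \<open>R \<otimes>\<^sub>C _\<close> at \<open>M\<close>.\<close>

definition Tor ::
  "('o, 'm) cat \<Rightarrow> nat \<Rightarrow> ('o, 'm, 'r) cmod \<Rightarrow> ('o, 'm, 'a) cmod
    \<Rightarrow> ('o \<Rightarrow> ('r \<times> ('m, 'a) univ \<Rightarrow>\<^sub>0 int) set) set set monoid"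
  where "Tor C n R M = (case chosen_resolution C M of (P, \<delta>) \<Rightarrow>
    homology_group (\<lambda>k. tensor C R (P k)) (\<lambda>k. tensor_map C R (P k) (\<lambda>_ r. r) (\<delta> k)) n)"

definition cat_homology ::
  "nat \<Rightarrow> ('o, 'm) cat \<Rightarrow> ('o, 'm, 'a) cmod
    \<Rightarrow> ('o \<Rightarrow> (int \<times> ('m, 'a) univ \<Rightarrow>\<^sub>0 int) set) set set monoid"
  where "cat_homology n C M = Tor C n trivial_module M"


lemma (in category) Hom_obj: "f \<in> Hom C x y \<Longrightarrow> x \<in> obj C \<and> y \<in> obj C"
  using src_obj tgt_obj by (auto simp: Hom_def)

section \<open>Existence of projective resolutions\<close>

lemma module_hom_closed:
  "\<lbrakk>module_hom C M N \<theta>; x \<in> obj C; a \<in> carrier (val M x)\<rbrakk> \<Longrightarrow> \<theta> x a \<in> carrier (val N x)"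
  unfolding module_hom_def hom_def by blast

lemma module_hom_compose:
  assumes "module_hom C L M \<theta>" "module_hom C M N \<eta>" "left_module C L"
  shows "module_hom C L N (\<lambda>x a. \<eta> x (\<theta> x a))"
proof -
  interpret left_module C L by fact
  note mem = module_hom_closed[OF assms(1)]
  have "(\<lambda>a. \<eta> x (\<theta> x a)) \<in> hom (val L x) (val N x)" if "x \<in> obj C" for x
    using assms(1,2) that hom_compose[of "\<theta> x" "val L x" "val M x" "\<eta> x" "val N x"]
    unfolding module_hom_def comp_def by blast
  moreover have "\<eta> x (\<theta> x (act L f a)) = act N f (\<eta> y (\<theta> y a))"
    if "f \<in> Hom C x y" "a \<in> carrier (val L y)" for x y f a
    using assms(1,2) that mem Hom_obj[OF that(1)] unfolding module_hom_def by simp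
  ultimately show ?thesis unfolding module_hom_def by blast
qed

subsection \<open>Transport of structure and kernels\<close>

definition transport_module ::
  "('a \<Rightarrow> 'b) \<Rightarrow> ('b \<Rightarrow> 'a) \<Rightarrow> ('o, 'm, 'a) cmod \<Rightarrow> ('o, 'm, 'b) cmod"
  where "transport_module e r M = \<lparr>
    val = (\<lambda>x. \<lparr>carrier = e ` carrier (val M x),
      monoid.mult = (\<lambda>a b. e (r a \<otimes>\<^bsub>val M x\<^esub> r b)), one = e \<one>\<^bsub>val M x\<^esub>\<rparr>),
    act = (\<lambda>f a. e (act M f (r a)))\<rparr>"

lemma transport_module:
  assumes "left_module C M" and r: "\<And>a. r (e a) = a"
  shows left_module_transport: "left_module C (transport_module e r M)"
    and transport_hom: "module_hom C M (transport_module e r M) (\<lambda>_. e)"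
    and transport_epi: "module_epi C (transport_module e r M) M (\<lambda>_. r)"
proof -
  interpret left_module C M by fact
  let ?T = "transport_module e r M"
  have act_closed: "act M f a \<in> carrier (val M x)" if "f \<in> Hom C x y" "a \<in> carrier (val M y)" for f x y a
    using act_hom[OF that(1)] that(2) by (auto simp: hom_def)
  have 1: "comm_group (val ?T x)" if "x \<in> obj C" for x
  proof -
    interpret comm_group "val M x" using val_comm_group[OF that] .
    show ?thesis
    proof (rule comm_groupI)
      fix a assume "a \<in> carrier (val ?T x)"
      then obtain a' where a: "a' \<in> carrier (val M x)" "a = e a'" by (auto simp: transport_module_def)
      show "\<exists>b\<in>carrier (val ?T x). b \<otimes>\<^bsub>val ?T x\<^esub> a = \<one>\<^bsub>val ?T x\<^esub>"
        by (rule bexI[of _ "e (inv\<^bsub>val M x\<^esub> a')"]) (use a in \<open>auto simp: transport_module_def r\<close>)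
    qed (auto simp: transport_module_def r m_ac)
  qed
  show "left_module C ?T"
  proof (intro left_module.intro left_module_axioms.intro)
    fix f x y assume f: "f \<in> Hom C x y"
    show "act ?T f \<in> hom (val ?T y) (val ?T x)"
      using act_hom[OF f] unfolding hom_def by (auto simp: transport_module_def r)
  qed (use 1 act_idn act_cmp act_closed category_axioms in \<open>auto simp: transport_module_def r\<close>)
  show "module_hom C M (transport_module e r M) (\<lambda>_. e)"
    by (auto simp: module_hom_def hom_def transport_module_def r)
  show "module_epi C (transport_module e r M) M (\<lambda>_. r)"
    using val_comm_group act_closed
    by (auto simp: module_epi_def module_hom_def hom_def transport_module_def r image_image
       comm_group_def comm_monoid_def monoid.m_closed)
qed

lemma comm_group_restrict:
  assumes "comm_group G" "subgroup S G"
  shows "comm_group (G\<lparr>carrier := S\<rparr>)"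
proof -
  interpret comm_group G by fact
  have "group (G\<lparr>carrier := S\<rparr>)" using assms(2) subgroup_imp_group by blast
  then show ?thesis
    by (rule group.group_comm_groupI) (use subgroup.mem_carrier[OF assms(2)] in \<open>simp add: m_comm\<close>)
qed

definition kernel_module ::
  "('o, 'm, 'a) cmod \<Rightarrow> ('o, 'm, 'b) cmod \<Rightarrow> ('o \<Rightarrow> 'a \<Rightarrow> 'b) \<Rightarrow> ('o, 'm, 'a) cmod"
  where "kernel_module M N \<theta> = \<lparr>
    val = (\<lambda>x. (val M x)\<lparr>carrier := kernel (val M x) (val N x) (\<theta> x)\<rparr>), act = act M\<rparr>"

lemma left_module_kernel:
  assumes "left_module C M" "left_module C N" and h: "module_hom C M N \<theta>"
  shows "left_module C (kernel_module M N \<theta>)"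
proof -
  interpret M: left_module C M by fact
  interpret N: left_module C N by fact
  let ?K = "kernel_module M N \<theta>"
  have gh: "group_hom (val M x) (val N x) (\<theta> x)" if "x \<in> obj C" for x
    using h that M.val_comm_group N.val_comm_group
    by (auto simp: module_hom_def group_hom_def group_hom_axioms_def comm_group_def)
  show ?thesis
  proof (intro left_module.intro left_module_axioms.intro)
    fix x assume x: "x \<in> obj C"
    have "subgroup (kernel (val M x) (val N x) (\<theta> x)) (val M x)"
      using group_hom.subgroup_kernel[OF gh[OF x]] .
    then show "comm_group (val ?K x)"
      using comm_group_restrict[OF M.val_comm_group[OF x]] by (simp add: kernel_module_def)
  next
    fix f x y assume f: "f \<in> Hom C x y"
    have xy: "x \<in> obj C" "y \<in> obj C" using M.Hom_obj[OF f] by auto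
    have "act N f \<one>\<^bsub>val N y\<^esub> = \<one>\<^bsub>val N x\<^esub>"
      using hom_one[OF N.act_hom[OF f]] N.val_comm_group xy by (simp add: comm_group_def)
    then have "act M f a \<in> kernel (val M x) (val N x) (\<theta> x)"
      if "a \<in> kernel (val M y) (val N y) (\<theta> y)" for a
      using that h f M.act_hom[OF f] by (auto simp: kernel_def module_hom_def hom_def)
    then show "act ?K f \<in> hom (val ?K y) (val ?K x)"
      using M.act_hom[OF f] by (auto simp: hom_def kernel_module_def kernel_def)
  qed (auto simp: kernel_module_def kernel_def M.act_idn M.act_cmp M.category_axioms)
qed

subsection \<open>Free covers\<close>

definition free_basis :: "('o, 'm) cat \<Rightarrow> ('o, 'm, 'a) cmod \<Rightarrow> 'o \<Rightarrow> ('m \<times> 'a) set"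
  where "free_basis C N x = {(f, b). f \<in> mor C \<and> src C f = x \<and> b \<in> carrier (val N (tgt C f))}"

definition free_cover :: "('o, 'm) cat \<Rightarrow> ('o, 'm, 'a) cmod \<Rightarrow> ('o, 'm, 'm \<times> 'a \<Rightarrow>\<^sub>0 int) cmod"
  where "free_cover C N = \<lparr>
    val = (\<lambda>x. free_Abelian_group (free_basis C N x)),
    act = (\<lambda>f. frag_extend (\<lambda>(g, b). frag_of (cmp C f g, b)))\<rparr>"

lemma frag_extend_hom:
  assumes "\<And>s. s \<in> S \<Longrightarrow> Poly_Mapping.keys (f s) \<subseteq> T"
  shows "frag_extend f \<in> hom (free_Abelian_group S) (free_Abelian_group T)"
proof (rule homI)
  fix x assume "x \<in> carrier (free_Abelian_group S)"
  then show "frag_extend f x \<in> carrier (free_Abelian_group T)"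
    using keys_frag_extend[of f x] assms by fastforce
qed (simp add: frag_extend_add)

lemma hom_free_eqI:
  assumes "h \<in> hom (free_Abelian_group S) G" "k \<in> hom (free_Abelian_group S) G" "group G"
    and "\<And>s. s \<in> S \<Longrightarrow> h (frag_of s) = k (frag_of s)" and "Poly_Mapping.keys c \<subseteq> S"
  shows "h c = k c"
proof -
  interpret h: group_hom "free_Abelian_group S" G h
    using assms by (auto simp: group_hom_def group_hom_axioms_def)
  interpret k: group_hom "free_Abelian_group S" G k
    using assms by (auto simp: group_hom_def group_hom_axioms_def)
  show ?thesis
  proof (rule free_Abelian_group_induct[OF assms(5), where P="\<lambda>c. h c = k c"])
    show "h 0 = k 0" using h.hom_one k.hom_one by simp
    fix x y assume xy: "Poly_Mapping.keys x \<subseteq> S" "Poly_Mapping.keys y \<subseteq> S" "h x = k x" "h y = k y"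
    have "h (x - y) = h x \<otimes>\<^bsub>G\<^esub> inv\<^bsub>G\<^esub> h y" "k (x - y) = k x \<otimes>\<^bsub>G\<^esub> inv\<^bsub>G\<^esub> k y"
      using xy h.hom_mult[of x "-y"] h.hom_inv[of y] k.hom_mult[of x "-y"] k.hom_inv[of y] by auto
    then show "h (x - y) = k (x - y)" using xy by simp
  qed (rule assms(4))
qed

lemma left_module_free_cover:
  assumes "left_module C N"
  shows "left_module C (free_cover C N)"
proof -
  interpret left_module C N by fact
  let ?F = "free_cover C N"
  have hom: "act ?F f \<in> hom (val ?F y) (val ?F x)" if f: "f \<in> Hom C x y" for f x y
    unfolding free_cover_def cmod.simps
  proof (rule frag_extend_hom)
    fix s assume "s \<in> free_basis C N y"
    moreover have "cmp C f g \<in> Hom C x (tgt C g)" if "g \<in> mor C" "src C g = y" for g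
      using cmp_Hom[OF f, of g "tgt C g"] that by (auto simp: Hom_def)
    ultimately
    show "Poly_Mapping.keys (case s of (g, b) \<Rightarrow> frag_of (cmp C f g, b)) \<subseteq> free_basis C N x"
      by (fastforce simp: free_basis_def Hom_def)
  qed
  show ?thesis
  proof (intro left_module.intro left_module_axioms.intro)
    fix x a assume x: "x \<in> obj C" and a: "a \<in> carrier (val ?F x)"
    have "act ?F (idn C x) a = (\<lambda>c. c) a"
    proof (rule hom_free_eqI[where S="free_basis C N x"])
      show "act ?F (idn C x) \<in> hom (free_Abelian_group (free_basis C N x)) (free_Abelian_group (free_basis C N x))"
        using hom[OF idn_Hom[OF x]] by (simp add: free_cover_def)
    qed (use a in \<open>auto simp: free_cover_def hom_def free_basis_def idn_left Hom_def\<close>)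
    then show "act ?F (idn C x) a = a" by simp
  next
    fix f g x y z a assume f: "f \<in> Hom C x y" and g: "g \<in> Hom C y z" and a: "a \<in> carrier (val ?F z)"
    have "act ?F (cmp C f g) a = (act ?F f \<circ> act ?F g) a"
    proof (rule hom_free_eqI[where S="free_basis C N z" and G="free_Abelian_group (free_basis C N x)"
          and h="act ?F (cmp C f g)" and k="act ?F f \<circ> act ?F g"])
      show "act ?F (cmp C f g) \<in> hom (free_Abelian_group (free_basis C N z)) (free_Abelian_group (free_basis C N x))"
        using hom[OF cmp_Hom[OF f g]] by (simp add: free_cover_def)
      show "act ?F f \<circ> act ?F g \<in> hom (free_Abelian_group (free_basis C N z)) (free_Abelian_group (free_basis C N x))"
        using hom_compose[OF hom[OF g] hom[OF f]] by (simp add: free_cover_def)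
      fix s assume "s \<in> free_basis C N z"
      then show "act ?F (cmp C f g) (frag_of s) = (act ?F f \<circ> act ?F g) (frag_of s)"
        using cmp_assoc[OF f g] by (auto simp: free_cover_def free_basis_def Hom_def)
    qed (use a in \<open>auto simp: free_cover_def\<close>)
    then show "act ?F (cmp C f g) a = act ?F f (act ?F g a)" by simp
  qed (use hom category_axioms in \<open>auto simp: free_cover_def abelian_free_Abelian_group\<close>)
qed

lemma free_cover_universal:
  fixes A :: "('o, 'm, 'b) cmod"
  assumes "left_module C N" "left_module C A"
    and l: "\<And>x b. \<lbrakk>x \<in> obj C; b \<in> carrier (val N x)\<rbrakk> \<Longrightarrow> l x b \<in> carrier (val A x)"
  obtains \<psi> where "module_hom C (free_cover C N) A \<psi>"
    "\<And>x f b. (f, b) \<in> free_basis C N x \<Longrightarrow> \<psi> x (frag_of (f, b)) = act A f (l (tgt C f) b)"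
proof -
  interpret N: left_module C N by fact
  interpret A: left_module C A by fact
  interpret F: left_module C "free_cover C N" by (rule left_module_free_cover) fact
  let ?g = "\<lambda>(f, b). act A f (l (tgt C f) b)"
  have cl: "?g s \<in> carrier (val A x)" if s: "s \<in> free_basis C N x" for x s
  proof -
    obtain f b where fb: "s = (f, b)" "f \<in> Hom C x (tgt C f)" "b \<in> carrier (val N (tgt C f))"
      using s by (auto simp: free_basis_def Hom_def)
    then show ?thesis using A.act_hom[OF fb(2)] l N.Hom_obj[OF fb(2)] by (auto simp: hom_def)
  qed
  have "\<exists>h. h \<in> hom (free_Abelian_group (free_basis C N x)) (val A x) \<and>
     (\<forall>s \<in> free_basis C N x. h (frag_of s) = ?g s)" if "x \<in> obj C" for x
    using comm_group.free_Abelian_group_universal[OF A.val_comm_group[OF that], of ?g "free_basis C N x"]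
      cl by (metis (no_types, lifting) image_subsetI)
  then have "\<forall>x\<in>obj C. \<exists>h. h \<in> hom (free_Abelian_group (free_basis C N x)) (val A x) \<and>
     (\<forall>s \<in> free_basis C N x. h (frag_of s) = ?g s)" by blast
  from bchoice[OF this]
  obtain \<psi> where psi: "\<And>x. x \<in> obj C \<Longrightarrow> \<psi> x \<in> hom (free_Abelian_group (free_basis C N x)) (val A x)"
     "\<And>x s. x \<in> obj C \<Longrightarrow> s \<in> free_basis C N x \<Longrightarrow> \<psi> x (frag_of s) = ?g s"
    by blast
  have nat: "\<psi> x (act (free_cover C N) f a) = act A f (\<psi> y a)"
    if f: "f \<in> Hom C x y" and a: "a \<in> carrier (val (free_cover C N) y)" for f x y a
  proof -
    have xy: "x \<in> obj C" "y \<in> obj C" using N.Hom_obj[OF f] by auto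
    have "(\<psi> x \<circ> act (free_cover C N) f) a = (act A f \<circ> \<psi> y) a"
    proof (rule hom_free_eqI[where S="free_basis C N y" and G="val A x"
          and h="\<psi> x \<circ> act (free_cover C N) f" and k="act A f \<circ> \<psi> y"])
      show "\<psi> x \<circ> act (free_cover C N) f \<in> hom (free_Abelian_group (free_basis C N y)) (val A x)"
        using hom_compose[OF F.act_hom[OF f], of "\<psi> x" "val A x"] psi(1)[OF xy(1)] by (simp add: free_cover_def)
      show "act A f \<circ> \<psi> y \<in> hom (free_Abelian_group (free_basis C N y)) (val A x)"
        using hom_compose[OF psi(1)[OF xy(2)] A.act_hom[OF f]] .
      show "Group.group (val A x)" using A.val_comm_group[OF xy(1)] by (simp add: comm_group_def)
      fix s assume s: "s \<in> free_basis C N y"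
      obtain g b where gb: "s = (g, b)" "g \<in> Hom C y (tgt C g)" "b \<in> carrier (val N (tgt C g))"
        using s by (auto simp: free_basis_def Hom_def)
      have fg: "cmp C f g \<in> Hom C x (tgt C g)" using N.cmp_Hom[OF f gb(2)] .
      then have t: "tgt C (cmp C f g) = tgt C g" "(cmp C f g, b) \<in> free_basis C N x"
        using gb(3) by (auto simp: free_basis_def Hom_def)
      have "\<psi> x (act (free_cover C N) f (frag_of s)) = act A (cmp C f g) (l (tgt C g) b)"
        using psi(2)[OF xy(1) t(2)] t(1) by (simp add: free_cover_def gb(1))
      also have "\<dots> = act A f (act A g (l (tgt C g) b))"
        using A.act_cmp[OF f gb(2)] l gb N.Hom_obj[OF gb(2)] by auto
      also have "\<dots> = act A f (\<psi> y (frag_of s))"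
        using psi(2)[OF xy(2) s] gb(1) by simp
      finally show "(\<psi> x \<circ> act (free_cover C N) f) (frag_of s) = (act A f \<circ> \<psi> y) (frag_of s)" by simp
    qed (use a in \<open>auto simp: free_cover_def\<close>)
    then show ?thesis by simp
  qed
  show thesis
  proof (rule that[of \<psi>])
    show "module_hom C (free_cover C N) A \<psi>"
      using nat psi(1) unfolding module_hom_def by (simp add: free_cover_def)
    show "\<psi> x (frag_of (f, b)) = act A f (l (tgt C f) b)" if "(f, b) \<in> free_basis C N x" for x f b
      using psi(2)[of x "(f, b)"] that N.src_obj by (auto simp: free_basis_def)
  qed
qed

lemma free_cover_hom_eqI:
  assumes "left_module C N" "left_module C B"
    and h: "module_hom C (free_cover C N) B \<theta>" and k: "module_hom C (free_cover C N) B \<eta>"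
    and eq: "\<And>x b. \<lbrakk>x \<in> obj C; b \<in> carrier (val N x)\<rbrakk> \<Longrightarrow> \<theta> x (frag_of (idn C x, b)) = \<eta> x (frag_of (idn C x, b))"
    and x: "x \<in> obj C" and a: "a \<in> carrier (val (free_cover C N) x)"
  shows "\<theta> x a = \<eta> x a"
proof (rule hom_free_eqI[where S="free_basis C N x" and G="val B x" and h="\<theta> x" and k="\<eta> x"])
  interpret N: left_module C N by fact
  interpret B: left_module C B by fact
  show "\<theta> x \<in> hom (free_Abelian_group (free_basis C N x)) (val B x)"
    "\<eta> x \<in> hom (free_Abelian_group (free_basis C N x)) (val B x)"
    using h k x by (auto simp: module_hom_def free_cover_def)
  show "Group.group (val B x)" using B.val_comm_group[OF x] by (simp add: comm_group_def)
  show "Poly_Mapping.keys a \<subseteq> free_basis C N x" using a by (simp add: free_cover_def)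
  fix s assume s: "s \<in> free_basis C N x"
  obtain g b where gb: "s = (g, b)" "g \<in> Hom C x (tgt C g)" "b \<in> carrier (val N (tgt C g))"
    using s by (auto simp: free_basis_def Hom_def)
  let ?y = "tgt C g"
  have y: "?y \<in> obj C" using N.Hom_obj[OF gb(2)] by simp
  have i: "frag_of (idn C ?y, b) \<in> carrier (val (free_cover C N) ?y)"
    using N.idn_Hom[OF y] gb(3) by (auto simp: free_cover_def free_basis_def Hom_def)
  have s': "frag_of s = act (free_cover C N) g (frag_of (idn C ?y, b))"
    using N.idn_right[OF gb(2)] by (simp add: free_cover_def gb(1))
  have "\<theta> x (frag_of s) = act B g (\<theta> ?y (frag_of (idn C ?y, b)))"
    using h gb(2) i unfolding s' module_hom_def by blast
  moreover have "\<eta> x (frag_of s) = act B g (\<eta> ?y (frag_of (idn C ?y, b)))"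
    using k gb(2) i unfolding s' module_hom_def by blast
  ultimately show "\<theta> x (frag_of s) = \<eta> x (frag_of s)"
    using eq[OF y gb(3)] by simp
qed

lemma free_cover_lift:
  fixes A :: "('o, 'm, 'b) cmod" and B :: "('o, 'm, 'c) cmod"
  assumes N: "left_module C N" and A: "left_module C A" and B: "left_module C B"
    and p: "module_epi C A B p" and t: "module_hom C (free_cover C N) B \<theta>"
  obtains \<psi> where "module_hom C (free_cover C N) A \<psi>"
    "\<And>x a. \<lbrakk>x \<in> obj C; a \<in> carrier (val (free_cover C N) x)\<rbrakk> \<Longrightarrow> p x (\<psi> x a) = \<theta> x a"
proof -
  interpret N: left_module C N by fact
  interpret A: left_module C A by fact
  have i: "(idn C x, b) \<in> free_basis C N x" if "x \<in> obj C" "b \<in> carrier (val N x)" for x b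
    using N.idn_Hom[OF that(1)] that(2) by (auto simp: free_basis_def Hom_def)
  have "\<exists>a. a \<in> carrier (val A x) \<and> p x a = \<theta> x (frag_of (idn C x, b))"
    if "x \<in> obj C" "b \<in> carrier (val N x)" for x b
  proof -
    have "\<theta> x (frag_of (idn C x, b)) \<in> carrier (val B x)"
      using module_hom_closed[OF t that(1)] i[OF that] by (simp add: free_cover_def)
    then show ?thesis using p that(1) unfolding module_epi_def by (metis imageE)
  qed
  then obtain l where l: "\<And>x b. \<lbrakk>x \<in> obj C; b \<in> carrier (val N x)\<rbrakk> \<Longrightarrow> l x b \<in> carrier (val A x)"
    "\<And>x b. \<lbrakk>x \<in> obj C; b \<in> carrier (val N x)\<rbrakk> \<Longrightarrow> p x (l x b) = \<theta> x (frag_of (idn C x, b))"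
    by metis
  obtain \<psi> where psi: "module_hom C (free_cover C N) A \<psi>"
    "\<And>x f b. (f, b) \<in> free_basis C N x \<Longrightarrow> \<psi> x (frag_of (f, b)) = act A f (l (tgt C f) b)"
    using free_cover_universal[OF N A, of l] l(1) by blast
  have pc: "module_hom C (free_cover C N) B (\<lambda>x a. p x (\<psi> x a))"
    using module_hom_compose[OF psi(1) _ left_module_free_cover[OF N]] p by (auto simp: module_epi_def)
  have "p x (\<psi> x a) = \<theta> x a" if xa: "x \<in> obj C" "a \<in> carrier (val (free_cover C N) x)" for x a
  proof (rule free_cover_hom_eqI[OF N B pc t _ xa])
    fix y b assume y: "y \<in> obj C" and b: "b \<in> carrier (val N y)"
    have "\<psi> y (frag_of (idn C y, b)) = l y b"
      using psi(2)[OF i[OF y b]] N.idn_Hom[OF y] A.act_idn[OF y l(1)[OF y b]] by (simp add: Hom_def)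
    then show "p y (\<psi> y (frag_of (idn C y, b))) = \<theta> y (frag_of (idn C y, b))"
      using l(2)[OF y b] by simp
  qed
  with psi(1) show thesis by (rule that)
qed

lemma free_cover_epi:
  assumes N: "left_module C N"
  obtains \<pi> where "module_epi C (free_cover C N) N \<pi>"
proof -
  interpret N: left_module C N by fact
  obtain \<pi> where pi: "module_hom C (free_cover C N) N \<pi>"
    "\<And>x f b. (f, b) \<in> free_basis C N x \<Longrightarrow> \<pi> x (frag_of (f, b)) = act N f b"
    using free_cover_universal[OF N N, of "\<lambda>x b. b"] by auto
  have "\<pi> x ` carrier (val (free_cover C N) x) = carrier (val N x)" if x: "x \<in> obj C" for x
  proof
    show "\<pi> x ` carrier (val (free_cover C N) x) \<subseteq> carrier (val N x)"
      using module_hom_closed[OF pi(1) x] by blast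
    show "carrier (val N x) \<subseteq> \<pi> x ` carrier (val (free_cover C N) x)"
    proof
      fix b assume b: "b \<in> carrier (val N x)"
      have i: "(idn C x, b) \<in> free_basis C N x"
        using N.idn_Hom[OF x] b by (auto simp: free_basis_def Hom_def)
      then have "frag_of (idn C x, b) \<in> carrier (val (free_cover C N) x)"
        by (simp add: free_cover_def)
      moreover have "\<pi> x (frag_of (idn C x, b)) = b" using pi(2)[OF i] N.act_idn[OF x b] by simp
      ultimately show "b \<in> \<pi> x ` carrier (val (free_cover C N) x)" by force
    qed
  qed
  with pi(1) show thesis by (intro that[of \<pi>]) (auto simp: module_epi_def)
qed

subsection \<open>Free covers inside the universal type\<close>

definition encode :: "('m \<times> ('m, 'a) univ \<Rightarrow>\<^sub>0 int) \<Rightarrow> ('m, 'a) univ"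
  where "encode c =
    Comb (SOME l. set l = (\<lambda>k. (k, Poly_Mapping.lookup c k)) ` Poly_Mapping.keys c)"

lemma inj_encode: "inj (encode :: ('m \<times> ('m, 'a) univ \<Rightarrow>\<^sub>0 int) \<Rightarrow> ('m, 'a) univ)"
proof (rule injI)
  fix c d :: "'m \<times> ('m, 'a) univ \<Rightarrow>\<^sub>0 int"
  let ?g = "\<lambda>c :: 'm \<times> ('m, 'a) univ \<Rightarrow>\<^sub>0 int. (\<lambda>k. (k, Poly_Mapping.lookup c k)) ` Poly_Mapping.keys c"
  assume e: "encode c = encode d"
  define g where "g c = ?g c" for c
  define l where "l c = (SOME l. set l = g c)" for c
  have s: "set (l c) = g c" for c
    unfolding l_def by (rule someI_ex) (simp add: finite_list g_def)
  have "l c = l d" using e by (simp add: encode_def l_def g_def)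
  then have "g c = g d" using s[of c] s[of d] by simp
  then have g: "?g c = ?g d" unfolding g_def .
  show "c = d"
  proof (rule poly_mapping_eqI)
    fix k
    have "(k, Poly_Mapping.lookup c k) \<in> ?g d" if "k \<in> Poly_Mapping.keys c" using that g by blast
    moreover have "(k, Poly_Mapping.lookup d k) \<in> ?g c" if "k \<in> Poly_Mapping.keys d" using that g by blast
    ultimately show "Poly_Mapping.lookup c k = Poly_Mapping.lookup d k"
      by (cases "k \<in> Poly_Mapping.keys c"; cases "k \<in> Poly_Mapping.keys d") (auto simp: in_keys_iff)
  qed
qed

definition univ_cover :: "('o, 'm) cat \<Rightarrow> ('o, 'm, 'a) umod \<Rightarrow> ('o, 'm, 'a) umod"
  where "univ_cover C N = transport_module encode (inv_into UNIV encode) (free_cover C N)"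

lemma left_module_univ_cover: "left_module C N \<Longrightarrow> left_module C (univ_cover C N)"
  unfolding univ_cover_def
  by (rule left_module_transport[OF left_module_free_cover]) (simp_all add: inj_encode)

lemma module_epi_compose:
  assumes "module_epi C L M \<theta>" "module_epi C M N \<eta>" "left_module C L"
  shows "module_epi C L N (\<lambda>x a. \<eta> x (\<theta> x a))"
  using assms module_hom_compose[OF _ _ assms(3), of M \<theta> N \<eta>] unfolding module_epi_def
  by (simp add: image_image[symmetric])

lemma univ_cover_epi:
  assumes N: "left_module C N"
  obtains \<pi> where "module_epi C (univ_cover C N) N \<pi>"
proof -
  obtain \<pi> where "module_epi C (free_cover C N) N \<pi>" using free_cover_epi[OF N] .
  with transport_epi[OF left_module_free_cover[OF N], of "inv_into UNIV encode" encode]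
  have "module_epi C (univ_cover C N) N (\<lambda>x a. \<pi> x (inv_into UNIV encode a))"
    using module_epi_compose[of C "univ_cover C N" "free_cover C N" "\<lambda>_. inv_into UNIV encode" N \<pi>]
      left_module_univ_cover[OF N] by (simp add: univ_cover_def inj_encode)
  then show thesis by (rule that)
qed

lemma univ_cover_lift:
  fixes A :: "('o, 'm, 'b) cmod" and B :: "('o, 'm, 'c) cmod"
  assumes N: "left_module C N" and A: "left_module C A" and B: "left_module C B"
    and p: "module_epi C A B p" and t: "module_hom C (univ_cover C N) B \<theta>"
  obtains \<psi> where "module_hom C (univ_cover C N) A \<psi>"
    "\<And>x a. \<lbrakk>x \<in> obj C; a \<in> carrier (val (univ_cover C N) x)\<rbrakk> \<Longrightarrow> p x (\<psi> x a) = \<theta> x a"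
proof -
  note F = left_module_free_cover[OF N]
  have h: "module_hom C (free_cover C N) (univ_cover C N) (\<lambda>_. encode)"
    unfolding univ_cover_def by (rule transport_hom[OF F]) (simp add: inj_encode)
  have e: "module_hom C (univ_cover C N) (free_cover C N) (\<lambda>_. inv_into UNIV encode)"
    using transport_epi[OF F, of "inv_into UNIV encode" encode] unfolding univ_cover_def module_epi_def
    by (simp add: inj_encode)
  have t': "module_hom C (free_cover C N) B (\<lambda>x a. \<theta> x (encode a))"
    using module_hom_compose[OF h t F] .
  obtain \<psi> where psi: "module_hom C (free_cover C N) A \<psi>"
    "\<And>x a. \<lbrakk>x \<in> obj C; a \<in> carrier (val (free_cover C N) x)\<rbrakk> \<Longrightarrow> p x (\<psi> x a) = \<theta> x (encode a)"
    using free_cover_lift[OF N A B p t'] by blast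
  show thesis
  proof (rule that[of "\<lambda>x a. \<psi> x (inv_into UNIV encode a)"])
    show "module_hom C (univ_cover C N) A (\<lambda>x a. \<psi> x (inv_into UNIV encode a))"
      using module_hom_compose[OF e psi(1) left_module_univ_cover[OF N]] .
    fix x a assume x: "x \<in> obj C" and a: "a \<in> carrier (val (univ_cover C N) x)"
    obtain a' where "a = encode a'" "a' \<in> carrier (val (free_cover C N) x)"
      using a by (auto simp: univ_cover_def transport_module_def)
    then show "p x (\<psi> x (inv_into UNIV encode a)) = \<theta> x a" using psi(2)[OF x] by (simp add: inj_encode)
  qed
qed

lemma projective_univ_cover:
  assumes "left_module C N" shows "projective C (univ_cover C N)"
  unfolding projective_def
proof (intro conjI allI impI)
  show "left_module C (univ_cover C N)" by (rule left_module_univ_cover) fact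
  fix A B p \<theta>
  assume "left_module C A \<and> left_module C B \<and> module_epi C A B p \<and> module_hom C (univ_cover C N) B \<theta>"
  then show "\<exists>\<psi>. module_hom C (univ_cover C N) A \<psi> \<and>
     (\<forall>x\<in>obj C. \<forall>a\<in>carrier (val (univ_cover C N) x). p x (\<psi> x a) = \<theta> x a)"
    using univ_cover_lift[OF assms, of A B p \<theta>] by metis
qed

theorem projective_lift:
  fixes A :: "('o, 'm, 'b) cmod" and B :: "('o, 'm, 'c) cmod"
  assumes P: "projective C P" and A: "left_module C A" and B: "left_module C B"
    and p: "module_epi C A B p" and t: "module_hom C P B \<theta>"
  obtains \<psi> where "module_hom C P A \<psi>"
    "\<And>x a. \<lbrakk>x \<in> obj C; a \<in> carrier (val P x)\<rbrakk> \<Longrightarrow> p x (\<psi> x a) = \<theta> x a"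
proof -
  have LP: "left_module C P" using P by (simp add: projective_def)
  note LU = left_module_univ_cover[OF LP]
  obtain \<pi> where pi: "module_epi C (univ_cover C P) P \<pi>" using univ_cover_epi[OF LP] .
  have "module_hom C P P (\<lambda>x a. a)" by (auto simp: module_hom_def hom_def)
  then obtain \<sigma> where sigma: "module_hom C P (univ_cover C P) \<sigma>"
    "\<And>x a. \<lbrakk>x \<in> obj C; a \<in> carrier (val P x)\<rbrakk> \<Longrightarrow> \<pi> x (\<sigma> x a) = a"
    using P LU LP pi unfolding projective_def by metis
  have "module_hom C (univ_cover C P) B (\<lambda>x a. \<theta> x (\<pi> x a))"
    using module_hom_compose[OF _ t LU] pi by (simp add: module_epi_def)
  then obtain \<psi> where psi: "module_hom C (univ_cover C P) A \<psi>"
    "\<And>x a. \<lbrakk>x \<in> obj C; a \<in> carrier (val (univ_cover C P) x)\<rbrakk> \<Longrightarrow> p x (\<psi> x a) = \<theta> x (\<pi> x a)"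
    using univ_cover_lift[OF LP A B p] by blast
  show thesis
  proof (rule that[of "\<lambda>x a. \<psi> x (\<sigma> x a)"])
    show "module_hom C P A (\<lambda>x a. \<psi> x (\<sigma> x a))" by (rule module_hom_compose[OF sigma(1) psi(1) LP])
    fix x a assume x: "x \<in> obj C" and a: "a \<in> carrier (val P x)"
    have "\<sigma> x a \<in> carrier (val (univ_cover C P) x)"
      using module_hom_closed[OF sigma(1) x a] .
    then show "p x (\<psi> x (\<sigma> x a)) = \<theta> x a" using psi(2)[OF x] sigma(2)[OF x a] by simp
  qed
qed

theorem projective_resolution_exists:
  fixes C :: "('o, 'm) cat" and M :: "('o, 'm, 'a) cmod"
  assumes M: "left_module C M"
  obtains P \<delta> \<epsilon> where "projective_resolution C M P \<delta> \<epsilon>"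
proof -
  define r :: "('m, 'a) univ \<Rightarrow> 'a" where "r = (\<lambda>u. case u of Base a \<Rightarrow> a | Comb _ \<Rightarrow> undefined)"
  have rB: "r (Base a) = a" for a by (simp add: r_def)
  define M0 where "M0 = transport_module Base r M"
  have M0: "left_module C M0" and r: "module_epi C M0 M (\<lambda>_. r)"
    unfolding M0_def using left_module_transport[OF M, of r Base] transport_epi[OF M, of r Base] rB by auto
  define cov where "cov N = (SOME \<pi>. module_epi C (univ_cover C N) N \<pi>)" for N :: "('o, 'm, 'a) umod"
  have cov: "module_epi C (univ_cover C N) N (cov N)" if N: "left_module C N" for N
  proof -
    obtain \<pi> where "module_epi C (univ_cover C N) N \<pi>" by (rule univ_cover_epi[OF N])
    then have "\<exists>\<pi>. module_epi C (univ_cover C N) N \<pi>" by - (rule exI)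
    then show ?thesis unfolding cov_def by (rule someI_ex)
  qed
  define K where "K n = ((\<lambda>N. kernel_module (univ_cover C N) N (cov N)) ^^ n) M0" for n
  have K0: "K 0 = M0" and KS: "K (Suc n) = kernel_module (univ_cover C (K n)) (K n) (cov (K n))" for n
    by (simp_all add: K_def)
  have K: "left_module C (K n)" for n
  proof (induction n)
    case (Suc n)
    then show ?case unfolding KS
      using left_module_kernel[OF left_module_univ_cover[OF Suc] Suc] cov[OF Suc]
      by (simp add: module_epi_def)
  qed (simp add: K0 M0)
  define P where "P n = univ_cover C (K n)" for n
  have P: "left_module C (P n)" for n unfolding P_def by (rule left_module_univ_cover[OF K])
  define \<delta> where "\<delta> n = cov (K (Suc n))" for n
  have im: "\<delta> n x ` carrier (val (P (Suc n)) x) = kernel (val (P n) x) (val (K n) x) (cov (K n) x)"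
    if "x \<in> obj C" for n x
    using cov[OF K[of "Suc n"]] that
    by (simp add: module_epi_def P_def \<delta>_def) (simp add: KS kernel_module_def)
  have d: "module_hom C (P (Suc n)) (P n) (\<delta> n)" for n
  proof -
    have "module_hom C (P (Suc n)) (K (Suc n)) (\<delta> n)"
      using cov[OF K[of "Suc n"]] by (simp add: module_epi_def P_def \<delta>_def)
    then show ?thesis
      unfolding KS kernel_module_def P_def module_hom_def hom_def by (auto simp: kernel_def)
  qed
  have one: "r \<one>\<^bsub>val M0 x\<^esub> = \<one>\<^bsub>val M x\<^esub>" for x
    by (simp add: M0_def transport_module_def rB)
  have "projective_resolution C M P \<delta> (\<lambda>x a. r (cov M0 x a))"
    unfolding projective_resolution_def
  proof (intro conjI allI ballI)
    show "projective C (P n)" for n unfolding P_def by (rule projective_univ_cover[OF K])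
    show "module_epi C (P 0) M (\<lambda>x a. r (cov M0 x a))"
      using module_epi_compose[OF cov[OF M0] r left_module_univ_cover[OF M0]] by (simp add: P_def K0)
    fix x assume x: "x \<in> obj C"
    have mem: "cov M0 x a \<in> Base ` carrier (val M x)" if "a \<in> carrier (val (P 0) x)" for a
    proof -
      have "cov M0 x a \<in> carrier (val M0 x)"
        using cov[OF M0] module_hom_closed[OF _ x, of "P 0" M0 "cov M0" a] that
        by (simp add: P_def K0 module_epi_def)
      then show ?thesis by (simp add: M0_def transport_module_def)
    qed
    have "(cov M0 x a = \<one>\<^bsub>val M0 x\<^esub>) = (r (cov M0 x a) = \<one>\<^bsub>val M x\<^esub>)"
      if "a \<in> carrier (val (P 0) x)" for a
      using mem[OF that] by (auto simp: M0_def transport_module_def rB)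
    then show "\<delta> 0 x ` carrier (val (P (Suc 0)) x) =
        kernel (val (P 0) x) (val M x) ((\<lambda>a. r (cov M0 x a)))"
      unfolding im[OF x] by (auto simp: kernel_def K0)
  next
    fix n x assume x: "x \<in> obj C"
    show "\<delta> (Suc n) x ` carrier (val (P (Suc (Suc n))) x) =
        kernel (val (P (Suc n)) x) (val (P n) x) (\<delta> n x)"
      unfolding im[OF x] by (simp add: kernel_def KS kernel_module_def \<delta>_def P_def)
  qed (rule d)
  then show thesis by (rule that)
qed

corollary chosen_resolution:
  assumes "left_module C M"
  obtains P \<delta> \<epsilon> where "chosen_resolution C M = (P, \<delta>)" "projective_resolution C M P \<delta> \<epsilon>"
proof -
  obtain P \<delta> \<epsilon> where "projective_resolution C M P \<delta> \<epsilon>" using projective_resolution_exists[OF assms] .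
  then have "\<exists>x. case x of (P, \<delta>) \<Rightarrow> \<exists>\<epsilon>. projective_resolution C M P \<delta> \<epsilon>" by auto
  from someI_ex[OF this]
  have "case chosen_resolution C M of (P, \<delta>) \<Rightarrow> \<exists>\<epsilon>. projective_resolution C M P \<delta> \<epsilon>"
    unfolding chosen_resolution_def .
  then show thesis using that by (cases "chosen_resolution C M") auto
qed

section \<open>The enveloping groupoid is a groupoid\<close>

lemma zigzag_append: "zigzag C x u y \<Longrightarrow> zigzag C y v z \<Longrightarrow> zigzag C x (u @ v) z"
  by (induction rule: zigzag.induct) (auto intro: zigzag.intros)

context category
begin

lemma zigzag_obj: "zigzag C x w y \<Longrightarrow> x \<in> obj C \<and> y \<in> obj C"
  by (induction rule: zigzag.induct) (use Hom_obj in auto)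

lemma zigzag_pos: "f \<in> Hom C x y \<Longrightarrow> zigzag C x [(f, True)] y"
  and zigzag_neg: "f \<in> Hom C x y \<Longrightarrow> zigzag C y [(f, False)] x"
  using Hom_obj by (auto intro!: zigzag.intros)

lemma word_eq_zigzag: "word_eq C x u v y \<Longrightarrow> zigzag C x u y \<and> zigzag C x v y"
  by (induction rule: word_eq.induct)
    (use Hom_obj in \<open>auto intro!: zigzag_append zigzag.intros idn_Hom cmp_Hom\<close>)

lemma word_class_eq: "word_eq C x u v y \<Longrightarrow> word_class C x u y = word_class C x v y"
  unfolding word_class_def by (auto intro: we_sym we_trans)

lemma env_obj [simp]: "obj (env_groupoid C) = obj C"
  by (simp add: env_groupoid_def)

lemma env_Hom: "Hom (env_groupoid C) x y = {word_class C x w y | w. zigzag C x w y}"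
  by (auto simp: Hom_def env_groupoid_def word_class_def)

lemma env_idn: "idn (env_groupoid C) x = word_class C x [] x"
  by (simp add: env_groupoid_def)

lemma env_cmp:
  assumes "zigzag C x u y" "zigzag C y v z"
  shows "cmp (env_groupoid C) (word_class C x u y) (word_class C y v z) = word_class C x (u @ v) z"
proof -
  have "(\<exists>u'. word_eq C x u u' y \<and> (\<exists>v'. word_eq C y v v' z \<and> word_eq C x (u' @ v') w z))
      \<longleftrightarrow> word_eq C x (u @ v) w z" for w
    using assms by (meson we_append we_refl we_trans)
  then show ?thesis by (simp add: env_groupoid_def word_class_def)
qed

theorem category_env: "category (env_groupoid C)"
proof
  fix f assume "f \<in> mor (env_groupoid C)"
  then show "src (env_groupoid C) f \<in> obj (env_groupoid C)"
    "tgt (env_groupoid C) f \<in> obj (env_groupoid C)"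
    using zigzag_obj by (auto simp: env_groupoid_def word_class_def)
next
  fix x assume "x \<in> obj (env_groupoid C)"
  then show "idn (env_groupoid C) x \<in> Hom (env_groupoid C) x x"
    by (auto simp: env_Hom env_idn intro: zigzag.intros)
next
  fix f g x y z assume "f \<in> Hom (env_groupoid C) x y" "g \<in> Hom (env_groupoid C) y z"
  then show "cmp (env_groupoid C) f g \<in> Hom (env_groupoid C) x z"
    by (auto simp: env_Hom env_cmp intro: zigzag_append)
next
  fix f g h w x y z
  assume "f \<in> Hom (env_groupoid C) w x" "g \<in> Hom (env_groupoid C) x y" "h \<in> Hom (env_groupoid C) y z"
  then show "cmp (env_groupoid C) (cmp (env_groupoid C) f g) h =
      cmp (env_groupoid C) f (cmp (env_groupoid C) g h)"
    by (auto simp: env_Hom env_cmp zigzag_append)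
next
  fix f x y assume "f \<in> Hom (env_groupoid C) x y"
  then obtain w where w: "f = word_class C x w y" "zigzag C x w y" by (auto simp: env_Hom)
  then show "cmp (env_groupoid C) (idn (env_groupoid C) x) f = f"
    "cmp (env_groupoid C) f (idn (env_groupoid C) y) = f"
    using zigzag_obj[OF w(2)] env_cmp[of x "[]" x w y] env_cmp[of x w y "[]" y]
    by (auto simp: env_idn intro: zigzag.intros)
qed

lemma env_map_Hom: "f \<in> Hom C x y \<Longrightarrow> env_map C f = word_class C x [(f, True)] y"
  by (simp add: env_map_def Hom_def)

theorem env_map_functor: "cat_functor C (env_groupoid C) (\<lambda>x. x) (env_map C)"
proof (intro cat_functor.intro cat_functor_axioms.intro)
  show "category C" "category (env_groupoid C)" by (rule category_axioms category_env)+
  fix f x y assume f: "f \<in> Hom C x y"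
  then show "env_map C f \<in> Hom (env_groupoid C) x y"
    using zigzag_pos by (auto simp: env_map_Hom env_Hom)
  fix g z assume g: "g \<in> Hom C y z"
  show "env_map C (cmp C f g) = cmp (env_groupoid C) (env_map C f) (env_map C g)"
    using word_class_eq[OF we_cmp[OF f g]] cmp_Hom[OF f g]
    by (simp add: env_map_Hom[OF f] env_map_Hom[OF g] env_map_Hom env_cmp zigzag_pos[OF f] zigzag_pos[OF g])
next
  fix x assume "x \<in> obj C"
  then show "env_map C (idn C x) = idn (env_groupoid C) x"
    using idn_Hom env_map_Hom word_class_eq[OF we_idn] by (metis env_idn)
qed auto

theorem env_inverse:
  assumes "f \<in> Hom (env_groupoid C) x y"
  shows "\<exists>g \<in> Hom (env_groupoid C) y x. cmp (env_groupoid C) f g = idn (env_groupoid C) x \<and>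
    cmp (env_groupoid C) g f = idn (env_groupoid C) y"
proof -
  have "\<exists>v. zigzag C y v x \<and> word_eq C x (w @ v) [] x \<and> word_eq C y (v @ w) [] y" if "zigzag C x w y" for w
    using that
  proof (induction rule: zigzag.induct)
    case (zz_Nil x)
    then show ?case using we_refl zigzag.zz_Nil by fastforce
  next
    case (zz_pos f x y w z)
    then obtain v where v: "zigzag C z v y" "word_eq C y (w @ v) [] y" "word_eq C z (v @ w) [] z" by blast
    note f = \<open>f \<in> Hom C x y\<close>
    have xy: "x \<in> obj C" "y \<in> obj C" using Hom_obj[OF f] by auto
    have "word_eq C x ([(f, True)] @ (w @ v) @ [(f, False)]) ([(f, True)] @ [] @ [(f, False)]) x"
      by (intro we_append[OF we_refl[OF zigzag_pos[OF f]]] we_append[OF v(2)] we_refl zigzag_neg f)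
    then have 1: "word_eq C x (((f, True) # w) @ v @ [(f, False)]) [] x"
      using we_trans we_inv_right[OF xy(1) f] by fastforce
    have "word_eq C z (v @ [(f, False), (f, True)] @ w) (v @ [] @ w) z"
      by (intro we_append[OF we_refl[OF v(1)]] we_append[OF we_inv_left[OF xy(2) f]] we_refl zz_pos)
    then have 2: "word_eq C z ((v @ [(f, False)]) @ ((f, True) # w)) [] z"
      using we_trans v(3) by fastforce
    show ?case using 1 2 zigzag_append[OF v(1) zigzag_neg[OF f]] by blast
  next
    case (zz_neg f y x w z)
    then obtain v where v: "zigzag C z v y" "word_eq C y (w @ v) [] y" "word_eq C z (v @ w) [] z" by blast
    note f = \<open>f \<in> Hom C y x\<close>
    have xy: "x \<in> obj C" "y \<in> obj C" using Hom_obj[OF f] by auto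
    have "word_eq C x ([(f, False)] @ (w @ v) @ [(f, True)]) ([(f, False)] @ [] @ [(f, True)]) x"
      by (intro we_append[OF we_refl[OF zigzag_neg[OF f]]] we_append[OF v(2)] we_refl zigzag_pos f)
    then have 1: "word_eq C x (((f, False) # w) @ v @ [(f, True)]) [] x"
      using we_trans we_inv_left[OF xy(1) f] by fastforce
    have "word_eq C z (v @ [(f, True), (f, False)] @ w) (v @ [] @ w) z"
      by (intro we_append[OF we_refl[OF v(1)]] we_append[OF we_inv_right[OF xy(2) f]] we_refl zz_neg)
    then have 2: "word_eq C z ((v @ [(f, True)]) @ ((f, False) # w)) [] z"
      using we_trans v(3) by fastforce
    show ?case using 1 2 zigzag_append[OF v(1) zigzag_pos[OF f]] by blast
  qed
  moreover obtain w where w: "f = word_class C x w y" "zigzag C x w y" using assms by (auto simp: env_Hom)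
  ultimately obtain v where v: "zigzag C y v x" "word_eq C x (w @ v) [] x" "word_eq C y (v @ w) [] y" by blast
  show ?thesis
  proof (rule bexI[of _ "word_class C y v x"])
    show "word_class C y v x \<in> Hom (env_groupoid C) y x" using v(1) by (auto simp: env_Hom)
  qed (use v w in \<open>simp add: env_cmp env_idn word_class_eq[OF v(2)] word_class_eq[OF v(3)]\<close>)
qed

theorem right_module_free_hom:
  assumes x: "x \<in> obj C"
  shows "right_module C (free_hom_module C x)"
proof -
  interpret E: category "env_groupoid C" by (rule category_env)
  interpret I: cat_functor C "env_groupoid C" "\<lambda>x. x" "env_map C" by (rule env_map_functor)
  let ?R = "free_hom_module C x"
  have hom: "act ?R d \<in> hom (val ?R y) (val ?R z)" if d: "d \<in> Hom C y z" for d y z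
    unfolding free_hom_module_def cmod.simps
    by (rule frag_extend_hom) (use E.cmp_Hom I.map_Hom[OF d] in auto)
  show ?thesis
  proof (intro right_module.intro right_module_axioms.intro)
    fix y a assume y: "y \<in> obj C" and a: "a \<in> carrier (val ?R y)"
    have "act ?R (idn C y) a = (\<lambda>c. c) a"
    proof (rule hom_free_eqI[where S="Hom (env_groupoid C) x y" and h="act ?R (idn C y)" and k="\<lambda>c. c"
        and G = "free_Abelian_group (Hom (env_groupoid C) x y)"])
      show "act ?R (idn C y) \<in> hom (free_Abelian_group (Hom (env_groupoid C) x y)) (free_Abelian_group (Hom (env_groupoid C) x y))"
        using hom[OF idn_Hom[OF y]] by (simp add: free_hom_module_def)
    qed (use a y in \<open>auto simp: free_hom_module_def hom_def I.map_idn E.idn_right\<close>)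
    then show "act ?R (idn C y) a = a" by simp
  next
    fix f g w y z a assume f: "f \<in> Hom C w y" and g: "g \<in> Hom C y z" and a: "a \<in> carrier (val ?R w)"
    have "act ?R (cmp C f g) a = (act ?R g \<circ> act ?R f) a"
    proof (rule hom_free_eqI[where S="Hom (env_groupoid C) x w" and h="act ?R (cmp C f g)" and k="act ?R g \<circ> act ?R f"
        and G = "val ?R z"])
      show "act ?R (cmp C f g) \<in> hom (free_Abelian_group (Hom (env_groupoid C) x w)) (val ?R z)"
        using hom[OF cmp_Hom[OF f g]] by (simp add: free_hom_module_def)
      show "act ?R g \<circ> act ?R f \<in> hom (free_Abelian_group (Hom (env_groupoid C) x w)) (val ?R z)"
        using hom_compose[OF hom[OF f] hom[OF g]] by (simp add: free_hom_module_def)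
    qed (use a f g in \<open>auto simp: free_hom_module_def I.map_cmp E.cmp_assoc[OF _ I.map_Hom[OF f] I.map_Hom[OF g]]\<close>)
    then show "act ?R (cmp C f g) a = act ?R g (act ?R f a)" by simp
  qed (use hom category_axioms in \<open>auto simp: free_hom_module_def abelian_free_Abelian_group\<close>)
qed

end

section \<open>Functoriality of tensor products\<close>

lemma coset_map:
  assumes "comm_group G" "comm_group G'" "subgroup K G" "subgroup K' G'" and h: "h \<in> hom G G'" "h ` K \<subseteq> K'"
  shows coset_map_rcos: "x \<in> carrier G \<Longrightarrow> K' <#>\<^bsub>G'\<^esub> (h ` (K #>\<^bsub>G\<^esub> x)) = K' #>\<^bsub>G'\<^esub> h x"
    and coset_map_hom: "(\<lambda>X. K' <#>\<^bsub>G'\<^esub> (h ` X)) \<in> hom (G Mod K) (G' Mod K')"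
proof -
  interpret G: comm_group G by fact
  interpret G': comm_group G' by fact
  interpret K: subgroup K G by fact
  interpret K': subgroup K' G' by fact
  interpret h: group_hom G G' h using h(1) by unfold_locales
  have N: "K \<lhd> G" "K' \<lhd> G'" using assms G.subgroup_imp_normal G'.subgroup_imp_normal by auto
  show *: "K' <#>\<^bsub>G'\<^esub> (h ` (K #>\<^bsub>G\<^esub> x)) = K' #>\<^bsub>G'\<^esub> h x" if x: "x \<in> carrier G" for x
  proof
    show "K' <#>\<^bsub>G'\<^esub> (h ` (K #>\<^bsub>G\<^esub> x)) \<subseteq> K' #>\<^bsub>G'\<^esub> h x"
    proof
      fix y assume "y \<in> K' <#>\<^bsub>G'\<^esub> (h ` (K #>\<^bsub>G\<^esub> x))"
      then obtain k' k where k: "k' \<in> K'" "k \<in> K" "y = k' \<otimes>\<^bsub>G'\<^esub> h (k \<otimes>\<^bsub>G\<^esub> x)"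
        by (auto simp: set_mult_def r_coset_def)
      then have "y = (k' \<otimes>\<^bsub>G'\<^esub> h k) \<otimes>\<^bsub>G'\<^esub> h x" "k' \<otimes>\<^bsub>G'\<^esub> h k \<in> K'"
        using x h(2) by (auto simp: G'.m_assoc K'.mem_carrier K.mem_carrier)
      then show "y \<in> K' #>\<^bsub>G'\<^esub> h x" by (auto simp: r_coset_def)
    qed
    show "K' #>\<^bsub>G'\<^esub> h x \<subseteq> K' <#>\<^bsub>G'\<^esub> (h ` (K #>\<^bsub>G\<^esub> x))"
    proof
      fix y assume "y \<in> K' #>\<^bsub>G'\<^esub> h x"
      then obtain k' where "k' \<in> K'" "y = k' \<otimes>\<^bsub>G'\<^esub> h x" by (auto simp: r_coset_def)
      moreover have "x \<in> K #>\<^bsub>G\<^esub> x" using G.rcos_self[OF x K.subgroup_axioms] .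
      ultimately show "y \<in> K' <#>\<^bsub>G'\<^esub> (h ` (K #>\<^bsub>G\<^esub> x))" unfolding set_mult_def by blast
    qed
  qed
  show "(\<lambda>X. K' <#>\<^bsub>G'\<^esub> (h ` X)) \<in> hom (G Mod K) (G' Mod K')"
  proof (rule homI)
    fix X assume "X \<in> carrier (G Mod K)"
    then obtain x where "x \<in> carrier G" "X = K #>\<^bsub>G\<^esub> x" by (auto simp: FactGroup_def RCOSETS_def)
    then show "K' <#>\<^bsub>G'\<^esub> (h ` X) \<in> carrier (G' Mod K')" using * by (auto simp: FactGroup_def RCOSETS_def)
    fix Y assume "Y \<in> carrier (G Mod K)"
    then obtain y where "y \<in> carrier G" "Y = K #>\<^bsub>G\<^esub> y" by (auto simp: FactGroup_def RCOSETS_def)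
    then show "K' <#>\<^bsub>G'\<^esub> (h ` (X \<otimes>\<^bsub>G Mod K\<^esub> Y)) =
       (K' <#>\<^bsub>G'\<^esub> (h ` X)) \<otimes>\<^bsub>G' Mod K'\<^esub> (K' <#>\<^bsub>G'\<^esub> (h ` Y))"
      using \<open>x \<in> carrier G\<close> \<open>X = K #>\<^bsub>G\<^esub> x\<close> *
      by (simp add: FactGroup_def normal.rcos_sum[OF N(1)] normal.rcos_sum[OF N(2)])
  qed
qed

lemma hom_generate_subset:
  assumes "group G" "group G'" and h: "h \<in> hom G G'" and S: "S \<subseteq> carrier G" "h ` S \<subseteq> K'" "subgroup K' G'"
  shows "h ` generate G S \<subseteq> K'"
proof -
  interpret group_hom G G' h using assms by (simp add: group_hom_def group_hom_axioms_def)
  have "h ` generate G S = generate G' (h ` S)" using generate_img[OF S(1)] by (rule sym)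
  also have "\<dots> \<subseteq> K'" using H.generate_subgroup_incl[OF S(2,3)] .
  finally show ?thesis .
qed

context
  fixes A :: "'a monoid" and B :: "'b monoid"
  assumes A: "group A" and B: "group B"
begin

lemma bilinear_gens_closed:
  "{frag_of (a \<otimes>\<^bsub>A\<^esub> a', b) - (frag_of (a, b) + frag_of (a', b)) | a a' b.
        a \<in> carrier A \<and> a' \<in> carrier A \<and> b \<in> carrier B} \<union>
     {frag_of (a, b \<otimes>\<^bsub>B\<^esub> b') - (frag_of (a, b) + frag_of (a, b')) | a b b'.
        a \<in> carrier A \<and> b \<in> carrier B \<and> b' \<in> carrier B}
   \<subseteq> carrier (free_Abelian_group (carrier A \<times> carrier B))"
proof -
  interpret A: group A by (rule A)
  interpret B: group B by (rule B)
  show ?thesis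
    by (auto dest!: subsetD[OF keys_diff] subsetD[OF keys_add])
qed

lemma subgroup_bilinear_rels:
  "subgroup (bilinear_rels A B) (free_Abelian_group (carrier A \<times> carrier B))"
  unfolding bilinear_rels_def
  by (rule group.generate_is_subgroup[OF group_free_Abelian_group bilinear_gens_closed])

lemma comm_group_tensor_group: "comm_group (tensor_group A B)"
  unfolding tensor_group_def
  using comm_group.abelian_FactGroup[OF abelian_free_Abelian_group subgroup_bilinear_rels] .

lemma carrier_tensor_group:
  "X \<in> carrier (tensor_group A B) \<longleftrightarrow> (\<exists>c. Poly_Mapping.keys c \<subseteq> carrier A \<times> carrier B \<and>
     X = bilinear_rels A B #>\<^bsub>free_Abelian_group (carrier A \<times> carrier B)\<^esub> c)"
  by (simp add: tensor_group_def FactGroup_def RCOSETS_def Bex_def)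

lemma pure_tensor_closed:
  "a \<in> carrier A \<Longrightarrow> b \<in> carrier B \<Longrightarrow> pure_tensor A B a b \<in> carrier (tensor_group A B)"
  unfolding carrier_tensor_group pure_tensor_def by (intro exI[of _ "frag_of (a, b)"]) simp

end

lemma frag_extend_frag_extend:
  "frag_extend f (frag_extend g c) = frag_extend (\<lambda>x. frag_extend f (g x)) c"
  by (rule frag_induction[of c UNIV]) (simp_all add: frag_extend_diff)

lemma bilinear_rels_left:
  assumes "a \<in> carrier A" "a' \<in> carrier A" "b \<in> carrier B"
  shows "frag_of (a \<otimes>\<^bsub>A\<^esub> a', b) - (frag_of (a, b) + frag_of (a', b)) \<in> bilinear_rels A B"
  unfolding bilinear_rels_def by (rule generate.incl, rule UnI1) (use assms in blast)

lemma bilinear_rels_right: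
  assumes "a \<in> carrier A" "b \<in> carrier B" "b' \<in> carrier B"
  shows "frag_of (a, b \<otimes>\<^bsub>B\<^esub> b') - (frag_of (a, b) + frag_of (a, b')) \<in> bilinear_rels A B"
  unfolding bilinear_rels_def by (rule generate.incl, rule UnI2) (use assms in blast)

lemma tensor_group_map:
  assumes gr: "group A" "group B" "group A'" "group B'" and f: "f \<in> hom A A'" and g: "g \<in> hom B B'"
  shows tensor_group_map_hom: "tensor_group_map A' B' f g \<in> hom (tensor_group A B) (tensor_group A' B')"
    and tensor_group_map_coset: "Poly_Mapping.keys c \<subseteq> carrier A \<times> carrier B \<Longrightarrow>
     tensor_group_map A' B' f g (bilinear_rels A B #>\<^bsub>free_Abelian_group (carrier A \<times> carrier B)\<^esub> c) =
     bilinear_rels A' B' #>\<^bsub>free_Abelian_group (carrier A' \<times> carrier B')\<^esub> frag_extend (\<lambda>(a, b). frag_of (f a, g b)) c"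
proof -
  let ?F = "free_Abelian_group (carrier A \<times> carrier B)"
  let ?F' = "free_Abelian_group (carrier A' \<times> carrier B')"
  let ?h = "frag_extend (\<lambda>(a, b). frag_of (f a, g b))"
  have h: "?h \<in> hom ?F ?F'"
    by (rule frag_extend_hom) (use f g in \<open>auto simp: hom_def\<close>)
  have "?h ` bilinear_rels A B \<subseteq> bilinear_rels A' B'"
    unfolding bilinear_rels_def[of A B]
  proof (rule hom_generate_subset[OF _ _ h bilinear_gens_closed[OF gr(1,2)] _ subgroup_bilinear_rels[OF gr(3,4)]])
    let ?S1 = "{frag_of (a \<otimes>\<^bsub>A\<^esub> a', b) - (frag_of (a, b) + frag_of (a', b)) | a a' b.
        a \<in> carrier A \<and> a' \<in> carrier A \<and> b \<in> carrier B}"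
    let ?S2 = "{frag_of (a, b \<otimes>\<^bsub>B\<^esub> b') - (frag_of (a, b) + frag_of (a, b')) | a b b'.
        a \<in> carrier A \<and> b \<in> carrier B \<and> b' \<in> carrier B}"
    have cl: "f a \<in> carrier A'" "g b \<in> carrier B'" if "a \<in> carrier A" "b \<in> carrier B" for a b
      using f g that by (auto simp: hom_def)
    have "?h c \<in> bilinear_rels A' B'" if c: "c \<in> ?S1" for c
    proof -
      obtain a a' b where "a \<in> carrier A" "a' \<in> carrier A" "b \<in> carrier B"
        "c = frag_of (a \<otimes>\<^bsub>A\<^esub> a', b) - (frag_of (a, b) + frag_of (a', b))" using c by blast
      then show ?thesis using bilinear_rels_left[of "f a" A' "f a'" "g b" B'] cl
        by (simp add: frag_extend_diff frag_extend_add hom_mult[OF f])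
    qed
    moreover have "?h c \<in> bilinear_rels A' B'" if c: "c \<in> ?S2" for c
    proof -
      obtain a b b' where "a \<in> carrier A" "b \<in> carrier B" "b' \<in> carrier B"
        "c = frag_of (a, b \<otimes>\<^bsub>B\<^esub> b') - (frag_of (a, b) + frag_of (a, b'))" using c by blast
      then show ?thesis using bilinear_rels_right[of "f a" A' "g b" B' "g b'"] cl
        by (simp add: frag_extend_diff frag_extend_add hom_mult[OF g])
    qed
    ultimately show "?h ` (?S1 \<union> ?S2) \<subseteq> bilinear_rels A' B'" by blast
  qed simp_all
  note c = coset_map[OF abelian_free_Abelian_group abelian_free_Abelian_group
      subgroup_bilinear_rels[OF gr(1,2)] subgroup_bilinear_rels[OF gr(3,4)] h this]
  show "tensor_group_map A' B' f g \<in> hom (tensor_group A B) (tensor_group A' B')"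
    using c(2) unfolding tensor_group_map_def tensor_group_def .
  show "Poly_Mapping.keys c \<subseteq> carrier A \<times> carrier B \<Longrightarrow>
     tensor_group_map A' B' f g (bilinear_rels A B #>\<^bsub>?F\<^esub> c) = bilinear_rels A' B' #>\<^bsub>?F'\<^esub> ?h c"
    using c(1)[of c] unfolding tensor_group_map_def by simp
qed

lemma tensor_group_map_pure:
  assumes gr: "group A" "group B" "group A'" "group B'" and f: "f \<in> hom A A'" and g: "g \<in> hom B B'"
    and "a \<in> carrier A" "b \<in> carrier B"
  shows "tensor_group_map A' B' f g (pure_tensor A B a b) = pure_tensor A' B' (f a) (g b)"
  using tensor_group_map_coset[OF gr f g, of "frag_of (a, b)"] assms(7,8) by (simp add: pure_tensor_def)

lemma tensor_group_map_id:
  assumes "group A" "group B" "X \<in> carrier (tensor_group A B)"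
    and f: "\<And>a. a \<in> carrier A \<Longrightarrow> f a = a" and g: "\<And>b. b \<in> carrier B \<Longrightarrow> g b = b"
  shows "tensor_group_map A B f g X = X"
proof -
  obtain c where c: "Poly_Mapping.keys c \<subseteq> carrier A \<times> carrier B"
    "X = bilinear_rels A B #>\<^bsub>free_Abelian_group (carrier A \<times> carrier B)\<^esub> c"
    using assms(3) carrier_tensor_group[OF assms(1,2)] by auto
  have "f \<in> hom A A" "g \<in> hom B B"
    using assms by (auto simp: hom_def group.is_monoid monoid.m_closed)
  moreover have "frag_extend (\<lambda>(a, b). frag_of (f a, g b)) c = frag_extend frag_of c"
    by (rule frag_extend_eq) (use c(1) f g in auto)
  ultimately show ?thesis
    using tensor_group_map_coset[OF assms(1,2,1,2) _ _ c(1), of f g] c(2) frag_expansion[of c] by simp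
qed

lemma tensor_group_map_compose:
  assumes gr: "group A" "group B" "group A'" "group B'" "group A''" "group B''"
    and f: "f \<in> hom A A'" and g: "g \<in> hom B B'" and f': "f' \<in> hom A' A''" and g': "g' \<in> hom B' B''"
    and X: "X \<in> carrier (tensor_group A B)"
    and ff: "\<And>a. a \<in> carrier A \<Longrightarrow> f'' a = f' (f a)" and gg: "\<And>b. b \<in> carrier B \<Longrightarrow> g'' b = g' (g b)"
  shows "tensor_group_map A'' B'' f' g' (tensor_group_map A' B' f g X) = tensor_group_map A'' B'' f'' g'' X"
proof -
  obtain c where c: "Poly_Mapping.keys c \<subseteq> carrier A \<times> carrier B"
    "X = bilinear_rels A B #>\<^bsub>free_Abelian_group (carrier A \<times> carrier B)\<^esub> c"
    using X carrier_tensor_group[OF gr(1,2)] by auto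
  let ?h = "frag_extend (\<lambda>(a, b). frag_of (f a, g b))"
  have hc: "Poly_Mapping.keys (?h c) \<subseteq> carrier A' \<times> carrier B'"
  proof -
    have "?h \<in> hom (free_Abelian_group (carrier A \<times> carrier B)) (free_Abelian_group (carrier A' \<times> carrier B'))"
      by (rule frag_extend_hom) (use f g in \<open>auto simp: hom_def\<close>)
    from hom_in_carrier[OF this, of c] show ?thesis using c(1) by simp
  qed
  have h'': "f'' \<in> hom A A''" "g'' \<in> hom B B''"
    using hom_compose[OF f f'] hom_compose[OF g g'] ff gg gr(1,2)
    by (auto simp: hom_def group.is_monoid monoid.m_closed Pi_def)
  have "frag_extend (\<lambda>(a, b). frag_of (f'' a, g'' b)) c =
      frag_extend (frag_extend (\<lambda>(a, b). frag_of (f' a, g' b)) \<circ> (\<lambda>(a, b). frag_of (f a, g b))) c"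
    by (rule frag_extend_eq) (use c(1) ff gg in auto)
  also have "\<dots> = frag_extend (\<lambda>(a, b). frag_of (f' a, g' b)) (?h c)"
    by (simp add: frag_extend_frag_extend comp_def)
  finally show ?thesis
    using tensor_group_map_coset[OF gr(1-4) f g c(1)] tensor_group_map_coset[OF gr(3-6) f' g' hc]
      tensor_group_map_coset[OF gr(1,2,5,6) h'' c(1)] c(2) by simp
qed

context
  fixes C :: "('o, 'm) cat" and R :: "('o, 'm, 'r) cmod" and M :: "('o, 'm, 'a) cmod"
  assumes R: "right_module C R" and M: "left_module C M"
begin

lemma tensor_sum_groups: "z \<in> obj C \<Longrightarrow> group (tensor_group (val R z) (val M z))"
  using comm_group_tensor_group[of "val R z" "val M z"]
    right_module.val_comm_group[OF R, of z] left_module.val_comm_group[OF M, of z]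
  by (simp add: comm_group_def)

lemma carrier_tensor_sum: "t \<in> carrier (tensor_sum C R M) \<longleftrightarrow>
   t \<in> (\<Pi>\<^sub>E z\<in>obj C. carrier (tensor_group (val R z) (val M z))) \<and>
   finite {z \<in> obj C. t z \<noteq> \<one>\<^bsub>tensor_group (val R z) (val M z)\<^esub>}"
  using carrier_sum_group[of "obj C" "\<lambda>z. tensor_group (val R z) (val M z)"] tensor_sum_groups
  by (simp add: tensor_sum_def)

lemma comm_group_tensor_sum: "comm_group (tensor_sum C R M)"
proof (rule group.group_comm_groupI)
  show "group (tensor_sum C R M)" unfolding tensor_sum_def using tensor_sum_groups by simp
  have "comm_group (tensor_group (val R z) (val M z))" if "z \<in> obj C" for z
    using comm_group_tensor_group[of "val R z" "val M z"]
      right_module.val_comm_group[OF R that] left_module.val_comm_group[OF M that]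
    by (simp add: comm_group_def)
  then show "x \<otimes>\<^bsub>tensor_sum C R M\<^esub> y = y \<otimes>\<^bsub>tensor_sum C R M\<^esub> x"
    if "x \<in> carrier (tensor_sum C R M)" "y \<in> carrier (tensor_sum C R M)" for x y
    using that unfolding carrier_tensor_sum
    by (auto simp: tensor_sum_def PiE_iff comm_group_def comm_monoid.m_comm intro!: restrict_ext)
qed

lemma summand_closed:
  assumes "z \<in> obj C" "a \<in> carrier (val R z)" "b \<in> carrier (val M z)"
  shows "summand C R M z a b \<in> carrier (tensor_sum C R M)"
proof -
  have "{i \<in> obj C. summand C R M z a b i \<noteq> \<one>\<^bsub>tensor_group (val R i) (val M i)\<^esub>} \<subseteq> {z}"
    by (auto simp: summand_def split: if_splits)
  then have "finite {i \<in> obj C. summand C R M z a b i \<noteq> \<one>\<^bsub>tensor_group (val R i) (val M i)\<^esub>}"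
    by (rule finite_subset) simp
  moreover have "pure_tensor (val R z) (val M z) a b \<in> carrier (tensor_group (val R z) (val M z))"
    using assms pure_tensor_closed right_module.val_comm_group[OF R assms(1)] left_module.val_comm_group[OF M assms(1)]
    by (auto simp: comm_group_def)
  ultimately show ?thesis unfolding carrier_tensor_sum
    using tensor_sum_groups
    by (auto simp: summand_def PiE_iff group.is_monoid monoid.one_closed)
qed

lemma balancing_gens_closed:
  "{summand C R M z' (act R d a) b \<otimes>\<^bsub>tensor_sum C R M\<^esub>
       inv\<^bsub>tensor_sum C R M\<^esub> (summand C R M z a (act M d b)) | d z z' a b.
     d \<in> Hom C z z' \<and> a \<in> carrier (val R z) \<and> b \<in> carrier (val M z')} \<subseteq> carrier (tensor_sum C R M)"
proof -
  interpret S: comm_group "tensor_sum C R M" by (rule comm_group_tensor_sum)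
  interpret R: right_module C R by (rule R)
  interpret M: left_module C M by (rule M)
  have *: "act R d a \<in> carrier (val R z')" "act M d b \<in> carrier (val M z)" "z \<in> obj C" "z' \<in> obj C"
    if "d \<in> Hom C z z'" "a \<in> carrier (val R z)" "b \<in> carrier (val M z')" for d z z' a b
    using hom_in_carrier[OF R.act_hom[OF that(1)] that(2)] hom_in_carrier[OF M.act_hom[OF that(1)] that(3)]
      R.Hom_obj[OF that(1)] by auto
  have "summand C R M z' (act R d a) b \<otimes>\<^bsub>tensor_sum C R M\<^esub>
       inv\<^bsub>tensor_sum C R M\<^esub> (summand C R M z a (act M d b)) \<in> carrier (tensor_sum C R M)"
    if t: "d \<in> Hom C z z'" "a \<in> carrier (val R z)" "b \<in> carrier (val M z')" for d z z' a b
    by (intro S.m_closed S.inv_closed summand_closed *[OF t] t)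
  then show ?thesis by blast
qed

lemma subgroup_balancing_rels: "subgroup (balancing_rels C R M) (tensor_sum C R M)"
  unfolding balancing_rels_def
  using group.generate_is_subgroup[OF _ balancing_gens_closed] comm_group_tensor_sum by (simp add: comm_group_def)

lemma comm_group_tensor: "comm_group (tensor C R M)"
  unfolding tensor_def using comm_group.abelian_FactGroup[OF comm_group_tensor_sum subgroup_balancing_rels] .

lemma carrier_tensor: "X \<in> carrier (tensor C R M) \<longleftrightarrow>
   (\<exists>t \<in> carrier (tensor_sum C R M). X = balancing_rels C R M #>\<^bsub>tensor_sum C R M\<^esub> t)"
  by (simp add: tensor_def FactGroup_def RCOSETS_def)

end

definition right_module_hom ::
  "('o, 'm) cat \<Rightarrow> ('o, 'm, 'a) cmod \<Rightarrow> ('o, 'm, 'b) cmod \<Rightarrow> ('o \<Rightarrow> 'a \<Rightarrow> 'b) \<Rightarrow> bool"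
  where "right_module_hom C R S \<rho> \<longleftrightarrow>
    (\<forall>x \<in> obj C. \<rho> x \<in> hom (val R x) (val S x)) \<and>
    (\<forall>x y. \<forall>f \<in> Hom C x y. \<forall>a \<in> carrier (val R x). \<rho> y (act R f a) = act S f (\<rho> x a))"

lemma tensor_map:
  assumes R: "right_module C R" and M: "left_module C M" and R': "right_module C R'" and M': "left_module C M'"
    and \<rho>: "right_module_hom C R R' \<rho>" and \<mu>: "module_hom C M M' \<mu>"
  shows tensor_map_hom: "tensor_map C R' M' \<rho> \<mu> \<in> hom (tensor C R M) (tensor C R' M')"
    and tensor_map_coset: "t \<in> carrier (tensor_sum C R M) \<Longrightarrow>
      tensor_map C R' M' \<rho> \<mu> (balancing_rels C R M #>\<^bsub>tensor_sum C R M\<^esub> t) =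
      balancing_rels C R' M' #>\<^bsub>tensor_sum C R' M'\<^esub>
        (\<lambda>z \<in> obj C. tensor_group_map (val R' z) (val M' z) (\<rho> z) (\<mu> z) (t z))"
    and tensor_map_sum_closed: "t \<in> carrier (tensor_sum C R M) \<Longrightarrow>
      (\<lambda>z \<in> obj C. tensor_group_map (val R' z) (val M' z) (\<rho> z) (\<mu> z) (t z)) \<in> carrier (tensor_sum C R' M')"
proof -
  interpret R: right_module C R by fact
  interpret M: left_module C M by fact
  interpret R': right_module C R' by fact
  interpret M': left_module C M' by fact
  interpret S: comm_group "tensor_sum C R M" by (rule comm_group_tensor_sum[OF R M])
  interpret S': comm_group "tensor_sum C R' M'" by (rule comm_group_tensor_sum[OF R' M'])
  let ?h = "\<lambda>t. \<lambda>z \<in> obj C. tensor_group_map (val R' z) (val M' z) (\<rho> z) (\<mu> z) (t z)"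
  have gr: "group (val R z)" "group (val M z)" "group (val R' z)" "group (val M' z)" if "z \<in> obj C" for z
    using that R.val_comm_group M.val_comm_group R'.val_comm_group M'.val_comm_group
    by (auto simp: comm_group_def)
  have rm: "\<rho> z \<in> hom (val R z) (val R' z)" "\<mu> z \<in> hom (val M z) (val M' z)" if "z \<in> obj C" for z
    using \<rho> \<mu> that by (auto simp: right_module_hom_def module_hom_def)
  have th: "tensor_group_map (val R' z) (val M' z) (\<rho> z) (\<mu> z) \<in>
      hom (tensor_group (val R z) (val M z)) (tensor_group (val R' z) (val M' z))" if "z \<in> obj C" for z
    by (rule tensor_group_map_hom[OF gr[OF that] rm[OF that]])
  have one: "tensor_group_map (val R' z) (val M' z) (\<rho> z) (\<mu> z) \<one>\<^bsub>tensor_group (val R z) (val M z)\<^esub> =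
      \<one>\<^bsub>tensor_group (val R' z) (val M' z)\<^esub>" if "z \<in> obj C" for z
    by (rule hom_one[OF th[OF that] tensor_sum_groups[OF R M that] tensor_sum_groups[OF R' M' that]])
  have closed: "?h t \<in> carrier (tensor_sum C R' M')" if t: "t \<in> carrier (tensor_sum C R M)" for t
  proof -
    have "{z \<in> obj C. ?h t z \<noteq> \<one>\<^bsub>tensor_group (val R' z) (val M' z)\<^esub>} \<subseteq>
        {z \<in> obj C. t z \<noteq> \<one>\<^bsub>tensor_group (val R z) (val M z)\<^esub>}"
      using one by auto
    then have "finite {z \<in> obj C. ?h t z \<noteq> \<one>\<^bsub>tensor_group (val R' z) (val M' z)\<^esub>}"
      by (rule finite_subset) (use t in \<open>simp add: carrier_tensor_sum[OF R M]\<close>)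
    then show ?thesis
      using t hom_in_carrier[OF th] unfolding carrier_tensor_sum[OF R' M'] carrier_tensor_sum[OF R M]
      by (simp add: PiE_iff)
  qed
  then show "t \<in> carrier (tensor_sum C R M) \<Longrightarrow> ?h t \<in> carrier (tensor_sum C R' M')" .
  have h: "?h \<in> hom (tensor_sum C R M) (tensor_sum C R' M')"
  proof (rule homI)
    fix s t assume "s \<in> carrier (tensor_sum C R M)" "t \<in> carrier (tensor_sum C R M)"
    then show "?h (s \<otimes>\<^bsub>tensor_sum C R M\<^esub> t) = ?h s \<otimes>\<^bsub>tensor_sum C R' M'\<^esub> ?h t"
      using hom_mult[OF th] unfolding carrier_tensor_sum[OF R M]
      by (auto simp: tensor_sum_def PiE_iff intro!: restrict_ext)
  qed (rule closed)
  interpret h: group_hom "tensor_sum C R M" "tensor_sum C R' M'" ?h using h by unfold_locales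
  have hs: "?h (summand C R M z a b) = summand C R' M' z (\<rho> z a) (\<mu> z b)"
    if "z \<in> obj C" "a \<in> carrier (val R z)" "b \<in> carrier (val M z)" for z a b
    using one tensor_group_map_pure[OF gr[OF that(1)] rm[OF that(1)] that(2,3)]
    by (auto simp: summand_def intro!: restrict_ext)
  have "?h ` balancing_rels C R M \<subseteq> balancing_rels C R' M'"
    unfolding balancing_rels_def[of C R M]
  proof (rule hom_generate_subset[OF _ _ h balancing_gens_closed[OF R M] _ subgroup_balancing_rels[OF R' M']])
    have "?h (summand C R M z' (act R d a) b \<otimes>\<^bsub>tensor_sum C R M\<^esub>
       inv\<^bsub>tensor_sum C R M\<^esub> (summand C R M z a (act M d b))) \<in> balancing_rels C R' M'"
      if d: "d \<in> Hom C z z'" and a: "a \<in> carrier (val R z)" and b: "b \<in> carrier (val M z')" for d z z' a b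
    proof -
      have z: "z \<in> obj C" "z' \<in> obj C" using R.Hom_obj[OF d] by auto
      have ac: "act R d a \<in> carrier (val R z')" "act M d b \<in> carrier (val M z)"
        using hom_in_carrier[OF R.act_hom[OF d] a] hom_in_carrier[OF M.act_hom[OF d] b] by auto
      have nat: "\<rho> z' (act R d a) = act R' d (\<rho> z a)" "\<mu> z (act M d b) = act M' d (\<mu> z' b)"
        using \<rho> \<mu> a b d by (auto simp: right_module_hom_def module_hom_def)
      have "\<rho> z a \<in> carrier (val R' z)" "\<mu> z' b \<in> carrier (val M' z')"
        using hom_in_carrier[OF rm(1)[OF z(1)] a] hom_in_carrier[OF rm(2)[OF z(2)] b] .
      then have "summand C R' M' z' (act R' d (\<rho> z a)) (\<mu> z' b) \<otimes>\<^bsub>tensor_sum C R' M'\<^esub>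
        inv\<^bsub>tensor_sum C R' M'\<^esub> (summand C R' M' z (\<rho> z a) (act M' d (\<mu> z' b))) \<in> balancing_rels C R' M'"
        unfolding balancing_rels_def using d by (intro generate.incl) blast
      moreover have "?h (summand C R M z' (act R d a) b \<otimes>\<^bsub>tensor_sum C R M\<^esub>
         inv\<^bsub>tensor_sum C R M\<^esub> (summand C R M z a (act M d b))) =
         ?h (summand C R M z' (act R d a) b) \<otimes>\<^bsub>tensor_sum C R' M'\<^esub>
         inv\<^bsub>tensor_sum C R' M'\<^esub> (?h (summand C R M z a (act M d b)))"
        using h.hom_mult[OF summand_closed[OF R M z(2) ac(1) b]
            S.inv_closed[OF summand_closed[OF R M z(1) a ac(2)]]]
          h.hom_inv[OF summand_closed[OF R M z(1) a ac(2)]] by simp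
      ultimately show ?thesis unfolding hs[OF z(2) ac(1) b] hs[OF z(1) a ac(2)] nat by simp
    qed
    then show "?h ` {summand C R M z' (act R d a) b \<otimes>\<^bsub>tensor_sum C R M\<^esub>
       inv\<^bsub>tensor_sum C R M\<^esub> (summand C R M z a (act M d b)) | d z z' a b.
     d \<in> Hom C z z' \<and> a \<in> carrier (val R z) \<and> b \<in> carrier (val M z')} \<subseteq> balancing_rels C R' M'"
      by blast
  qed unfold_locales
  note c = coset_map[OF comm_group_tensor_sum[OF R M] comm_group_tensor_sum[OF R' M']
      subgroup_balancing_rels[OF R M] subgroup_balancing_rels[OF R' M'] h this]
  show "tensor_map C R' M' \<rho> \<mu> \<in> hom (tensor C R M) (tensor C R' M')"
    using c(2) unfolding tensor_map_def tensor_def .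
  show "t \<in> carrier (tensor_sum C R M) \<Longrightarrow>
      tensor_map C R' M' \<rho> \<mu> (balancing_rels C R M #>\<^bsub>tensor_sum C R M\<^esub> t) =
      balancing_rels C R' M' #>\<^bsub>tensor_sum C R' M'\<^esub> ?h t"
    using c(1) unfolding tensor_map_def .
qed

lemma tensor_map_id:
  assumes R: "right_module C R" and M: "left_module C M" and X: "X \<in> carrier (tensor C R M)"
    and r: "\<And>z a. \<lbrakk>z \<in> obj C; a \<in> carrier (val R z)\<rbrakk> \<Longrightarrow> \<rho> z a = a"
    and m: "\<And>z a. \<lbrakk>z \<in> obj C; a \<in> carrier (val M z)\<rbrakk> \<Longrightarrow> \<mu> z a = a"
  shows "tensor_map C R M \<rho> \<mu> X = X"
proof -
  interpret R: right_module C R by fact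
  interpret M: left_module C M by fact
  have gr: "group (val R z)" "group (val M z)" if "z \<in> obj C" for z
    using that R.val_comm_group M.val_comm_group by (auto simp: comm_group_def)
  have \<rho>: "right_module_hom C R R \<rho>"
    using r gr R.Hom_obj hom_in_carrier[OF R.act_hom]
    by (auto simp: right_module_hom_def hom_def group.is_monoid monoid.m_closed)
  have \<mu>: "module_hom C M M \<mu>"
    using m gr R.Hom_obj hom_in_carrier[OF M.act_hom]
    by (auto simp: module_hom_def hom_def group.is_monoid monoid.m_closed)
  obtain t where t: "t \<in> carrier (tensor_sum C R M)" "X = balancing_rels C R M #>\<^bsub>tensor_sum C R M\<^esub> t"
    using X carrier_tensor[OF R M] by blast
  have "(\<lambda>z \<in> obj C. tensor_group_map (val R z) (val M z) (\<rho> z) (\<mu> z) (t z)) = t"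
  proof
    fix z
    have "tensor_group_map (val R z) (val M z) (\<rho> z) (\<mu> z) (t z) = t z" if z: "z \<in> obj C"
      by (rule tensor_group_map_id[OF gr[OF z]]) (use z t(1) r m in \<open>auto simp: carrier_tensor_sum[OF R M]\<close>)
    then show "(\<lambda>z \<in> obj C. tensor_group_map (val R z) (val M z) (\<rho> z) (\<mu> z) (t z)) z = t z"
      using t(1) by (auto simp: carrier_tensor_sum[OF R M] PiE_iff extensional_def)
  qed
  then show ?thesis using tensor_map_coset[OF R M R M \<rho> \<mu> t(1)] t(2) by simp
qed

lemma tensor_map_compose:
  assumes R: "right_module C R" and M: "left_module C M" and R': "right_module C R'" and M': "left_module C M'"
    and R'': "right_module C R''" and M'': "left_module C M''"
    and \<rho>: "right_module_hom C R R' \<rho>" and \<mu>: "module_hom C M M' \<mu>"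
    and \<rho>': "right_module_hom C R' R'' \<rho>'" and \<mu>': "module_hom C M' M'' \<mu>'"
    and \<rho>'': "right_module_hom C R R'' \<rho>''" and \<mu>'': "module_hom C M M'' \<mu>''"
    and X: "X \<in> carrier (tensor C R M)"
    and r: "\<And>z a. \<lbrakk>z \<in> obj C; a \<in> carrier (val R z)\<rbrakk> \<Longrightarrow> \<rho>'' z a = \<rho>' z (\<rho> z a)"
    and m: "\<And>z a. \<lbrakk>z \<in> obj C; a \<in> carrier (val M z)\<rbrakk> \<Longrightarrow> \<mu>'' z a = \<mu>' z (\<mu> z a)"
  shows "tensor_map C R'' M'' \<rho>' \<mu>' (tensor_map C R' M' \<rho> \<mu> X) = tensor_map C R'' M'' \<rho>'' \<mu>'' X"
proof -
  have gr: "group (val R z)" "group (val M z)" "group (val R' z)" "group (val M' z)"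
    "group (val R'' z)" "group (val M'' z)" if "z \<in> obj C" for z
    using that R R' R'' M M' M'' right_module.val_comm_group left_module.val_comm_group
    by (metis comm_group_def)+
  have rm: "\<rho> z \<in> hom (val R z) (val R' z)" "\<mu> z \<in> hom (val M z) (val M' z)"
    "\<rho>' z \<in> hom (val R' z) (val R'' z)" "\<mu>' z \<in> hom (val M' z) (val M'' z)" if "z \<in> obj C" for z
    using \<rho> \<mu> \<rho>' \<mu>' that by (auto simp: right_module_hom_def module_hom_def)
  obtain t where t: "t \<in> carrier (tensor_sum C R M)" "X = balancing_rels C R M #>\<^bsub>tensor_sum C R M\<^esub> t"
    using X carrier_tensor[OF R M] by blast
  let ?t = "\<lambda>z \<in> obj C. tensor_group_map (val R' z) (val M' z) (\<rho> z) (\<mu> z) (t z)"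
  have tz: "t z \<in> carrier (tensor_group (val R z) (val M z))" if "z \<in> obj C" for z
    using t(1) that unfolding carrier_tensor_sum[OF R M] by auto
  have "(\<lambda>z \<in> obj C. tensor_group_map (val R'' z) (val M'' z) (\<rho>' z) (\<mu>' z) (?t z)) =
      (\<lambda>z \<in> obj C. tensor_group_map (val R'' z) (val M'' z) (\<rho>'' z) (\<mu>'' z) (t z))"
  proof (rule restrict_ext)
    fix z assume z: "z \<in> obj C"
    show "tensor_group_map (val R'' z) (val M'' z) (\<rho>' z) (\<mu>' z) (?t z) =
      tensor_group_map (val R'' z) (val M'' z) (\<rho>'' z) (\<mu>'' z) (t z)"
      using tensor_group_map_compose[OF gr[OF z] rm[OF z] tz[OF z] r[OF z] m[OF z]] z by simp
  qed
  then show ?thesis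
    using tensor_map_coset[OF R M R' M' \<rho> \<mu> t(1)] tensor_map_coset[OF R M R'' M'' \<rho>'' \<mu>'' t(1)]
      tensor_map_coset[OF R' M' R'' M'' \<rho>' \<mu>' tensor_map_sum_closed[OF R M R' M' \<rho> \<mu> t(1)]] t(2)
    by simp
qed

theorem left_module_induced:
  assumes M: "left_module C M"
  shows "left_module (env_groupoid C) (induced_module C M)"
proof -
  interpret M: left_module C M by fact
  let ?G = "env_groupoid C"
  interpret E: category ?G by (rule M.category_env)
  interpret I: cat_functor C ?G "\<lambda>x. x" "env_map C" by (rule M.env_map_functor)
  let ?\<rho> = "\<lambda>h (_ :: 'a). frag_extend (\<lambda>g. frag_of (cmp ?G h g))"
  let ?F = "free_hom_module C"
  note rf = M.right_module_free_hom
  have \<rho>: "right_module_hom C (?F y) (?F x) (?\<rho> h)" if h: "h \<in> Hom ?G x y" for h x y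
  proof -
    have hom: "?\<rho> h z \<in> hom (val (?F y) z) (val (?F x) z)" for z
      unfolding free_hom_module_def cmod.simps
      by (rule frag_extend_hom) (use E.cmp_Hom[OF h] in auto)
    have xy: "x \<in> obj C" "y \<in> obj C" using E.Hom_obj[OF h] by auto
    interpret X: right_module C "?F x" by (rule rf[OF xy(1)])
    interpret Y: right_module C "?F y" by (rule rf[OF xy(2)])
    have "?\<rho> h w (act (?F y) d a) = act (?F x) d (?\<rho> h z a)"
      if d: "d \<in> Hom C z w" and a: "a \<in> carrier (val (?F y) z)" for d z w a
    proof -
      have "(?\<rho> h w \<circ> act (?F y) d) a = (act (?F x) d \<circ> ?\<rho> h z) a"
      proof (rule hom_free_eqI[where S="Hom ?G y z" and G="val (?F x) w"
            and h="?\<rho> h w \<circ> act (?F y) d" and k="act (?F x) d \<circ> ?\<rho> h z"])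
        show "?\<rho> h w \<circ> act (?F y) d \<in> hom (free_Abelian_group (Hom ?G y z)) (val (?F x) w)"
          using hom_compose[OF Y.act_hom[OF d] hom[of w]] by (simp add: free_hom_module_def)
        show "act (?F x) d \<circ> ?\<rho> h z \<in> hom (free_Abelian_group (Hom ?G y z)) (val (?F x) w)"
          using hom_compose[OF hom[of z] X.act_hom[OF d]] by (simp add: free_hom_module_def)
      qed (use a E.cmp_assoc[OF h _ I.map_Hom[OF d]] in \<open>auto simp: free_hom_module_def\<close>)
      then show ?thesis by simp
    qed
    then show ?thesis using hom unfolding right_module_hom_def by blast
  qed
  have id: "module_hom C M M (\<lambda>_ b. b)" by (auto simp: module_hom_def hom_def)
  have src: "src ?G h = x" if "h \<in> Hom ?G x y" for h x y using that by (simp add: Hom_def)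
  show ?thesis
  proof (intro left_module.intro left_module_axioms.intro)
    show "category ?G" by (rule E.category_axioms)
    show "comm_group (val (induced_module C M) x)" if "x \<in> obj ?G" for x
      using that comm_group_tensor[OF rf M] by (simp add: induced_module_def)
    show "act (induced_module C M) h \<in> hom (val (induced_module C M) y) (val (induced_module C M) x)"
      if h: "h \<in> Hom ?G x y" for h x y
      using tensor_map_hom[OF rf M rf M \<rho>[OF h] id] E.Hom_obj[OF h] src[OF h] by (simp add: induced_module_def)
  next
    fix x X assume x: "x \<in> obj ?G" and X: "X \<in> carrier (val (induced_module C M) x)"
    have i: "idn ?G x \<in> Hom ?G x x" by (rule E.idn_Hom[OF x])
    have "tensor_map C (?F x) M (?\<rho> (idn ?G x)) (\<lambda>_ b. b) X = X"
    proof (rule tensor_map_id[OF rf M])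
      fix z a assume a: "a \<in> carrier (val (?F x) z)"
      have "?\<rho> (idn ?G x) z a = frag_extend frag_of a"
        by (rule frag_extend_eq) (use a E.idn_left in \<open>auto simp: free_hom_module_def\<close>)
      then show "?\<rho> (idn ?G x) z a = a" using frag_expansion[of a] by simp
    qed (use x X in \<open>auto simp: induced_module_def\<close>)
    then show "act (induced_module C M) (idn ?G x) X = X" using src[OF i] by (simp add: induced_module_def)
  next
    fix h k x y z X
    assume h: "h \<in> Hom ?G x y" and k: "k \<in> Hom ?G y z" and X: "X \<in> carrier (val (induced_module C M) z)"
    have hk: "cmp ?G h k \<in> Hom ?G x z" by (rule E.cmp_Hom[OF h k])
    have xyz: "x \<in> obj C" "y \<in> obj C" "z \<in> obj C" using E.Hom_obj[OF h] E.Hom_obj[OF k] by auto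
    have "tensor_map C (?F x) M (?\<rho> h) (\<lambda>_ b. b) (tensor_map C (?F y) M (?\<rho> k) (\<lambda>_ b. b) X) =
      tensor_map C (?F x) M (?\<rho> (cmp ?G h k)) (\<lambda>_ b. b) X"
    proof (rule tensor_map_compose[OF rf[OF xyz(3)] M rf[OF xyz(2)] M rf[OF xyz(1)] M \<rho>[OF k] id \<rho>[OF h] id \<rho>[OF hk] id])
      show "X \<in> carrier (tensor C (?F z) M)" using X by (simp add: induced_module_def)
      fix w a assume a: "a \<in> carrier (val (?F z) w)"
      have "?\<rho> (cmp ?G h k) w a =
          frag_extend (frag_extend (\<lambda>g. frag_of (cmp ?G h g)) \<circ> (\<lambda>g. frag_of (cmp ?G k g))) a"
        by (rule frag_extend_eq) (use a E.cmp_assoc[OF h k] in \<open>auto simp: free_hom_module_def\<close>)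
      also have "\<dots> = ?\<rho> h w (?\<rho> k w a)"
        by (simp add: frag_extend_frag_extend comp_def)
      finally show "?\<rho> (cmp ?G h k) w a = ?\<rho> h w (?\<rho> k w a)" .
    qed simp_all
    then show "act (induced_module C M) (cmp ?G h k) X =
        act (induced_module C M) h (act (induced_module C M) k X)"
      using src[OF h] src[OF k] src[OF hk] by (simp add: induced_module_def)
  qed
qed

section \<open>The remaining categories and modules\<close>

theorem category_group_cat: "group G \<Longrightarrow> category (group_cat G)"
  by unfold_locales
    (auto simp: group_cat_def Hom_def group.is_monoid monoid.m_closed monoid.m_assoc monoid.one_closed
       monoid.l_one monoid.r_one)

theorem right_module_trivial: "category C \<Longrightarrow> right_module C trivial_module"
  by (intro right_module.intro right_module_axioms.intro)
    (auto simp: trivial_module_def abelian_integer_group hom_def)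

theorem left_module_restrict:
  assumes "cat_functor A B Fo Fm" "left_module B N"
  shows "left_module A (restrict_module Fo Fm N)"
proof -
  interpret F: cat_functor A B Fo Fm by fact
  interpret N: left_module B N by fact
  show ?thesis
    by (intro left_module.intro left_module_axioms.intro)
      (use N.act_hom[OF F.map_Hom] in \<open>auto simp: restrict_module_def F.A.category_axioms N.val_comm_group
        F.map_obj F.map_idn F.map_cmp N.act_idn N.act_cmp[OF F.map_Hom F.map_Hom]\<close>)
qed

end

theory Submission
  imports Defs
begin

text \<open>Induction \<open>M \<mapsto> \<int>\<G> \<otimes>\<^sub>C M\<close> is left adjoint to restriction along \<open>C \<rightarrow> \<G>\<close>, hence preserves lifting
  properties, and it is exact: by the left Ore condition every element of the induced module at \<open>x\<close> is
  a single fraction \<open>f\<^sup>-\<^sup>1 \<otimes> a\<close>, which is trivial only if \<open>u.a\<close> is for some \<open>u\<close>. So it turns a projective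
  resolution of \<open>M\<close> into a resolution of the induced module that computes \<open>\<G>\<close>-homology, while the
  coinvariants \<open>\<int> \<otimes> P\<close> do not change, because homomorphisms into constant modules are the same on both
  sides. For an equivalence \<open>G \<rightarrow> \<G>\<close> the same argument is run with restriction and its inverse.\<close>

section \<open>The universal property of tensor products\<close>

text \<open>The obstacle behind the form of the proof is typing. \<open>projective\<close> and
  \<open>projective_resolution\<close> fix the element type \<open>univ\<close>, and
  \<open>cat_homology\<close> uses one resolution chosen there, whereas induced resolutions consist
  of cosets and do not live in the required type. Therefore the arguments use \<open>lifts\<close>,
  a lifting property against two named modules, which can be instantiated at each pair of types that
  a comparison meets and which passes along adjunctions. Exactness of induction needs control over a
  groupoid that is only given by words and generated relations. No second groupoid of fractions is
  built for this: words are evaluated inside the category as partial functions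
  (\<open>track\<close>), which yields injectivity of \<open>env_map\<close> and a numerator for
  each groupoid morphism. Likewise no localised module is built: trivial tensors are detected by a
  homomorphism out of the tensor product into a group of germs. Coinvariants are handled through
  maps into constant modules alone, so that the step to the groupoid and the step to the group are
  two instances of \<open>coinvariants_iso\<close>.\<close>

lemma FactGroup_lift:
  assumes "comm_group G" "subgroup K G" "group H" "h \<in> hom G H" and K: "\<And>k. k \<in> K \<Longrightarrow> h k = \<one>\<^bsub>H\<^esub>"
  obtains g where "g \<in> hom (G Mod K) H" "\<And>x. x \<in> carrier G \<Longrightarrow> g (K #>\<^bsub>G\<^esub> x) = h x"
proof -
  interpret G: comm_group G by fact
  interpret H: group H by fact
  interpret group_hom G H h using assms by unfold_locales auto
  have "K \<lhd> G" using G.subgroup_imp_normal assms(2) by blast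
  moreover have "K \<subseteq> kernel G H h"
    using K subgroup.subset[OF assms(2)] by (auto simp: kernel_def)
  ultimately show thesis using FactGroup_universal_kernel that by blast
qed

lemma FactGroup_proj_hom:
  assumes "comm_group G" "subgroup K G"
  shows "(\<lambda>x. K #>\<^bsub>G\<^esub> x) \<in> hom G (G Mod K)"
    and "k \<in> K \<Longrightarrow> K #>\<^bsub>G\<^esub> k = \<one>\<^bsub>G Mod K\<^esub>"
    and "x \<in> carrier G \<Longrightarrow> K #>\<^bsub>G\<^esub> x = \<one>\<^bsub>G Mod K\<^esub> \<Longrightarrow> x \<in> K"
proof -
  interpret G: comm_group G by fact
  have N: "K \<lhd> G" using G.subgroup_imp_normal assms(2) by blast
  show "(\<lambda>x. K #>\<^bsub>G\<^esub> x) \<in> hom G (G Mod K)"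
    by (rule normal.r_coset_hom_Mod[OF N])
  show "k \<in> K \<Longrightarrow> K #>\<^bsub>G\<^esub> k = \<one>\<^bsub>G Mod K\<^esub>"
    using G.coset_join2[OF _ assms(2)] subgroup.mem_carrier[OF assms(2)] by (simp add: FactGroup_def)
  show "x \<in> carrier G \<Longrightarrow> K #>\<^bsub>G\<^esub> x = \<one>\<^bsub>G Mod K\<^esub> \<Longrightarrow> x \<in> K"
    using G.rcos_self[OF _ assms(2)] by (auto simp: FactGroup_def)
qed

lemma generate_hom_trivial:
  assumes "group G" "group H" "h \<in> hom G H" "S \<subseteq> carrier G" "\<And>s. s \<in> S \<Longrightarrow> h s = \<one>\<^bsub>H\<^esub>" "x \<in> generate G S"
  shows "h x = \<one>\<^bsub>H\<^esub>"
  using hom_generate_subset[OF assms(1-4), of "{\<one>\<^bsub>H\<^esub>}"] assms(5,6) group.triv_subgroup[OF assms(2)] by auto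

lemma (in group) mult_inv_eq_one_iff:
  assumes "a \<in> carrier G" "b \<in> carrier G"
  shows "a \<otimes> inv b = \<one> \<longleftrightarrow> a = b"
  using inv_equality[of a "inv b"] assms by auto

lemma hom_free_diff:
  assumes "h \<in> hom (free_Abelian_group S) G" "group G" "Poly_Mapping.keys x \<subseteq> S" "Poly_Mapping.keys y \<subseteq> S"
  shows "h (x - y) = h x \<otimes>\<^bsub>G\<^esub> inv\<^bsub>G\<^esub> h y"
proof -
  interpret group_hom "free_Abelian_group S" G h
    using assms by (simp add: group_hom_def group_hom_axioms_def)
  have "h (x + - y) = h x \<otimes>\<^bsub>G\<^esub> h (- y)"
    using hom_mult[of x "- y"] assms(3,4) by simp
  then show ?thesis using hom_inv[of y] assms(4) by simp
qed

text \<open>A relator is a difference, so being killed and being respected are the same. Both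
  readings are used: one to factor a bilinear map through \<open>tensor_group\<close>, the other to
  see that the classes \<open>tens\<close> are bilinear.\<close>

lemma hom_free_rel:
  assumes h: "h \<in> hom (free_Abelian_group S) G" "group G" and S: "p \<in> S" "q \<in> S" "r \<in> S"
  shows "h (frag_of p - (frag_of q + frag_of r)) = \<one>\<^bsub>G\<^esub> \<longleftrightarrow> h (frag_of p) = h (frag_of q) \<otimes>\<^bsub>G\<^esub> h (frag_of r)"
proof -
  interpret group_hom "free_Abelian_group S" G h
    using h by (simp add: group_hom_def group_hom_axioms_def)
  have qr: "Poly_Mapping.keys (frag_of q + frag_of r) \<subseteq> S"
    using G.m_closed[of "frag_of q" "frag_of r"] S by simp
  have "h (frag_of q + frag_of r) = h (frag_of q) \<otimes>\<^bsub>G\<^esub> h (frag_of r)"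
    using hom_mult[of "frag_of q" "frag_of r"] S by simp
  moreover have "h (frag_of p) \<in> carrier G" "h (frag_of q) \<otimes>\<^bsub>G\<^esub> h (frag_of r) \<in> carrier G"
    using hom_closed S by auto
  ultimately show ?thesis
    using hom_free_diff[OF h _ qr, of "frag_of p"] S(1) H.mult_inv_eq_one_iff by simp
qed

lemma tensor_group_lift:
  assumes gr: "group A" "group B" and T: "comm_group T"
    and cl: "\<And>a b. \<lbrakk>a \<in> carrier A; b \<in> carrier B\<rbrakk> \<Longrightarrow> \<beta> a b \<in> carrier T"
    and left: "\<And>a a' b. \<lbrakk>a \<in> carrier A; a' \<in> carrier A; b \<in> carrier B\<rbrakk>
       \<Longrightarrow> \<beta> (a \<otimes>\<^bsub>A\<^esub> a') b = \<beta> a b \<otimes>\<^bsub>T\<^esub> \<beta> a' b"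
    and right: "\<And>a b b'. \<lbrakk>a \<in> carrier A; b \<in> carrier B; b' \<in> carrier B\<rbrakk>
       \<Longrightarrow> \<beta> a (b \<otimes>\<^bsub>B\<^esub> b') = \<beta> a b \<otimes>\<^bsub>T\<^esub> \<beta> a b'"
  obtains h where "h \<in> hom (tensor_group A B) T"
    "\<And>a b. \<lbrakk>a \<in> carrier A; b \<in> carrier B\<rbrakk> \<Longrightarrow> h (pure_tensor A B a b) = \<beta> a b"
proof -
  interpret A: group A by fact
  interpret B: group B by fact
  interpret T: comm_group T by fact
  let ?F = "free_Abelian_group (carrier A \<times> carrier B)"
  have img: "(\<lambda>(a, b). \<beta> a b) ` (carrier A \<times> carrier B) \<subseteq> carrier T" using cl by auto
  obtain k where k: "k \<in> hom ?F T" "\<And>s. s \<in> carrier A \<times> carrier B \<Longrightarrow> k (frag_of s) = (case s of (a, b) \<Rightarrow> \<beta> a b)"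
    using T.free_Abelian_group_universal[OF img] by blast
  interpret k: group_hom ?F T k using k(1) by (simp add: group_hom_def group_hom_axioms_def T.is_group)
  have rel: "k (frag_of p - (frag_of q + frag_of r)) = \<one>\<^bsub>T\<^esub>"
    if "p \<in> carrier A \<times> carrier B" "q \<in> carrier A \<times> carrier B" "r \<in> carrier A \<times> carrier B"
      "k (frag_of p) = k (frag_of q) \<otimes>\<^bsub>T\<^esub> k (frag_of r)" for p q r
  proof -
    show ?thesis using hom_free_rel[OF k(1) T.is_group that(1-3)] that(4) by blast
  qed
  have "k x = \<one>\<^bsub>T\<^esub>" if "x \<in> bilinear_rels A B" for x
  proof (rule generate_hom_trivial[OF _ _ k(1) bilinear_gens_closed[OF gr] _ that[unfolded bilinear_rels_def]])
    fix s assume "s \<in> {frag_of (a \<otimes>\<^bsub>A\<^esub> a', b) - (frag_of (a, b) + frag_of (a', b)) | a a' b.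
        a \<in> carrier A \<and> a' \<in> carrier A \<and> b \<in> carrier B} \<union>
     {frag_of (a, b \<otimes>\<^bsub>B\<^esub> b') - (frag_of (a, b) + frag_of (a, b')) | a b b'.
        a \<in> carrier A \<and> b \<in> carrier B \<and> b' \<in> carrier B}"
    then show "k s = \<one>\<^bsub>T\<^esub>"
      by (elim UnE CollectE exE conjE) (simp_all add: rel k(2) left right)
  qed auto
  from FactGroup_lift[OF abelian_free_Abelian_group subgroup_bilinear_rels[OF gr] _ k(1) this]
  obtain h where "h \<in> hom (?F Mod bilinear_rels A B) T"
    "\<And>x. x \<in> carrier ?F \<Longrightarrow> h (bilinear_rels A B #>\<^bsub>?F\<^esub> x) = k x"
    using T.is_group by blast
  then show thesis using k(2) by (intro that[of h]) (auto simp: tensor_group_def pure_tensor_def)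
qed

text \<open>Elements have finite support, so splitting off one coordinate at a time ends at the
  unit. The inner induction runs over a finite set that merely contains the support; the remainder
  after splitting off a coordinate then satisfies the induction hypothesis whether or not that
  coordinate was trivial.\<close>

lemma sum_group_induct [consumes 1, case_names group one mult single]:
  assumes "t \<in> carrier (sum_group I A)" and gr: "\<And>i. i \<in> I \<Longrightarrow> group (A i)"
    and one: "P \<one>\<^bsub>sum_group I A\<^esub>"
    and mult: "\<And>s t. \<lbrakk>s \<in> carrier (sum_group I A); t \<in> carrier (sum_group I A); P s; P t\<rbrakk>
      \<Longrightarrow> P (s \<otimes>\<^bsub>sum_group I A\<^esub> t)"
    and single: "\<And>i x. \<lbrakk>i \<in> I; x \<in> carrier (A i)\<rbrakk> \<Longrightarrow> P (\<lambda>j\<in>I. if j = i then x else \<one>\<^bsub>A j\<^esub>)"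
  shows "P t"
proof -
  have "P t" if "finite S" "t \<in> carrier (sum_group I A)" "{i \<in> I. t i \<noteq> \<one>\<^bsub>A i\<^esub>} \<subseteq> S" for S t
    using that
  proof (induction S arbitrary: t)
    case empty
    then have "t = \<one>\<^bsub>sum_group I A\<^esub>"
      by (auto simp: carrier_sum_group gr PiE_iff extensional_def)
    then show ?case using one by (simp only:)
  next
    case (insert i S)
    show ?case
    proof (cases "i \<in> I")
      case False
      then show ?thesis using insert by blast
    next
      case True
      let ?s = "\<lambda>j\<in>I. if j = i then t i else \<one>\<^bsub>A j\<^esub>"
      let ?r = "\<lambda>j\<in>I. if j = i then \<one>\<^bsub>A j\<^esub> else t j"
      have t: "t \<in> (\<Pi>\<^sub>E i\<in>I. carrier (A i))" "finite {i \<in> I. t i \<noteq> \<one>\<^bsub>A i\<^esub>}"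
        using insert.prems(1) by (auto simp: carrier_sum_group gr)
      have "finite {j \<in> I. ?s j \<noteq> \<one>\<^bsub>A j\<^esub>}" by (rule finite_subset[of _ "{i}"]) auto
      then have s: "?s \<in> carrier (sum_group I A)"
        using t by (auto simp: carrier_sum_group gr group.is_monoid monoid.one_closed)
      have "finite {j \<in> I. ?r j \<noteq> \<one>\<^bsub>A j\<^esub>}" by (rule finite_subset[OF _ t(2)]) auto
      then have r: "?r \<in> carrier (sum_group I A)"
        using t by (auto simp: carrier_sum_group gr group.is_monoid monoid.one_closed)
      have "t = ?s \<otimes>\<^bsub>sum_group I A\<^esub> ?r"
        using t True by (auto simp: PiE_iff extensional_def gr group.is_monoid monoid.l_one monoid.r_one)
      moreover have "P ?s" using t True by (intro single) auto
      moreover have "P ?r" using insert.prems(2) by (intro insert.IH r) auto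
      ultimately show ?thesis using mult[OF s r] by simp
    qed
  qed
  then show ?thesis using assms(1) by (auto simp: carrier_sum_group gr)
qed

text \<open>The class of an elementary tensor \<open>a \<otimes> b\<close> at the object
  \<open>z\<close>. Together with \<open>tensor_hom_eqI\<close>, \<open>tensor_lift\<close> and
  \<open>tensor_map_tens\<close> these classes replace the encoding of \<open>tensor\<close> by
  nested cosets in all later sections.\<close>

definition tens ::
  "('o, 'm) cat \<Rightarrow> ('o, 'm, 'r) cmod \<Rightarrow> ('o, 'm, 'a) cmod \<Rightarrow> 'o \<Rightarrow> 'r \<Rightarrow> 'a
    \<Rightarrow> ('o \<Rightarrow> ('r \<times> 'a \<Rightarrow>\<^sub>0 int) set) set"
  where "tens C R M z a b = balancing_rels C R M #>\<^bsub>tensor_sum C R M\<^esub> summand C R M z a b"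

context
  fixes C :: "('o, 'm) cat" and R :: "('o, 'm, 'r) cmod" and M :: "('o, 'm, 'a) cmod"
  assumes R: "right_module C R" and M: "left_module C M"
begin

interpretation R: right_module C R by (rule R)
interpretation M: left_module C M by (rule M)

lemma tens_groups:
  assumes "z \<in> obj C" shows "group (val R z)" "group (val M z)"
  using R.val_comm_group[OF assms] M.val_comm_group[OF assms] by (auto simp: comm_group_def)

lemma group_tensor: "group (tensor C R M)"
  using comm_group_tensor[OF R M] by (simp add: comm_group_def)

lemma tens_closed:
  "\<lbrakk>z \<in> obj C; a \<in> carrier (val R z); b \<in> carrier (val M z)\<rbrakk> \<Longrightarrow> tens C R M z a b \<in> carrier (tensor C R M)"
  using carrier_tensor[OF R M] summand_closed[OF R M] by (auto simp: tens_def)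

text \<open>The composite of the two quotient maps with the inclusion of the summand at
  \<open>z\<close>. Starting from a free abelian group, it reduces statements about the tensor
  product to free generators. The last clause records its value at an arbitrary combination
  \<open>c\<close>, since elements of a summand are classes of such combinations and not only of
  pure tensors.\<close>

lemma free_tensor_hom:
  assumes z: "z \<in> obj C"
  obtains q where "q \<in> hom (free_Abelian_group (carrier (val R z) \<times> carrier (val M z))) (tensor C R M)"
    "\<And>a b. q (frag_of (a, b)) = tens C R M z a b"
    "\<And>c. c \<in> bilinear_rels (val R z) (val M z) \<Longrightarrow> q c = \<one>\<^bsub>tensor C R M\<^esub>"
    "\<And>c. q c = balancing_rels C R M #>\<^bsub>tensor_sum C R M\<^esub> (\<lambda>i\<in>obj C. if i = z then bilinear_rels (val R z) (val M z)
        #>\<^bsub>free_Abelian_group (carrier (val R z) \<times> carrier (val M z))\<^esub> c else \<one>\<^bsub>tensor_group (val R i) (val M i)\<^esub>)"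
proof -
  let ?F = "free_Abelian_group (carrier (val R z) \<times> carrier (val M z))"
  let ?B = "bilinear_rels (val R z) (val M z)"
  let ?s = "\<lambda>X. \<lambda>i\<in>obj C. if i = z then X else \<one>\<^bsub>tensor_group (val R i) (val M i)\<^esub>"
  let ?K = "balancing_rels C R M"
  note S = comm_group_tensor_sum[OF R M]
  have s: "?s \<in> hom (tensor_group (val R z) (val M z)) (tensor_sum C R M)"
  proof (rule homI)
    fix X assume X: "X \<in> carrier (tensor_group (val R z) (val M z))"
    have "finite {i \<in> obj C. ?s X i \<noteq> \<one>\<^bsub>tensor_group (val R i) (val M i)\<^esub>}"
      by (rule finite_subset[of _ "{z}"]) auto
    then show "?s X \<in> carrier (tensor_sum C R M)"
      using X tensor_sum_groups[OF R M] unfolding carrier_tensor_sum[OF R M]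
      by (auto simp: group.is_monoid monoid.one_closed)
  next
    fix X Y
    show "?s (X \<otimes>\<^bsub>tensor_group (val R z) (val M z)\<^esub> Y) = ?s X \<otimes>\<^bsub>tensor_sum C R M\<^esub> ?s Y"
      using tensor_sum_groups[OF R M]
      by (auto simp: tensor_sum_def group.is_monoid monoid.one_closed monoid.l_one intro!: restrict_ext)
  qed
  note p = FactGroup_proj_hom[OF abelian_free_Abelian_group subgroup_bilinear_rels[OF tens_groups[OF z]]]
  note k = FactGroup_proj_hom[OF S subgroup_balancing_rels[OF R M]]
  let ?q = "(\<lambda>t. ?K #>\<^bsub>tensor_sum C R M\<^esub> t) \<circ> (?s \<circ> (\<lambda>c. ?B #>\<^bsub>?F\<^esub> c))"
  show thesis
  proof (rule that[of ?q])
    show "?q \<in> hom ?F (tensor C R M)"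
      by (rule hom_compose[OF hom_compose[OF p(1)[folded tensor_group_def] s] k(1)[folded tensor_def]])
    show "?q (frag_of (a, b)) = tens C R M z a b" for a b
      unfolding tens_def summand_def pure_tensor_def comp_apply by (rule refl)
    fix c assume "c \<in> ?B"
    then have "?B #>\<^bsub>?F\<^esub> c = \<one>\<^bsub>tensor_group (val R z) (val M z)\<^esub>"
      using p(2) by (simp add: tensor_group_def)
    then have "?s (?B #>\<^bsub>?F\<^esub> c) = \<one>\<^bsub>tensor_sum C R M\<^esub>"
      unfolding tensor_sum_def one_sum_group by (intro restrict_ext) (simp split: if_split)
    moreover have "\<one>\<^bsub>tensor_sum C R M\<^esub> \<in> ?K"
      using subgroup.one_closed[OF subgroup_balancing_rels[OF R M]] .
    ultimately show "?q c = \<one>\<^bsub>tensor C R M\<^esub>" using k(2) by (simp add: tensor_def)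
  qed simp
qed

lemma tens_mult:
  assumes z: "z \<in> obj C"
  shows tens_mult_left: "\<lbrakk>a \<in> carrier (val R z); a' \<in> carrier (val R z); b \<in> carrier (val M z)\<rbrakk> \<Longrightarrow>
     tens C R M z (a \<otimes>\<^bsub>val R z\<^esub> a') b = tens C R M z a b \<otimes>\<^bsub>tensor C R M\<^esub> tens C R M z a' b"
   and tens_mult_right: "\<lbrakk>a \<in> carrier (val R z); b \<in> carrier (val M z); b' \<in> carrier (val M z)\<rbrakk> \<Longrightarrow>
     tens C R M z a (b \<otimes>\<^bsub>val M z\<^esub> b') = tens C R M z a b \<otimes>\<^bsub>tensor C R M\<^esub> tens C R M z a b'"
proof -
  interpret Rz: group "val R z" by (rule tens_groups[OF z])
  interpret Mz: group "val M z" by (rule tens_groups[OF z])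
  let ?F = "free_Abelian_group (carrier (val R z) \<times> carrier (val M z))"
  obtain q where q: "q \<in> hom ?F (tensor C R M)"
    "\<And>a b. q (frag_of (a, b)) = tens C R M z a b"
    "\<And>c. c \<in> bilinear_rels (val R z) (val M z) \<Longrightarrow> q c = \<one>\<^bsub>tensor C R M\<^esub>"
    "\<And>c. q c = balancing_rels C R M #>\<^bsub>tensor_sum C R M\<^esub> (\<lambda>i\<in>obj C. if i = z then bilinear_rels (val R z) (val M z)
        #>\<^bsub>?F\<^esub> c else \<one>\<^bsub>tensor_group (val R i) (val M i)\<^esub>)"
    by (rule free_tensor_hom[OF z]) (rule that)
  interpret T: group "tensor C R M" by (rule group_tensor)
  interpret q: group_hom ?F "tensor C R M" q
    using q(1) by (simp add: group_hom_def group_hom_axioms_def T.is_group)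
  have rel: "q (frag_of p) = q (frag_of x) \<otimes>\<^bsub>tensor C R M\<^esub> q (frag_of y)"
    if "frag_of p - (frag_of x + frag_of y) \<in> bilinear_rels (val R z) (val M z)"
      "p \<in> carrier (val R z) \<times> carrier (val M z)" "x \<in> carrier (val R z) \<times> carrier (val M z)"
      "y \<in> carrier (val R z) \<times> carrier (val M z)" for p x y
  proof -
    show ?thesis using hom_free_rel[OF q(1) group_tensor that(2-4)] q(3)[OF that(1)] by blast
  qed
  show "\<lbrakk>a \<in> carrier (val R z); a' \<in> carrier (val R z); b \<in> carrier (val M z)\<rbrakk> \<Longrightarrow>
     tens C R M z (a \<otimes>\<^bsub>val R z\<^esub> a') b = tens C R M z a b \<otimes>\<^bsub>tensor C R M\<^esub> tens C R M z a' b"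
    using rel[OF bilinear_rels_left] q(2) by simp
  show "\<lbrakk>a \<in> carrier (val R z); b \<in> carrier (val M z); b' \<in> carrier (val M z)\<rbrakk> \<Longrightarrow>
     tens C R M z a (b \<otimes>\<^bsub>val M z\<^esub> b') = tens C R M z a b \<otimes>\<^bsub>tensor C R M\<^esub> tens C R M z a b'"
    using rel[OF bilinear_rels_right] q(2) by simp
qed

lemma tens_hom_left: "z \<in> obj C \<Longrightarrow> b \<in> carrier (val M z) \<Longrightarrow> (\<lambda>a. tens C R M z a b) \<in> hom (val R z) (tensor C R M)"
  by (intro homI tens_closed tens_mult_left)

lemma tens_hom_right: "z \<in> obj C \<Longrightarrow> a \<in> carrier (val R z) \<Longrightarrow> tens C R M z a \<in> hom (val M z) (tensor C R M)"
  by (intro homI tens_closed tens_mult_right)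

lemma tens_one_right: "z \<in> obj C \<Longrightarrow> a \<in> carrier (val R z) \<Longrightarrow> tens C R M z a \<one>\<^bsub>val M z\<^esub> = \<one>\<^bsub>tensor C R M\<^esub>"
  by (rule hom_one[OF tens_hom_right tens_groups(2) group_tensor])

lemma tens_balanced:
  assumes d: "d \<in> Hom C z z'" and a: "a \<in> carrier (val R z)" and b: "b \<in> carrier (val M z')"
  shows "tens C R M z' (act R d a) b = tens C R M z a (act M d b)"
proof -
  have z: "z \<in> obj C" "z' \<in> obj C" using R.Hom_obj[OF d] by auto
  have c: "act R d a \<in> carrier (val R z')" "act M d b \<in> carrier (val M z)"
    using hom_in_carrier[OF R.act_hom[OF d] a] hom_in_carrier[OF M.act_hom[OF d] b] by auto
  interpret S: comm_group "tensor_sum C R M" by (rule comm_group_tensor_sum[OF R M])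
  interpret T: group "tensor C R M" by (rule group_tensor)
  note k = FactGroup_proj_hom[OF comm_group_tensor_sum[OF R M] subgroup_balancing_rels[OF R M]]
  interpret k: group_hom "tensor_sum C R M" "tensor C R M" "\<lambda>t. balancing_rels C R M #>\<^bsub>tensor_sum C R M\<^esub> t"
    using k(1) by unfold_locales (simp add: tensor_def)
  note s = summand_closed[OF R M z(2) c(1) b] summand_closed[OF R M z(1) a c(2)]
  have "summand C R M z' (act R d a) b \<otimes>\<^bsub>tensor_sum C R M\<^esub>
       inv\<^bsub>tensor_sum C R M\<^esub> (summand C R M z a (act M d b)) \<in> balancing_rels C R M"
    unfolding balancing_rels_def using a b d by (intro generate.incl) blast
  from k(2)[OF this] have "tens C R M z' (act R d a) b \<otimes>\<^bsub>tensor C R M\<^esub>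
      inv\<^bsub>tensor C R M\<^esub> tens C R M z a (act M d b) = \<one>\<^bsub>tensor C R M\<^esub>"
    using s k.hom_mult[OF s(1) S.inv_closed[OF s(2)]] k.hom_inv[OF s(2)] by (simp add: tens_def tensor_def)
  then show ?thesis
    using tens_closed[OF z(2) c(1) b] tens_closed[OF z(1) a c(2)]
    by (metis T.inv_solve_right' T.l_one T.one_closed)
qed

text \<open>Any element is a product of single-component elements, and each of these is the image
  under \<open>free_tensor_hom\<close> of a combination of pairs. Phrasing generation by a subgroup
  \<open>H\<close> lets \<open>H\<close> be an equalizer in \<open>tensor_hom_eqI\<close> and, by
  way of \<open>induced_generated\<close>, the set of single fractions in
  \<open>induced_fraction\<close>.\<close>

lemma tensor_generated:
  assumes H: "subgroup H (tensor C R M)"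
    and t: "\<And>z a b. \<lbrakk>z \<in> obj C; a \<in> carrier (val R z); b \<in> carrier (val M z)\<rbrakk> \<Longrightarrow> tens C R M z a b \<in> H"
  shows "carrier (tensor C R M) \<subseteq> H"
proof
  fix X assume "X \<in> carrier (tensor C R M)"
  then obtain t where t': "t \<in> carrier (tensor_sum C R M)" "X = balancing_rels C R M #>\<^bsub>tensor_sum C R M\<^esub> t"
    using carrier_tensor[OF R M] by blast
  interpret H: subgroup H "tensor C R M" by fact
  interpret T: group "tensor C R M" by (rule group_tensor)
  interpret S: comm_group "tensor_sum C R M" by (rule comm_group_tensor_sum[OF R M])
  note k = FactGroup_proj_hom[OF comm_group_tensor_sum[OF R M] subgroup_balancing_rels[OF R M]]
  interpret k: group_hom "tensor_sum C R M" "tensor C R M" "\<lambda>t. balancing_rels C R M #>\<^bsub>tensor_sum C R M\<^esub> t"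
    using k(1) by unfold_locales (simp add: tensor_def)
  have "balancing_rels C R M #>\<^bsub>tensor_sum C R M\<^esub> t \<in> H"
  proof (rule sum_group_induct[of t "obj C" "\<lambda>z. tensor_group (val R z) (val M z)", folded tensor_sum_def,
        where P="\<lambda>t. balancing_rels C R M #>\<^bsub>tensor_sum C R M\<^esub> t \<in> H"])
    show "balancing_rels C R M #>\<^bsub>tensor_sum C R M\<^esub> \<one>\<^bsub>tensor_sum C R M\<^esub> \<in> H"
      using k.hom_one H.one_closed by (simp only:)
  next
    fix s t assume "s \<in> carrier (tensor_sum C R M)" "t \<in> carrier (tensor_sum C R M)"
      "balancing_rels C R M #>\<^bsub>tensor_sum C R M\<^esub> s \<in> H" "balancing_rels C R M #>\<^bsub>tensor_sum C R M\<^esub> t \<in> H"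
    then show "balancing_rels C R M #>\<^bsub>tensor_sum C R M\<^esub> (s \<otimes>\<^bsub>tensor_sum C R M\<^esub> t) \<in> H"
      using k.hom_mult H.m_closed by (simp only:)
  next
    fix z x assume z: "z \<in> obj C" and x: "x \<in> carrier (tensor_group (val R z) (val M z))"
    let ?F = "free_Abelian_group (carrier (val R z) \<times> carrier (val M z))"
    obtain q where q: "q \<in> hom ?F (tensor C R M)" "\<And>a b. q (frag_of (a, b)) = tens C R M z a b"
     "\<And>c. c \<in> bilinear_rels (val R z) (val M z) \<Longrightarrow> q c = \<one>\<^bsub>tensor C R M\<^esub>"
     "\<And>c. q c = balancing_rels C R M #>\<^bsub>tensor_sum C R M\<^esub> (\<lambda>i\<in>obj C. if i = z then bilinear_rels (val R z) (val M z)
        #>\<^bsub>?F\<^esub> c else \<one>\<^bsub>tensor_group (val R i) (val M i)\<^esub>)"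
      by (rule free_tensor_hom[OF z]) (rule that)
    interpret q: group_hom ?F "tensor C R M" q
      using q(1) by (simp add: group_hom_def group_hom_axioms_def T.is_group)
    obtain c where c: "Poly_Mapping.keys c \<subseteq> carrier (val R z) \<times> carrier (val M z)"
      "x = bilinear_rels (val R z) (val M z) #>\<^bsub>?F\<^esub> c"
      using carrier_tensor_group[OF tens_groups[OF z]] x by blast
    have "q c \<in> H"
    proof (rule free_Abelian_group_induct[OF c(1), where P="\<lambda>c. q c \<in> H"])
      show "q 0 \<in> H" using q.hom_one H.one_closed by simp
      fix x y assume *: "Poly_Mapping.keys x \<subseteq> carrier (val R z) \<times> carrier (val M z)"
        "Poly_Mapping.keys y \<subseteq> carrier (val R z) \<times> carrier (val M z)" "q x \<in> H" "q y \<in> H"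
      then show "q (x - y) \<in> H"
        using hom_free_diff[OF q(1) group_tensor *(1,2)] H.m_closed H.m_inv_closed by simp
    qed (use q(2) t[OF z] in auto)
    then show "balancing_rels C R M #>\<^bsub>tensor_sum C R M\<^esub>
        (\<lambda>i\<in>obj C. if i = z then x else \<one>\<^bsub>tensor_group (val R i) (val M i)\<^esub>) \<in> H"
      unfolding q(4) c(2) .
  qed (use t'(1) tensor_sum_groups[OF R M] in auto)
  then show "X \<in> H" using t' by simp
qed

text \<open>The elements on which \<open>h\<close> and \<open>k\<close> agree form a subgroup, so
  agreement on the elementary tensors is enough.\<close>

lemma tensor_hom_eqI:
  assumes "h \<in> hom (tensor C R M) T" "k \<in> hom (tensor C R M) T" "group T"
    and t: "\<And>z a b. \<lbrakk>z \<in> obj C; a \<in> carrier (val R z); b \<in> carrier (val M z)\<rbrakk>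
       \<Longrightarrow> h (tens C R M z a b) = k (tens C R M z a b)"
    and X: "X \<in> carrier (tensor C R M)"
  shows "h X = k X"
proof -
  interpret T: group T by fact
  interpret X: group "tensor C R M" by (rule group_tensor)
  interpret h: group_hom "tensor C R M" T h using assms by unfold_locales
  interpret k: group_hom "tensor C R M" T k using assms by unfold_locales
  have "subgroup {X \<in> carrier (tensor C R M). h X = k X} (tensor C R M)"
    by (rule X.subgroupI) (auto intro: exI[of _ "\<one>\<^bsub>tensor C R M\<^esub>"])
  from tensor_generated[OF this] t tens_closed X show ?thesis by blast
qed

text \<open>The universal property: a balanced biadditive family extends to the direct sum by
  multiplying the values in all components, a finite product since supports are finite, and this
  extension kills the balancing relators.\<close>

lemma tensor_lift:
  assumes T: "comm_group T"
    and cl: "\<And>z a b. \<lbrakk>z \<in> obj C; a \<in> carrier (val R z); b \<in> carrier (val M z)\<rbrakk> \<Longrightarrow> \<beta> z a b \<in> carrier T"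
    and left: "\<And>z a a' b. \<lbrakk>z \<in> obj C; a \<in> carrier (val R z); a' \<in> carrier (val R z); b \<in> carrier (val M z)\<rbrakk>
       \<Longrightarrow> \<beta> z (a \<otimes>\<^bsub>val R z\<^esub> a') b = \<beta> z a b \<otimes>\<^bsub>T\<^esub> \<beta> z a' b"
    and right: "\<And>z a b b'. \<lbrakk>z \<in> obj C; a \<in> carrier (val R z); b \<in> carrier (val M z); b' \<in> carrier (val M z)\<rbrakk>
       \<Longrightarrow> \<beta> z a (b \<otimes>\<^bsub>val M z\<^esub> b') = \<beta> z a b \<otimes>\<^bsub>T\<^esub> \<beta> z a b'"
    and bal: "\<And>d z z' a b. \<lbrakk>d \<in> Hom C z z'; a \<in> carrier (val R z); b \<in> carrier (val M z')\<rbrakk>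
       \<Longrightarrow> \<beta> z' (act R d a) b = \<beta> z a (act M d b)"
  obtains h where "h \<in> hom (tensor C R M) T"
    "\<And>z a b. \<lbrakk>z \<in> obj C; a \<in> carrier (val R z); b \<in> carrier (val M z)\<rbrakk> \<Longrightarrow> h (tens C R M z a b) = \<beta> z a b"
proof -
  interpret T: comm_group T by fact
  let ?TG = "\<lambda>z. tensor_group (val R z) (val M z)"
  interpret S: comm_group "tensor_sum C R M" by (rule comm_group_tensor_sum[OF R M])
  have "\<exists>k. k \<in> hom (?TG z) T \<and> (\<forall>a \<in> carrier (val R z). \<forall>b \<in> carrier (val M z).
      k (pure_tensor (val R z) (val M z) a b) = \<beta> z a b)" if z: "z \<in> obj C" for z
    by (rule tensor_group_lift[OF tens_groups[OF z] T, of "\<beta> z"]) (use z cl left right in blast)+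
  then obtain k where k: "\<And>z. z \<in> obj C \<Longrightarrow> k z \<in> hom (?TG z) T"
    "\<And>z a b. \<lbrakk>z \<in> obj C; a \<in> carrier (val R z); b \<in> carrier (val M z)\<rbrakk>
       \<Longrightarrow> k z (pure_tensor (val R z) (val M z) a b) = \<beta> z a b"
    by metis
  let ?h = "\<lambda>t. gfinprod T (\<lambda>z. k z (t z)) (obj C)"
  have h: "?h \<in> hom (tensor_sum C R M) T"
    unfolding tensor_sum_def by (rule T.hom_group_sum) (use k(1) tensor_sum_groups[OF R M] in auto)
  interpret h: group_hom "tensor_sum C R M" T ?h using h by unfold_locales
  have hs: "?h (summand C R M z a b) = \<beta> z a b"
    if z: "z \<in> obj C" "a \<in> carrier (val R z)" "b \<in> carrier (val M z)" for z a b
  proof -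
    have one: "k i \<one>\<^bsub>?TG i\<^esub> = \<one>\<^bsub>T\<^esub>" if "i \<in> obj C" for i
      using hom_one[OF k(1) tensor_sum_groups[OF R M]] that T.is_group by blast
    have e: "gfinprod T (\<lambda>i. k i (summand C R M z a b i)) (obj C) =
      gfinprod T (\<lambda>i. if i = z then \<beta> z a b else \<one>\<^bsub>T\<^esub>) (obj C)"
      by (rule T.gfinprod_cong) (use cl z one k(2) in \<open>auto simp: summand_def simp_implies_def\<close>)
    \<comment> \<open>\<open>gfinprod\<close> multiplies over the indices with nontrivial factor, so
      a trivial value \<open>\<beta> z a b\<close> leaves an empty index set instead of
      \<open>{z}\<close>.\<close>
    have "gfinprod T (\<lambda>i. if i = z then \<beta> z a b else \<one>\<^bsub>T\<^esub>) (obj C) = \<beta> z a b"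
    proof (cases "\<beta> z a b = \<one>\<^bsub>T\<^esub>")
      case True
      then show ?thesis by (simp add: gfinprod_def)
    next
      case False
      then have "{i \<in> obj C. (if i = z then \<beta> z a b else \<one>\<^bsub>T\<^esub>) \<noteq> \<one>\<^bsub>T\<^esub>} = {z}" using z by auto
      then show ?thesis unfolding gfinprod_def using cl[OF z] by simp
    qed
    with e show ?thesis by simp
  qed
  have "?h x = \<one>\<^bsub>T\<^esub>" if x: "x \<in> balancing_rels C R M" for x
  proof (rule generate_hom_trivial[OF _ _ h balancing_gens_closed[OF R M] _ x[unfolded balancing_rels_def]])
    fix s assume "s \<in> {summand C R M z' (act R d a) b \<otimes>\<^bsub>tensor_sum C R M\<^esub>
       inv\<^bsub>tensor_sum C R M\<^esub> (summand C R M z a (act M d b)) | d z z' a b.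
       d \<in> Hom C z z' \<and> a \<in> carrier (val R z) \<and> b \<in> carrier (val M z')}"
    then obtain d z z' a b where s: "s = summand C R M z' (act R d a) b \<otimes>\<^bsub>tensor_sum C R M\<^esub>
       inv\<^bsub>tensor_sum C R M\<^esub> (summand C R M z a (act M d b))"
      and d: "d \<in> Hom C z z'" and a: "a \<in> carrier (val R z)" and b: "b \<in> carrier (val M z')" by blast
    have z: "z \<in> obj C" "z' \<in> obj C" using R.Hom_obj[OF d] by auto
    have c: "act R d a \<in> carrier (val R z')" "act M d b \<in> carrier (val M z)"
      using hom_in_carrier[OF R.act_hom[OF d] a] hom_in_carrier[OF M.act_hom[OF d] b] by auto
    note sc = summand_closed[OF R M z(2) c(1) b] summand_closed[OF R M z(1) a c(2)]
    have "?h s = ?h (summand C R M z' (act R d a) b) \<otimes>\<^bsub>T\<^esub> inv\<^bsub>T\<^esub> ?h (summand C R M z a (act M d b))"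
      unfolding s using h.hom_mult[OF sc(1) S.inv_closed[OF sc(2)]] h.hom_inv[OF sc(2)] by simp
    also have "\<dots> = \<one>\<^bsub>T\<^esub>"
      unfolding hs[OF z(2) c(1) b] hs[OF z(1) a c(2)] bal[OF d a b] using cl[OF z(1) a c(2)] by simp
    finally show "?h s = \<one>\<^bsub>T\<^esub>" .
  qed unfold_locales
  from FactGroup_lift[OF comm_group_tensor_sum[OF R M] subgroup_balancing_rels[OF R M] _ h this]
  obtain g where "g \<in> hom (tensor C R M) T"
     "\<And>x. x \<in> carrier (tensor_sum C R M) \<Longrightarrow> g (balancing_rels C R M #>\<^bsub>tensor_sum C R M\<^esub> x) = ?h x"
    using T.is_group unfolding tensor_def by blast
  then show thesis using hs summand_closed[OF R M] by (intro that[of g]) (auto simp: tens_def)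
qed

end

lemma tensor_map_tens:
  assumes R: "right_module C R" and M: "left_module C M" and R': "right_module C R'" and M': "left_module C M'"
    and \<rho>: "right_module_hom C R R' \<rho>" and \<mu>: "module_hom C M M' \<mu>"
    and z: "z \<in> obj C" "a \<in> carrier (val R z)" "b \<in> carrier (val M z)"
  shows "tensor_map C R' M' \<rho> \<mu> (tens C R M z a b) = tens C R' M' z (\<rho> z a) (\<mu> z b)"
proof -
  have gr: "group (val R z)" "group (val M z)" "group (val R' z)" "group (val M' z)" if "z \<in> obj C" for z
    using tens_groups[OF R M that] tens_groups[OF R' M' that] by auto
  have rm: "\<rho> z \<in> hom (val R z) (val R' z)" "\<mu> z \<in> hom (val M z) (val M' z)" if "z \<in> obj C" for z
    using \<rho> \<mu> that by (auto simp: right_module_hom_def module_hom_def)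
  have "tensor_group_map (val R' i) (val M' i) (\<rho> i) (\<mu> i) \<one>\<^bsub>tensor_group (val R i) (val M i)\<^esub> =
      \<one>\<^bsub>tensor_group (val R' i) (val M' i)\<^esub>" if i: "i \<in> obj C" for i
    by (rule hom_one[OF tensor_group_map_hom[OF gr[OF i] rm[OF i]] tensor_sum_groups[OF R M i] tensor_sum_groups[OF R' M' i]])
  then have "(\<lambda>i \<in> obj C. tensor_group_map (val R' i) (val M' i) (\<rho> i) (\<mu> i) (summand C R M z a b i)) =
      summand C R' M' z (\<rho> z a) (\<mu> z b)"
    using tensor_group_map_pure[OF gr[OF z(1)] rm[OF z(1)] z(2,3)]
    by (auto simp: summand_def intro!: restrict_ext)
  then show ?thesis
    using tensor_map_coset[OF R M R' M' \<rho> \<mu> summand_closed[OF R M z]] by (simp add: tens_def)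
qed

section \<open>Homology of complexes of abelian groups\<close>

definition chain_complex :: "(nat \<Rightarrow> 'a monoid) \<Rightarrow> (nat \<Rightarrow> 'a \<Rightarrow> 'a) \<Rightarrow> bool"
  where "chain_complex A d \<longleftrightarrow> (\<forall>n. comm_group (A n)) \<and> (\<forall>n. d n \<in> hom (A (Suc n)) (A n)) \<and>
    (\<forall>n. \<forall>a \<in> carrier (A (Suc (Suc n))). d n (d (Suc n) a) = \<one>\<^bsub>A n\<^esub>)"

definition chain_map ::
  "(nat \<Rightarrow> 'a monoid) \<Rightarrow> (nat \<Rightarrow> 'a \<Rightarrow> 'a) \<Rightarrow> (nat \<Rightarrow> 'b monoid) \<Rightarrow> (nat \<Rightarrow> 'b \<Rightarrow> 'b)
    \<Rightarrow> (nat \<Rightarrow> 'a \<Rightarrow> 'b) \<Rightarrow> bool"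
  where "chain_map A d B e F \<longleftrightarrow> (\<forall>n. F n \<in> hom (A n) (B n)) \<and>
    (\<forall>n. \<forall>a \<in> carrier (A (Suc n)). F n (d n a) = e n (F (Suc n) a))"

context
  fixes A :: "nat \<Rightarrow> 'a monoid" and d :: "nat \<Rightarrow> 'a \<Rightarrow> 'a"
  assumes A: "chain_complex A d"
begin

lemma chain_complex_group_hom: "group_hom (A (Suc n)) (A n) (d n)"
  using A by (simp add: chain_complex_def group_hom_def group_hom_axioms_def comm_group_def)

lemma subgroup_cycles: "subgroup (cycles A d n) (A n)"
proof (cases n)
  case 0
  have "group (A 0)" using A by (simp add: chain_complex_def comm_group_def)
  then show ?thesis using 0 by (simp add: group.subgroup_self)
next
  case (Suc m)
  then show ?thesis using group_hom.subgroup_kernel[OF chain_complex_group_hom[of m]] by simp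
qed

lemma boundary_cycle: "d n ` carrier (A (Suc n)) \<subseteq> cycles A d n"
proof (cases n)
  case 0
  then show ?thesis using group_hom.hom_closed[OF chain_complex_group_hom] by auto
next
  case (Suc m)
  then show ?thesis
    using A group_hom.hom_closed[OF chain_complex_group_hom[of "Suc m"]] by (auto simp: kernel_def chain_complex_def)
qed

lemma comm_group_cycles: "comm_group ((A n)\<lparr>carrier := cycles A d n\<rparr>)"
  using comm_group_restrict subgroup_cycles A by (auto simp: chain_complex_def)

lemma subgroup_boundaries: "subgroup (d n ` carrier (A (Suc n))) ((A n)\<lparr>carrier := cycles A d n\<rparr>)"
proof -
  have "subgroup (d n ` carrier (A (Suc n))) (A n)"
    using group_hom.img_is_subgroup[OF chain_complex_group_hom] .
  moreover have "group (A n)" using A by (simp add: chain_complex_def comm_group_def)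
  ultimately show ?thesis
    using group.subgroup_incl[OF _ _ subgroup_cycles boundary_cycle] by blast
qed

end

lemma chain_map_cycles:
  assumes A: "chain_complex A d" and B: "chain_complex B e" and F: "chain_map A d B e F" and a: "a \<in> cycles A d n"
  shows "F n a \<in> cycles B e n"
proof (cases n)
  case 0
  then show ?thesis using F a by (auto simp: chain_map_def hom_def)
next
  case (Suc m)
  interpret F: group_hom "A m" "B m" "F m"
    using A B F by (simp add: chain_complex_def chain_map_def group_hom_def group_hom_axioms_def comm_group_def)
  have "a \<in> carrier (A (Suc m))" "d m a = \<one>\<^bsub>A m\<^esub>" using a Suc by (auto simp: kernel_def)
  moreover from this have "e m (F (Suc m) a) = F m (d m a)" using F unfolding chain_map_def by metis
  moreover from calculation have "F (Suc m) a \<in> carrier (B (Suc m))" using F by (auto simp: chain_map_def hom_def)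
  ultimately show ?thesis using F.hom_one Suc by (simp add: kernel_def)
qed

lemma homology_map:
  assumes A: "chain_complex A d" and B: "chain_complex B e" and F: "chain_map A d B e F"
  obtains h where "h \<in> hom (homology_group A d n) (homology_group B e n)"
    "\<And>a. a \<in> cycles A d n \<Longrightarrow> h (d n ` carrier (A (Suc n)) #>\<^bsub>(A n)\<lparr>carrier := cycles A d n\<rparr>\<^esub> a) =
       e n ` carrier (B (Suc n)) #>\<^bsub>(B n)\<lparr>carrier := cycles B e n\<rparr>\<^esub> F n a"
proof -
  have F': "F n \<in> hom ((A n)\<lparr>carrier := cycles A d n\<rparr>) ((B n)\<lparr>carrier := cycles B e n\<rparr>)"
    using F chain_map_cycles[OF A B F] subgroup.mem_carrier[OF subgroup_cycles[OF A]]
    by (auto simp: hom_def chain_map_def)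
  have im: "F n ` d n ` carrier (A (Suc n)) \<subseteq> e n ` carrier (B (Suc n))"
  proof safe
    fix a assume a: "a \<in> carrier (A (Suc n))"
    then have "F (Suc n) a \<in> carrier (B (Suc n))" using F by (auto simp: hom_def chain_map_def)
    then show "F n (d n a) \<in> e n ` carrier (B (Suc n))" using F a by (simp add: chain_map_def)
  qed
  note c = coset_map[OF comm_group_cycles[OF A] comm_group_cycles[OF B] subgroup_boundaries[OF A]
      subgroup_boundaries[OF B] F' im]
  show thesis
    by (rule that[OF c(2)[folded homology_group_def]]) (use c(1) in simp)
qed

text \<open>Only the action on classes matters, so the composites are required to fix each cycle up
  to a boundary rather than to be homotopic to the identity. This covers both homotopy equivalences
  and degreewise isomorphisms.\<close>

lemma homology_iso:
  assumes A: "chain_complex A d" and B: "chain_complex B e"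
    and F: "chain_map A d B e F" and G: "chain_map B e A d G"
    and GF: "\<And>n a. a \<in> cycles A d n \<Longrightarrow> \<exists>c \<in> carrier (A (Suc n)). G n (F n a) = a \<otimes>\<^bsub>A n\<^esub> d n c"
    and FG: "\<And>n b. b \<in> cycles B e n \<Longrightarrow> \<exists>c \<in> carrier (B (Suc n)). F n (G n b) = b \<otimes>\<^bsub>B n\<^esub> e n c"
  shows "homology_group A d n \<cong> homology_group B e n"
proof -
  \<comment> \<open>Adding a boundary does not change a class. The fact is stated for any complex
    because both \<open>A\<close> and \<open>B\<close> use it.\<close>
  have coset: "d n ` carrier (A (Suc n)) #>\<^bsub>(A n)\<lparr>carrier := cycles A d n\<rparr>\<^esub> (a \<otimes>\<^bsub>A n\<^esub> d n c) =
      d n ` carrier (A (Suc n)) #>\<^bsub>(A n)\<lparr>carrier := cycles A d n\<rparr>\<^esub> a"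
    if A: "chain_complex A d" and a: "a \<in> cycles A d n" and c: "c \<in> carrier (A (Suc n))" for A :: "nat \<Rightarrow> 'x monoid" and d a c
  proof -
    interpret Z: comm_group "(A n)\<lparr>carrier := cycles A d n\<rparr>" by (rule comm_group_cycles[OF A])
    let ?K = "d n ` carrier (A (Suc n))"
    have dc: "d n c \<in> ?K" using c by blast
    then have dc': "d n c \<in> cycles A d n" using boundary_cycle[OF A] by blast
    have "?K #>\<^bsub>(A n)\<lparr>carrier := cycles A d n\<rparr>\<^esub> (d n c \<otimes>\<^bsub>A n\<^esub> a) =
        ?K #>\<^bsub>(A n)\<lparr>carrier := cycles A d n\<rparr>\<^esub> d n c #>\<^bsub>(A n)\<lparr>carrier := cycles A d n\<rparr>\<^esub> a"
      using Z.coset_mult_assoc[of ?K "d n c" a] boundary_cycle[OF A] dc' a by simp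
    also have "?K #>\<^bsub>(A n)\<lparr>carrier := cycles A d n\<rparr>\<^esub> d n c = ?K"
      using Z.coset_join2[OF _ subgroup_boundaries[OF A] dc] dc' by simp
    also have "d n c \<otimes>\<^bsub>A n\<^esub> a = a \<otimes>\<^bsub>A n\<^esub> d n c" using Z.m_comm[of "d n c" a] a dc' by simp
    finally show ?thesis .
  qed
  obtain f where f: "f \<in> hom (homology_group A d n) (homology_group B e n)"
    "\<And>a. a \<in> cycles A d n \<Longrightarrow> f (d n ` carrier (A (Suc n)) #>\<^bsub>(A n)\<lparr>carrier := cycles A d n\<rparr>\<^esub> a) =
       e n ` carrier (B (Suc n)) #>\<^bsub>(B n)\<lparr>carrier := cycles B e n\<rparr>\<^esub> F n a"
    by (rule homology_map[OF A B F]) (rule that)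
  obtain g where g: "g \<in> hom (homology_group B e n) (homology_group A d n)"
    "\<And>b. b \<in> cycles B e n \<Longrightarrow> g (e n ` carrier (B (Suc n)) #>\<^bsub>(B n)\<lparr>carrier := cycles B e n\<rparr>\<^esub> b) =
       d n ` carrier (A (Suc n)) #>\<^bsub>(A n)\<lparr>carrier := cycles A d n\<rparr>\<^esub> G n b"
    by (rule homology_map[OF B A G]) (rule that)
  have "g (f X) = X" if "X \<in> carrier (homology_group A d n)" for X
  proof -
    obtain a where a: "a \<in> cycles A d n" "X = d n ` carrier (A (Suc n)) #>\<^bsub>(A n)\<lparr>carrier := cycles A d n\<rparr>\<^esub> a"
      using \<open>X \<in> _\<close> by (auto simp: homology_group_def FactGroup_def RCOSETS_def)
    obtain c where "c \<in> carrier (A (Suc n))" "G n (F n a) = a \<otimes>\<^bsub>A n\<^esub> d n c" using GF[OF a(1)] by blast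
    then show ?thesis using f(2)[OF a(1)] g(2)[OF chain_map_cycles[OF A B F a(1)]] coset[OF A a(1)] a(2) by simp
  qed
  moreover have "f (g Y) = Y" if "Y \<in> carrier (homology_group B e n)" for Y
  proof -
    obtain b where b: "b \<in> cycles B e n" "Y = e n ` carrier (B (Suc n)) #>\<^bsub>(B n)\<lparr>carrier := cycles B e n\<rparr>\<^esub> b"
      using \<open>Y \<in> _\<close> by (auto simp: homology_group_def FactGroup_def RCOSETS_def)
    obtain c where "c \<in> carrier (B (Suc n))" "F n (G n b) = b \<otimes>\<^bsub>B n\<^esub> e n c" using FG[OF b(1)] by blast
    then show ?thesis using g(2)[OF b(1)] f(2)[OF chain_map_cycles[OF B A G b(1)]] coset[OF B b(1)] b(2) by simp
  qed
  ultimately have "bij_betw f (carrier (homology_group A d n)) (carrier (homology_group B e n))"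
    using f(1) g(1) by (intro bij_betw_byWitness[where f'=g]) (auto simp: hom_def)
  then show ?thesis using f(1) by (auto simp: is_iso_def iso_def)
qed

section \<open>Comparison of resolutions\<close>

lemma module_hom_group_hom:
  assumes "left_module C P" "left_module C Q" "module_hom C P Q \<mu>" "x \<in> obj C"
  shows "group_hom (val P x) (val Q x) (\<mu> x)"
  using assms(3,4) left_module.val_comm_group[OF assms(1,4)] left_module.val_comm_group[OF assms(2,4)]
  by (simp add: module_hom_def group_hom_def group_hom_axioms_def comm_group_def)

lemma module_hom_mult:
  assumes P: "left_module C P" and Q: "left_module C Q" and \<theta>: "module_hom C P Q \<theta>" and \<eta>: "module_hom C P Q \<eta>"
  shows "module_hom C P Q (\<lambda>x a. \<theta> x a \<otimes>\<^bsub>val Q x\<^esub> \<eta> x a)"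
proof -
  interpret Q: left_module C Q by fact
  have "\<theta> x (act P f a) \<otimes>\<^bsub>val Q x\<^esub> \<eta> x (act P f a) = act Q f (\<theta> y a \<otimes>\<^bsub>val Q y\<^esub> \<eta> y a)"
    if f: "f \<in> Hom C x y" and a: "a \<in> carrier (val P y)" for f x y a
  proof -
    have y: "y \<in> obj C" using Q.Hom_obj[OF f] by simp
    show ?thesis using \<theta> \<eta> f a hom_mult[OF Q.act_hom[OF f] module_hom_closed[OF \<theta> y a] module_hom_closed[OF \<eta> y a]]
      by (simp add: module_hom_def)
  qed
  moreover have "(\<lambda>a. \<theta> x a \<otimes>\<^bsub>val Q x\<^esub> \<eta> x a) \<in> hom (val P x) (val Q x)" if x: "x \<in> obj C" for x
    by (rule comm_group.hom_group_mult[OF Q.val_comm_group[OF x]]) (use \<theta> \<eta> x in \<open>auto simp: module_hom_def\<close>)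
  ultimately show ?thesis by (simp add: module_hom_def)
qed

lemma module_hom_inv:
  assumes P: "left_module C P" and Q: "left_module C Q" and \<theta>: "module_hom C P Q \<theta>"
  shows "module_hom C P Q (\<lambda>x a. inv\<^bsub>val Q x\<^esub> \<theta> x a)"
proof -
  interpret P: left_module C P by fact
  interpret Q: left_module C Q by fact
  have "(\<lambda>a. inv\<^bsub>val Q x\<^esub> \<theta> x a) \<in> hom (val P x) (val Q x)" if x: "x \<in> obj C" for x
  proof -
    interpret t: group_hom "val P x" "val Q x" "\<theta> x" by (rule module_hom_group_hom[OF P Q \<theta> x])
    interpret q: comm_group "val Q x" by (rule Q.val_comm_group[OF x])
    show ?thesis by (rule homI) (auto simp: q.inv_mult)
  qed
  moreover have "inv\<^bsub>val Q x\<^esub> \<theta> x (act P f a) = act Q f (inv\<^bsub>val Q y\<^esub> \<theta> y a)"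
    if f: "f \<in> Hom C x y" and a: "a \<in> carrier (val P y)" for f x y a
  proof -
    have xy: "x \<in> obj C" "y \<in> obj C" using P.Hom_obj[OF f] by auto
    interpret group_hom "val Q y" "val Q x" "act Q f"
      using Q.act_hom[OF f] Q.val_comm_group xy by (simp add: group_hom_def group_hom_axioms_def comm_group_def)
    show ?thesis using \<theta> f a hom_inv[OF module_hom_closed[OF \<theta> xy(2) a]] by (simp add: module_hom_def)
  qed
  ultimately show ?thesis by (simp add: module_hom_def)
qed

text \<open>A lifting property for two given modules, so that no quantification over modules fixes
  an element type. Instead of surjectivity of \<open>h\<close>, the image of \<open>\<theta>\<close>
  has to lie in that of \<open>h\<close>; exactness of a resolution supplies this condition for
  lifts along a differential directly, without passing to kernels or images as modules.\<close>

definition lifts ::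
  "('o, 'm) cat \<Rightarrow> ('o, 'm, 'p) cmod \<Rightarrow> ('o, 'm, 'a) cmod \<Rightarrow> ('o, 'm, 'b) cmod \<Rightarrow> bool"
  where "lifts C P A B \<longleftrightarrow> (\<forall>h \<theta>. module_hom C A B h \<and> module_hom C P B \<theta> \<and>
      (\<forall>x \<in> obj C. \<theta> x ` carrier (val P x) \<subseteq> h x ` carrier (val A x)) \<longrightarrow>
      (\<exists>\<psi>. module_hom C P A \<psi> \<and> (\<forall>x \<in> obj C. \<forall>a \<in> carrier (val P x). h x (\<psi> x a) = \<theta> x a)))"

lemma liftsE:
  assumes "lifts C P A B" "module_hom C A B h" "module_hom C P B \<theta>"
    "\<And>x a. \<lbrakk>x \<in> obj C; a \<in> carrier (val P x)\<rbrakk> \<Longrightarrow> \<theta> x a \<in> h x ` carrier (val A x)"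
  obtains \<psi> where "module_hom C P A \<psi>" "\<And>x a. \<lbrakk>x \<in> obj C; a \<in> carrier (val P x)\<rbrakk> \<Longrightarrow> h x (\<psi> x a) = \<theta> x a"
proof -
  have "\<forall>x \<in> obj C. \<theta> x ` carrier (val P x) \<subseteq> h x ` carrier (val A x)" using assms(4) by blast
  with assms(1-3) have "\<exists>\<psi>. module_hom C P A \<psi> \<and> (\<forall>x \<in> obj C. \<forall>a \<in> carrier (val P x). h x (\<psi> x a) = \<theta> x a)"
    unfolding lifts_def by blast
  then show thesis using that by blast
qed

text \<open>Like \<open>projective_resolution\<close>, but with any element type and no
  projectivity; the latter is replaced by \<open>lifts\<close> at the places where it is used.
  Induction and restriction preserve this notion.\<close>

definition resolution ::
  "('o, 'm) cat \<Rightarrow> ('o, 'm, 'a) cmod \<Rightarrow> (nat \<Rightarrow> ('o, 'm, 'p) cmod)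
    \<Rightarrow> (nat \<Rightarrow> 'o \<Rightarrow> 'p \<Rightarrow> 'p) \<Rightarrow> ('o \<Rightarrow> 'p \<Rightarrow> 'a) \<Rightarrow> bool"
  where "resolution C M P \<delta> \<epsilon> \<longleftrightarrow> left_module C M \<and>
    (\<forall>n. left_module C (P n)) \<and>
    (\<forall>n. module_hom C (P (Suc n)) (P n) (\<delta> n)) \<and>
    module_epi C (P 0) M \<epsilon> \<and>
    (\<forall>x \<in> obj C. \<delta> 0 x ` carrier (val (P (Suc 0)) x) = kernel (val (P 0) x) (val M x) (\<epsilon> x)) \<and>
    (\<forall>n. \<forall>x \<in> obj C. \<delta> (Suc n) x ` carrier (val (P (Suc (Suc n))) x) =
            kernel (val (P (Suc n)) x) (val (P n) x) (\<delta> n x))"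

lemma resolutionD:
  assumes "resolution C M P \<delta> \<epsilon>"
  shows "left_module C M" "left_module C (P n)" "module_hom C (P (Suc n)) (P n) (\<delta> n)" "module_hom C (P 0) M \<epsilon>"
    "\<lbrakk>x \<in> obj C; b \<in> carrier (val M x)\<rbrakk> \<Longrightarrow> \<exists>a \<in> carrier (val (P 0) x). b = \<epsilon> x a"
    "\<lbrakk>x \<in> obj C; a \<in> carrier (val (P 0) x); \<epsilon> x a = \<one>\<^bsub>val M x\<^esub>\<rbrakk> \<Longrightarrow> a \<in> \<delta> 0 x ` carrier (val (P (Suc 0)) x)"
    "\<lbrakk>x \<in> obj C; a \<in> carrier (val (P (Suc n)) x); \<delta> n x a = \<one>\<^bsub>val (P n) x\<^esub>\<rbrakk>
       \<Longrightarrow> a \<in> \<delta> (Suc n) x ` carrier (val (P (Suc (Suc n))) x)"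
    "\<lbrakk>x \<in> obj C; a \<in> carrier (val (P (Suc 0)) x)\<rbrakk> \<Longrightarrow> \<epsilon> x (\<delta> 0 x a) = \<one>\<^bsub>val M x\<^esub>"
    "\<lbrakk>x \<in> obj C; a \<in> carrier (val (P (Suc (Suc n))) x)\<rbrakk> \<Longrightarrow> \<delta> n x (\<delta> (Suc n) x a) = \<one>\<^bsub>val (P n) x\<^esub>"
proof -
  have *: "left_module C M" "\<forall>n. left_module C (P n)" "\<forall>n. module_hom C (P (Suc n)) (P n) (\<delta> n)"
    "module_hom C (P 0) M \<epsilon>" "\<forall>x \<in> obj C. \<epsilon> x ` carrier (val (P 0) x) = carrier (val M x)"
    and e: "\<forall>x \<in> obj C. \<delta> 0 x ` carrier (val (P (Suc 0)) x) = kernel (val (P 0) x) (val M x) (\<epsilon> x)"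
      "\<forall>n. \<forall>x \<in> obj C. \<delta> (Suc n) x ` carrier (val (P (Suc (Suc n))) x) =
            kernel (val (P (Suc n)) x) (val (P n) x) (\<delta> n x)"
    using assms unfolding resolution_def module_epi_def by simp_all
  show "left_module C M" "left_module C (P n)" "module_hom C (P (Suc n)) (P n) (\<delta> n)" "module_hom C (P 0) M \<epsilon>"
    using * by simp_all
  show "\<lbrakk>x \<in> obj C; b \<in> carrier (val M x)\<rbrakk> \<Longrightarrow> \<exists>a \<in> carrier (val (P 0) x). b = \<epsilon> x a"
    using *(5) by (auto simp: image_iff)
  show "\<lbrakk>x \<in> obj C; a \<in> carrier (val (P 0) x); \<epsilon> x a = \<one>\<^bsub>val M x\<^esub>\<rbrakk> \<Longrightarrow> a \<in> \<delta> 0 x ` carrier (val (P (Suc 0)) x)"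
    using e(1) by (simp add: kernel_def)
  show "\<lbrakk>x \<in> obj C; a \<in> carrier (val (P (Suc n)) x); \<delta> n x a = \<one>\<^bsub>val (P n) x\<^esub>\<rbrakk>
       \<Longrightarrow> a \<in> \<delta> (Suc n) x ` carrier (val (P (Suc (Suc n))) x)"
    using e(2) by (simp add: kernel_def)
  show "\<lbrakk>x \<in> obj C; a \<in> carrier (val (P (Suc 0)) x)\<rbrakk> \<Longrightarrow> \<epsilon> x (\<delta> 0 x a) = \<one>\<^bsub>val M x\<^esub>"
    using imageI[of a "carrier (val (P (Suc 0)) x)" "\<delta> 0 x"] bspec[OF e(1), of x] by (simp add: kernel_def)
  show "\<lbrakk>x \<in> obj C; a \<in> carrier (val (P (Suc (Suc n))) x)\<rbrakk> \<Longrightarrow> \<delta> n x (\<delta> (Suc n) x a) = \<one>\<^bsub>val (P n) x\<^esub>"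
    using imageI[of a "carrier (val (P (Suc (Suc n))) x)" "\<delta> (Suc n) x"] bspec[OF spec[OF e(2), of n], of x]
    by (simp add: kernel_def)
qed

text \<open>The inductive half of the comparison theorem: given \<open>f n\<close>, the composite
  \<open>f n \<circ> \<delta> n\<close> lifts along \<open>\<delta>' n\<close> because it lands in
  the image, and exactness of \<open>Q\<close> passes this property on to the next degree.\<close>

lemma chain_lift:
  assumes P: "resolution C M P \<delta> \<epsilon>" and Q: "resolution C M Q \<delta>' \<epsilon>'"
    and l0: "lifts C (P 0) (Q 0) M" and l: "\<And>n. lifts C (P (Suc n)) (Q (Suc n)) (Q n)"
  obtains f where "\<And>n. module_hom C (P n) (Q n) (f n)"
    "\<And>x a. \<lbrakk>x \<in> obj C; a \<in> carrier (val (P 0) x)\<rbrakk> \<Longrightarrow> \<epsilon>' x (f 0 x a) = \<epsilon> x a"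
    "\<And>n x a. \<lbrakk>x \<in> obj C; a \<in> carrier (val (P (Suc n)) x)\<rbrakk> \<Longrightarrow> \<delta>' n x (f (Suc n) x a) = f n x (\<delta> n x a)"
proof -
  note p = resolutionD[OF P] and q = resolutionD[OF Q]
  note dP = module_hom_closed[OF p(3)] and dQ = module_hom_closed[OF q(3)]
  \<comment> \<open>The second clause is what the lift in degree \<open>n + 1\<close> needs. The
    clause for \<open>n = 0\<close> keeps the compatibility with the augmentations, as there is no
    earlier map to relate \<open>f 0\<close> to.\<close>
  let ?ok = "\<lambda>n f. module_hom C (P n) (Q n) f \<and>
    (\<forall>x \<in> obj C. \<forall>a \<in> carrier (val (P (Suc n)) x). f x (\<delta> n x a) \<in> \<delta>' n x ` carrier (val (Q (Suc n)) x)) \<and>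
    (n = 0 \<longrightarrow> (\<forall>x \<in> obj C. \<forall>a \<in> carrier (val (P 0) x). \<epsilon>' x (f x a) = \<epsilon> x a))"
  let ?R = "\<lambda>n f f'. \<forall>x \<in> obj C. \<forall>a \<in> carrier (val (P (Suc n)) x). \<delta>' n x (f' x a) = f x (\<delta> n x a)"
  have "\<exists>f. \<forall>n. ?ok n (f n) \<and> ?R n (f n) (f (Suc n))"
  proof (rule dependent_nat_choice)
    obtain \<psi> where psi: "module_hom C (P 0) (Q 0) \<psi>"
      "\<And>x a. \<lbrakk>x \<in> obj C; a \<in> carrier (val (P 0) x)\<rbrakk> \<Longrightarrow> \<epsilon>' x (\<psi> x a) = \<epsilon> x a"
    proof (rule liftsE[OF l0 q(4) p(4)])
      show "\<epsilon> x a \<in> \<epsilon>' x ` carrier (val (Q 0) x)" if "x \<in> obj C" "a \<in> carrier (val (P 0) x)" for x a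
        using q(5)[OF that(1) module_hom_closed[OF p(4) that]] by blast
    qed blast
    have "\<psi> x (\<delta> 0 x a) \<in> \<delta>' 0 x ` carrier (val (Q (Suc 0)) x)"
      if "x \<in> obj C" "a \<in> carrier (val (P (Suc 0)) x)" for x a
      using q(6) psi that p(8) dP module_hom_closed[OF psi(1)] by simp
    with psi show "\<exists>f. ?ok 0 f" by blast
  next
    fix f n assume f: "?ok n f"
    have "module_hom C (P (Suc n)) (Q n) (\<lambda>x a. f x (\<delta> n x a))"
      using module_hom_compose[OF p(3) conjunct1[OF f] p(2)] .
    then obtain f' where f': "module_hom C (P (Suc n)) (Q (Suc n)) f'"
      "\<And>x a. \<lbrakk>x \<in> obj C; a \<in> carrier (val (P (Suc n)) x)\<rbrakk> \<Longrightarrow> \<delta>' n x (f' x a) = f x (\<delta> n x a)"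
      by (rule liftsE[OF l q(3)]) (use f in blast)+
    have 1: "\<forall>x \<in> obj C. \<forall>a \<in> carrier (val (P (Suc (Suc n))) x).
      f' x (\<delta> (Suc n) x a) \<in> \<delta>' (Suc n) x ` carrier (val (Q (Suc (Suc n))) x)"
    proof (intro ballI)
      fix x a assume x: "x \<in> obj C" and a: "a \<in> carrier (val (P (Suc (Suc n))) x)"
      interpret group_hom "val (P n) x" "val (Q n) x" "f x"
        by (rule module_hom_group_hom[OF p(2) q(2) conjunct1[OF f] x])
      have "\<delta>' n x (f' x (\<delta> (Suc n) x a)) = \<one>\<^bsub>val (Q n) x\<^esub>"
        using f'(2)[OF x dP[OF x a]] p(9)[OF x a] hom_one by simp
      then show "f' x (\<delta> (Suc n) x a) \<in> \<delta>' (Suc n) x ` carrier (val (Q (Suc (Suc n))) x)"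
        by (rule q(7)[OF x module_hom_closed[OF f'(1) x dP[OF x a]]])
    qed
    have 2: "?R n f f'" using f'(2) by blast
    show "\<exists>f'. ?ok (Suc n) f' \<and> ?R n f f'"
      by (intro exI[of _ f'] conjI impI f'(1) 1 2) simp
  qed
  then obtain f where f: "\<forall>n. ?ok n (f n) \<and> ?R n (f n) (f (Suc n))" by (rule exE)
  show thesis by (rule that[of f]) (use f in blast)+
qed

text \<open>The difference of \<open>d (Suc n)\<close> and \<open>s n \<circ> \<delta> n\<close> is
  killed by \<open>\<delta>' n\<close>, hence takes values in the image of the next differential by
  exactness of \<open>Q\<close>, and its lift is \<open>s (Suc n)\<close>. Degree 0 has no
  correction term.\<close>

lemma null_homotopy:
  assumes P: "resolution C M P \<delta> \<epsilon>" and Q: "resolution C M Q \<delta>' \<epsilon>'"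
    and l: "\<And>n. lifts C (P n) (Q (Suc n)) (Q n)"
    and d: "\<And>n. module_hom C (P n) (Q n) (d n)"
    and d0: "\<And>x a. \<lbrakk>x \<in> obj C; a \<in> carrier (val (P 0) x)\<rbrakk> \<Longrightarrow> \<epsilon>' x (d 0 x a) = \<one>\<^bsub>val M x\<^esub>"
    and dS: "\<And>n x a. \<lbrakk>x \<in> obj C; a \<in> carrier (val (P (Suc n)) x)\<rbrakk> \<Longrightarrow> \<delta>' n x (d (Suc n) x a) = d n x (\<delta> n x a)"
  obtains s where "\<And>n. module_hom C (P n) (Q (Suc n)) (s n)"
    "\<And>x a. \<lbrakk>x \<in> obj C; a \<in> carrier (val (P 0) x)\<rbrakk> \<Longrightarrow> d 0 x a = \<delta>' 0 x (s 0 x a)"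
    "\<And>n x a. \<lbrakk>x \<in> obj C; a \<in> carrier (val (P (Suc n)) x)\<rbrakk>
       \<Longrightarrow> d (Suc n) x a = \<delta>' (Suc n) x (s (Suc n) x a) \<otimes>\<^bsub>val (Q (Suc n)) x\<^esub> s n x (\<delta> n x a)"
proof -
  note p = resolutionD[OF P] and q = resolutionD[OF Q]
  note dP = module_hom_closed[OF p(3)] and dQ = module_hom_closed[OF q(3)] and dc = module_hom_closed[OF d]
  \<comment> \<open>The second clause says that \<open>\<delta>' n \<circ> s n\<close> and
    \<open>d n\<close> agree on boundaries, which is all that the next step uses of the relation in
    degree \<open>n\<close>; stating the full relation would involve
    \<open>s (n - 1)\<close>.\<close>
  let ?ok = "\<lambda>n s. module_hom C (P n) (Q (Suc n)) s \<and>
    (\<forall>x \<in> obj C. \<forall>a \<in> carrier (val (P (Suc n)) x). \<delta>' n x (s x (\<delta> n x a)) = d n x (\<delta> n x a)) \<and>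
    (n = 0 \<longrightarrow> (\<forall>x \<in> obj C. \<forall>a \<in> carrier (val (P 0) x). d 0 x a = \<delta>' 0 x (s x a)))"
  let ?R = "\<lambda>n s s'. \<forall>x \<in> obj C. \<forall>a \<in> carrier (val (P (Suc n)) x).
     d (Suc n) x a = \<delta>' (Suc n) x (s' x a) \<otimes>\<^bsub>val (Q (Suc n)) x\<^esub> s x (\<delta> n x a)"
  have "\<exists>s. \<forall>n. ?ok n (s n) \<and> ?R n (s n) (s (Suc n))"
  proof (rule dependent_nat_choice)
    obtain s where s: "module_hom C (P 0) (Q (Suc 0)) s"
      "\<And>x a. \<lbrakk>x \<in> obj C; a \<in> carrier (val (P 0) x)\<rbrakk> \<Longrightarrow> \<delta>' 0 x (s x a) = d 0 x a"
    proof (rule liftsE[OF l q(3) d])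
      show "d 0 x a \<in> \<delta>' 0 x ` carrier (val (Q (Suc 0)) x)" if "x \<in> obj C" "a \<in> carrier (val (P 0) x)" for x a
        by (rule q(6)[OF that(1) dc[OF that] d0[OF that]])
    qed blast
    have "\<forall>x \<in> obj C. \<forall>a \<in> carrier (val (P (Suc 0)) x). \<delta>' 0 x (s x (\<delta> 0 x a)) = d 0 x (\<delta> 0 x a)"
      "\<forall>x \<in> obj C. \<forall>a \<in> carrier (val (P 0) x). d 0 x a = \<delta>' 0 x (s x a)"
      using s(2) dP by simp_all
    with s(1) show "\<exists>s. ?ok 0 s" by blast
  next
    fix s n assume s: "?ok n s"
    let ?\<theta> = "\<lambda>x a. d (Suc n) x a \<otimes>\<^bsub>val (Q (Suc n)) x\<^esub> inv\<^bsub>val (Q (Suc n)) x\<^esub> s x (\<delta> n x a)"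
    have sd: "module_hom C (P (Suc n)) (Q (Suc n)) (\<lambda>x a. s x (\<delta> n x a))"
      using module_hom_compose[OF p(3) conjunct1[OF s] p(2)] .
    have \<theta>: "module_hom C (P (Suc n)) (Q (Suc n)) ?\<theta>"
      by (rule module_hom_mult[OF p(2) q(2) d module_hom_inv[OF p(2) q(2) sd]])
    obtain s' where s': "module_hom C (P (Suc n)) (Q (Suc (Suc n))) s'"
      "\<And>x a. \<lbrakk>x \<in> obj C; a \<in> carrier (val (P (Suc n)) x)\<rbrakk> \<Longrightarrow> \<delta>' (Suc n) x (s' x a) = ?\<theta> x a"
    proof (rule liftsE[OF l q(3) \<theta>])
      fix x a assume x: "x \<in> obj C" and a: "a \<in> carrier (val (P (Suc n)) x)"
      interpret group_hom "val (Q (Suc n)) x" "val (Q n) x" "\<delta>' n x"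
        by (rule module_hom_group_hom[OF q(2) q(2) q(3) x])
      have "\<delta>' n x (?\<theta> x a) = \<one>\<^bsub>val (Q n) x\<^esub>"
        using s x a dc[OF x a] module_hom_closed[OF sd x a] dS[OF x a] dc[OF x dP[OF x a]] by simp
      then show "?\<theta> x a \<in> \<delta>' (Suc n) x ` carrier (val (Q (Suc (Suc n))) x)"
        using q(7)[OF x module_hom_closed[OF \<theta> x a]] by blast
    qed blast
    \<comment> \<open>On boundaries the correction vanishes since
      \<open>\<delta> n \<circ> \<delta> (Suc n)\<close> is trivial, which restores the invariant
      for \<open>s'\<close>.\<close>
    have "?\<theta> x (\<delta> (Suc n) x a) = d (Suc n) x (\<delta> (Suc n) x a)"
      if x: "x \<in> obj C" and a: "a \<in> carrier (val (P (Suc (Suc n))) x)" for x a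
    proof -
      interpret group_hom "val (P n) x" "val (Q (Suc n)) x" "s x"
        by (rule module_hom_group_hom[OF p(2) q(2) conjunct1[OF s] x])
      show ?thesis using p(9)[OF x a] hom_one dc[OF x dP[OF x a]] by simp
    qed
    then have 1: "\<forall>x \<in> obj C. \<forall>a \<in> carrier (val (P (Suc (Suc n))) x).
        \<delta>' (Suc n) x (s' x (\<delta> (Suc n) x a)) = d (Suc n) x (\<delta> (Suc n) x a)"
      using s'(2) dP by simp
    have 2: "?R n s s'"
    proof safe
      fix x a assume x: "x \<in> obj C" and a: "a \<in> carrier (val (P (Suc n)) x)"
      interpret group "val (Q (Suc n)) x"
        using left_module.val_comm_group[OF q(2) x] by (simp add: comm_group_def)
      show "d (Suc n) x a = \<delta>' (Suc n) x (s' x a) \<otimes>\<^bsub>val (Q (Suc n)) x\<^esub> s x (\<delta> n x a)"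
        unfolding s'(2)[OF x a] using dc[OF x a] module_hom_closed[OF sd x a] by (simp add: m_assoc)
    qed
    show "\<exists>s'. ?ok (Suc n) s' \<and> ?R n s s'"
      by (intro exI[of _ s'] conjI impI s'(1) 1 2) simp
  qed
  then obtain s where s: "\<forall>n. ?ok n (s n) \<and> ?R n (s n) (s (Suc n))" by (rule exE)
  show thesis by (rule that[of s]) (use s in blast)+
qed

section \<open>Tensoring resolutions: additivity, chain maps, homotopies\<close>

lemma right_module_hom_id: "right_module_hom C R R (\<lambda>_ r. r)"
  by (auto simp: right_module_hom_def hom_def)

context
  fixes C :: "('o, 'm) cat" and R :: "('o, 'm, 'r) cmod"
  assumes R: "right_module C R"
begin

text \<open>Additivity of the functor \<open>R \<otimes> _\<close>; through it a homotopy between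
  module homomorphisms survives tensoring.\<close>

lemma tensor_map_mult:
  assumes P: "left_module C P" and Q: "left_module C Q" and \<mu>: "module_hom C P Q \<mu>" and \<nu>: "module_hom C P Q \<nu>"
    and X: "X \<in> carrier (tensor C R P)"
  shows "tensor_map C R Q (\<lambda>_ r. r) (\<lambda>x a. \<mu> x a \<otimes>\<^bsub>val Q x\<^esub> \<nu> x a) X =
    tensor_map C R Q (\<lambda>_ r. r) \<mu> X \<otimes>\<^bsub>tensor C R Q\<^esub> tensor_map C R Q (\<lambda>_ r. r) \<nu> X"
proof -
  note h = tensor_map_hom[OF R P R Q right_module_hom_id] and t = tensor_map_tens[OF R P R Q right_module_hom_id]
  note m = module_hom_mult[OF P Q \<mu> \<nu>]
  show ?thesis
  proof (rule tensor_hom_eqI[OF R P h[OF m] comm_group.hom_group_mult[OF comm_group_tensor[OF R Q] h[OF \<mu>] h[OF \<nu>]]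
        group_tensor[OF R Q] _ X])
    fix z a b assume *: "z \<in> obj C" "a \<in> carrier (val R z)" "b \<in> carrier (val P z)"
    show "tensor_map C R Q (\<lambda>_ r. r) (\<lambda>x a. \<mu> x a \<otimes>\<^bsub>val Q x\<^esub> \<nu> x a) (tens C R P z a b) =
      tensor_map C R Q (\<lambda>_ r. r) \<mu> (tens C R P z a b) \<otimes>\<^bsub>tensor C R Q\<^esub> tensor_map C R Q (\<lambda>_ r. r) \<nu> (tens C R P z a b)"
      unfolding t[OF m *] t[OF \<mu> *] t[OF \<nu> *]
      by (rule tens_mult_right[OF R Q *(1,2) module_hom_closed[OF \<mu> *(1,3)] module_hom_closed[OF \<nu> *(1,3)]])
  qed
qed

lemma tensor_map_comp:
  assumes "left_module C L" "left_module C P" "left_module C Q" "module_hom C L P \<mu>" "module_hom C P Q \<nu>"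
    and "module_hom C L Q \<kappa>" "X \<in> carrier (tensor C R L)"
    and "\<And>z a. \<lbrakk>z \<in> obj C; a \<in> carrier (val L z)\<rbrakk> \<Longrightarrow> \<kappa> z a = \<nu> z (\<mu> z a)"
  shows "tensor_map C R Q (\<lambda>_ r. r) \<kappa> X =
    tensor_map C R Q (\<lambda>_ r. r) \<nu> (tensor_map C R P (\<lambda>_ r. r) \<mu> X)"
  by (rule tensor_map_compose[symmetric, OF R assms(1) R assms(2) R assms(3) right_module_hom_id assms(4)
      right_module_hom_id assms(5) right_module_hom_id assms(6,7)]) (use assms(8) in auto)

text \<open>Module homomorphisms are compared on carriers only, whereas \<open>tensor_map\<close>
  takes total functions.\<close>

lemma tensor_map_cong:
  assumes P: "left_module C P" and Q: "left_module C Q" and \<mu>: "module_hom C P Q \<mu>" and \<nu>: "module_hom C P Q \<nu>"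
    and X: "X \<in> carrier (tensor C R P)"
    and eq: "\<And>z a. \<lbrakk>z \<in> obj C; a \<in> carrier (val P z)\<rbrakk> \<Longrightarrow> \<mu> z a = \<nu> z a"
  shows "tensor_map C R Q (\<lambda>_ r. r) \<mu> X = tensor_map C R Q (\<lambda>_ r. r) \<nu> X"
  using tensor_hom_eqI[OF R P tensor_map_hom[OF R P R Q right_module_hom_id \<mu>]
      tensor_map_hom[OF R P R Q right_module_hom_id \<nu>] group_tensor[OF R Q] _ X]
    tensor_map_tens[OF R P R Q right_module_hom_id \<mu>] tensor_map_tens[OF R P R Q right_module_hom_id \<nu>] eq
  by simp

lemma tensor_map_trivial:
  assumes P: "left_module C P" and Q: "left_module C Q" and \<mu>: "module_hom C P Q \<mu>"
    and X: "X \<in> carrier (tensor C R P)"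
    and 1: "\<And>z a. \<lbrakk>z \<in> obj C; a \<in> carrier (val P z)\<rbrakk> \<Longrightarrow> \<mu> z a = \<one>\<^bsub>val Q z\<^esub>"
  shows "tensor_map C R Q (\<lambda>_ r. r) \<mu> X = \<one>\<^bsub>tensor C R Q\<^esub>"
proof (rule tensor_hom_eqI[OF R P tensor_map_hom[OF R P R Q right_module_hom_id \<mu>] _ group_tensor[OF R Q] _ X])
  show "(\<lambda>_. \<one>\<^bsub>tensor C R Q\<^esub>) \<in> hom (tensor C R P) (tensor C R Q)"
    using group_tensor[OF R Q] by (auto simp: hom_def group.is_monoid monoid.one_closed monoid.l_one)
  fix z a b assume *: "z \<in> obj C" "a \<in> carrier (val R z)" "b \<in> carrier (val P z)"
  show "tensor_map C R Q (\<lambda>_ r. r) \<mu> (tens C R P z a b) = \<one>\<^bsub>tensor C R Q\<^esub>"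
    unfolding tensor_map_tens[OF R P R Q right_module_hom_id \<mu> *] 1[OF *(1,3)] by (rule tens_one_right[OF R Q *(1,2)])
qed

abbreviation "tensor_cx P k \<equiv> tensor C R (P k)"
abbreviation "tensor_bd P \<delta> k \<equiv> tensor_map C R (P k) (\<lambda>_ r. r) (\<delta> k)"

lemma chain_complex_tensor:
  assumes P: "resolution C M P \<delta> \<epsilon>"
  shows "chain_complex (tensor_cx P) (tensor_bd P \<delta>)"
proof -
  note p = resolutionD[OF P]
  have "tensor_bd P \<delta> n (tensor_bd P \<delta> (Suc n) X) = \<one>\<^bsub>tensor C R (P n)\<^esub>"
    if X: "X \<in> carrier (tensor C R (P (Suc (Suc n))))" for n X
  proof -
    have c: "module_hom C (P (Suc (Suc n))) (P n) (\<lambda>x a. \<delta> n x (\<delta> (Suc n) x a))"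
      by (rule module_hom_compose[OF p(3) p(3) p(2)])
    show ?thesis
      using tensor_map_comp[OF p(2,2,2) p(3,3) c X] tensor_map_trivial[OF p(2,2) c X] p(9) by simp
  qed
  then show ?thesis unfolding chain_complex_def
    using comm_group_tensor[OF R p(2)] tensor_map_hom[OF R p(2) R p(2) right_module_hom_id p(3)] by blast
qed

lemma chain_map_tensor:
  assumes P: "\<And>n. left_module C (P n)" and Q: "\<And>n. left_module C (Q n)"
    and \<delta>: "\<And>n. module_hom C (P (Suc n)) (P n) (\<delta> n)" and \<delta>': "\<And>n. module_hom C (Q (Suc n)) (Q n) (\<delta>' n)"
    and f: "\<And>n. module_hom C (P n) (Q n) (f n)"
    and c: "\<And>n x a. \<lbrakk>x \<in> obj C; a \<in> carrier (val (P (Suc n)) x)\<rbrakk> \<Longrightarrow> \<delta>' n x (f (Suc n) x a) = f n x (\<delta> n x a)"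
  shows "chain_map (tensor_cx P) (tensor_bd P \<delta>) (tensor_cx Q) (tensor_bd Q \<delta>') (\<lambda>n. tensor_map C R (Q n) (\<lambda>_ r. r) (f n))"
  unfolding chain_map_def
proof (intro conjI allI ballI)
  show "tensor_map C R (Q n) (\<lambda>_ r. r) (f n) \<in> hom (tensor C R (P n)) (tensor C R (Q n))" for n
    by (rule tensor_map_hom[OF R P R Q right_module_hom_id f])
  fix n X assume X: "X \<in> carrier (tensor C R (P (Suc n)))"
  note fd = module_hom_compose[OF \<delta> f P]
  show "tensor_map C R (Q n) (\<lambda>_ r. r) (f n) (tensor_bd P \<delta> n X) =
     tensor_bd Q \<delta>' n (tensor_map C R (Q (Suc n)) (\<lambda>_ r. r) (f (Suc n)) X)"
    using tensor_map_comp[OF P P Q \<delta> f fd X] tensor_map_comp[OF P Q Q f \<delta>' fd X] c by simp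
qed

text \<open>\<open>k\<close> and the identity lift the same map of \<open>M\<close>, so their
  difference has a null homotopy \<open>s\<close>. After tensoring, the term
  \<open>s \<circ> \<delta>\<close> vanishes on cycles, and what remains of the difference is the
  boundary of the image of \<open>X\<close> under \<open>s\<close>.\<close>

lemma self_map_homotopy:
  assumes P: "resolution C M P \<delta> \<epsilon>" and l: "\<And>n. lifts C (P n) (P (Suc n)) (P n)"
    and k: "\<And>n. module_hom C (P n) (P n) (k n)"
    and k0: "\<And>x a. \<lbrakk>x \<in> obj C; a \<in> carrier (val (P 0) x)\<rbrakk> \<Longrightarrow> \<epsilon> x (k 0 x a) = \<epsilon> x a"
    and kS: "\<And>n x a. \<lbrakk>x \<in> obj C; a \<in> carrier (val (P (Suc n)) x)\<rbrakk> \<Longrightarrow> \<delta> n x (k (Suc n) x a) = k n x (\<delta> n x a)"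
    and X: "X \<in> cycles (tensor_cx P) (tensor_bd P \<delta>) n"
  shows "\<exists>c \<in> carrier (tensor C R (P (Suc n))).
    tensor_map C R (P n) (\<lambda>_ r. r) (k n) X = X \<otimes>\<^bsub>tensor C R (P n)\<^esub> tensor_bd P \<delta> n c"
proof -
  note p = resolutionD[OF P]
  note dP = module_hom_closed[OF p(3)] and kc = module_hom_closed[OF k]
  have id: "module_hom C (P n) (P n) (\<lambda>_ a. a)" for n by (auto simp: module_hom_def hom_def)
  define d where "d n = (\<lambda>x a. k n x a \<otimes>\<^bsub>val (P n) x\<^esub> inv\<^bsub>val (P n) x\<^esub> a)" for n
  have d: "module_hom C (P n) (P n) (d n)" for n
    unfolding d_def by (rule module_hom_mult[OF p(2,2) k module_hom_inv[OF p(2,2) id]])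
  have d0: "\<epsilon> x (d 0 x a) = \<one>\<^bsub>val M x\<^esub>" if x: "x \<in> obj C" and a: "a \<in> carrier (val (P 0) x)" for x a
  proof -
    interpret group_hom "val (P 0) x" "val M x" "\<epsilon> x" by (rule module_hom_group_hom[OF p(2,1,4) x])
    show ?thesis using kc[OF x a] a k0[OF x a] by (simp add: d_def)
  qed
  have dS: "\<delta> n x (d (Suc n) x a) = d n x (\<delta> n x a)" if x: "x \<in> obj C" and a: "a \<in> carrier (val (P (Suc n)) x)" for n x a
  proof -
    interpret group_hom "val (P (Suc n)) x" "val (P n) x" "\<delta> n x" by (rule module_hom_group_hom[OF p(2,2,3) x])
    show ?thesis using kc[OF x a] a kS[OF x a] by (simp add: d_def)
  qed
  obtain s where s: "\<And>n. module_hom C (P n) (P (Suc n)) (s n)"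
    "\<And>x a. \<lbrakk>x \<in> obj C; a \<in> carrier (val (P 0) x)\<rbrakk> \<Longrightarrow> d 0 x a = \<delta> 0 x (s 0 x a)"
    "\<And>n x a. \<lbrakk>x \<in> obj C; a \<in> carrier (val (P (Suc n)) x)\<rbrakk>
       \<Longrightarrow> d (Suc n) x a = \<delta> (Suc n) x (s (Suc n) x a) \<otimes>\<^bsub>val (P (Suc n)) x\<^esub> s n x (\<delta> n x a)"
    by (rule null_homotopy[OF P P l d]) (erule (1) d0, erule (1) dS, rule that)
  let ?T = "\<lambda>n. tensor_map C R (P n) (\<lambda>_ r. r)"
  have Xc: "X \<in> carrier (tensor C R (P n))"
    using X by (cases n) (auto simp: kernel_def)
  have "?T n (k n) X = ?T n (\<lambda>x a. (\<lambda>_ a. a) x a \<otimes>\<^bsub>val (P n) x\<^esub> d n x a) X"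
  proof (rule tensor_map_cong[OF p(2,2) k module_hom_mult[OF p(2,2) id d] Xc])
    fix z a assume z: "z \<in> obj C" and a: "a \<in> carrier (val (P n) z)"
    interpret comm_group "val (P n) z" using left_module.val_comm_group[OF p(2) z] .
    show "k n z a = (\<lambda>_ a. a) z a \<otimes>\<^bsub>val (P n) z\<^esub> d n z a"
      unfolding d_def using kc[OF z a] a by (simp add: m_comm[of a] m_assoc)
  qed
  also have "\<dots> = X \<otimes>\<^bsub>tensor C R (P n)\<^esub> ?T n (d n) X"
    using tensor_map_mult[OF p(2,2) id d Xc] tensor_map_id[OF R p(2) Xc refl refl] by simp
  finally have *: "?T n (k n) X = X \<otimes>\<^bsub>tensor C R (P n)\<^esub> ?T n (d n) X" .
  have sX: "?T (Suc n) (s n) X \<in> carrier (tensor C R (P (Suc n)))"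
    using hom_in_carrier[OF tensor_map_hom[OF R p(2) R p(2) right_module_hom_id s(1)] Xc] .
  \<comment> \<open>In degree 0 every element is a cycle and the homotopy has one term; in degree
    \<open>m + 1\<close> the second term passes through \<open>tensor_bd P \<delta> m X\<close>,
    which is trivial for a cycle.\<close>
  have "?T n (d n) X = tensor_bd P \<delta> n (?T (Suc n) (s n) X)"
  proof (cases n)
    case 0
    show ?thesis using tensor_map_comp[OF p(2,2,2) s(1) p(3) d, of X 0] Xc s(2) unfolding 0 by blast
  next
    case (Suc m)
    interpret sT: group_hom "tensor C R (P m)" "tensor C R (P n)" "?T n (s m)"
      using group_tensor[OF R p(2)] tensor_map_hom[OF R p(2) R p(2) right_module_hom_id s(1)]
      by (simp add: group_hom_def group_hom_axioms_def Suc)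
    interpret Tn: group "tensor C R (P n)" by (rule group_tensor[OF R p(2)])
    have X1: "tensor_bd P \<delta> m X = \<one>\<^bsub>tensor C R (P m)\<^esub>" using X Suc by (simp add: kernel_def)
    have a: "module_hom C (P n) (P n) (\<lambda>x a. \<delta> n x (s n x a))"
      by (rule module_hom_compose[OF s(1) p(3) p(2)])
    have b: "module_hom C (P n) (P n) (\<lambda>x a. s m x (\<delta> m x a))"
      unfolding Suc by (rule module_hom_compose[OF p(3) s(1) p(2)])
    have ab: "module_hom C (P n) (P n) (\<lambda>x z. \<delta> n x (s n x z) \<otimes>\<^bsub>val (P n) x\<^esub> s m x (\<delta> m x z))"
      by (rule module_hom_mult[OF p(2,2) a b])
    have "?T n (d n) X = ?T n (\<lambda>x z. \<delta> n x (s n x z) \<otimes>\<^bsub>val (P n) x\<^esub> s m x (\<delta> m x z)) X"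
      by (rule tensor_map_cong[OF p(2,2) d ab Xc]) (use s(3) Suc in simp)
    also have "\<dots> = ?T n (\<lambda>x a. \<delta> n x (s n x a)) X \<otimes>\<^bsub>tensor C R (P n)\<^esub> ?T n (\<lambda>x a. s m x (\<delta> m x a)) X"
      by (rule tensor_map_mult[OF p(2,2) a b Xc])
    also have "?T n (\<lambda>x a. s m x (\<delta> m x a)) X = ?T n (s m) (tensor_bd P \<delta> m X)"
      using tensor_map_comp[OF p(2,2,2) p(3) s(1) b[unfolded Suc] Xc[unfolded Suc]] Suc by simp
    also have "\<dots> = \<one>\<^bsub>tensor C R (P n)\<^esub>" unfolding X1 using sT.hom_one by simp
    also have "?T n (\<lambda>x a. \<delta> n x (s n x a)) X = tensor_bd P \<delta> n (?T (Suc n) (s n) X)"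
      using tensor_map_comp[OF p(2,2,2) s(1) p(3) a Xc] by simp
    finally show ?thesis
      using hom_in_carrier[OF tensor_map_hom[OF R p(2) R p(2) right_module_hom_id p(3)] sX] by simp
  qed
  with * sX show ?thesis by auto
qed

text \<open>The pairs \<open>PQ\<close> and \<open>QP\<close> produce the comparison maps,
  \<open>PP\<close> and \<open>QQ\<close> the homotopies from their composites to the identities.
  Each hypothesis names its own modules because \<open>P\<close> and \<open>Q\<close> may have
  different element types.\<close>

theorem tensor_homology_comparison:
  assumes P: "resolution C M P \<delta> \<epsilon>" and Q: "resolution C M Q \<delta>' \<epsilon>'"
    and PQ: "lifts C (P 0) (Q 0) M" "\<And>n. lifts C (P (Suc n)) (Q (Suc n)) (Q n)"
    and QP: "lifts C (Q 0) (P 0) M" "\<And>n. lifts C (Q (Suc n)) (P (Suc n)) (P n)"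
    and PP: "\<And>n. lifts C (P n) (P (Suc n)) (P n)" and QQ: "\<And>n. lifts C (Q n) (Q (Suc n)) (Q n)"
  shows "homology_group (tensor_cx P) (tensor_bd P \<delta>) n \<cong> homology_group (tensor_cx Q) (tensor_bd Q \<delta>') n"
proof -
  note p = resolutionD[OF P] and q = resolutionD[OF Q]
  obtain f where f: "\<And>n. module_hom C (P n) (Q n) (f n)"
    "\<And>x a. \<lbrakk>x \<in> obj C; a \<in> carrier (val (P 0) x)\<rbrakk> \<Longrightarrow> \<epsilon>' x (f 0 x a) = \<epsilon> x a"
    "\<And>n x a. \<lbrakk>x \<in> obj C; a \<in> carrier (val (P (Suc n)) x)\<rbrakk> \<Longrightarrow> \<delta>' n x (f (Suc n) x a) = f n x (\<delta> n x a)"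
    by (rule chain_lift[OF P Q PQ]) (rule that)
  obtain g where g: "\<And>n. module_hom C (Q n) (P n) (g n)"
    "\<And>x a. \<lbrakk>x \<in> obj C; a \<in> carrier (val (Q 0) x)\<rbrakk> \<Longrightarrow> \<epsilon> x (g 0 x a) = \<epsilon>' x a"
    "\<And>n x a. \<lbrakk>x \<in> obj C; a \<in> carrier (val (Q (Suc n)) x)\<rbrakk> \<Longrightarrow> \<delta> n x (g (Suc n) x a) = g n x (\<delta>' n x a)"
    by (rule chain_lift[OF Q P QP]) (rule that)
  note fc = module_hom_closed[OF f(1)] and gc = module_hom_closed[OF g(1)]
  note gf = module_hom_compose[OF f(1) g(1) p(2)] and fg = module_hom_compose[OF g(1) f(1) q(2)]
  have carr: "X \<in> carrier (A n)" if "X \<in> cycles A d n" for A :: "nat \<Rightarrow> 'x monoid" and d n X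
    using that by (cases n) (auto simp: kernel_def)
  have F: "chain_map (tensor_cx P) (tensor_bd P \<delta>) (tensor_cx Q) (tensor_bd Q \<delta>') (\<lambda>n. tensor_map C R (Q n) (\<lambda>_ r. r) (f n))"
    by (rule chain_map_tensor) (fact p(2) q(2) p(3) q(3) f)+
  have G: "chain_map (tensor_cx Q) (tensor_bd Q \<delta>') (tensor_cx P) (tensor_bd P \<delta>) (\<lambda>n. tensor_map C R (P n) (\<lambda>_ r. r) (g n))"
    by (rule chain_map_tensor) (fact p(2) q(2) p(3) q(3) g)+
  show ?thesis
  proof (rule homology_iso[OF chain_complex_tensor[OF P] chain_complex_tensor[OF Q] F G])
    fix n X assume X: "X \<in> cycles (tensor_cx P) (tensor_bd P \<delta>) n"
    have "\<exists>c \<in> carrier (tensor C R (P (Suc n))).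
      tensor_map C R (P n) (\<lambda>_ r. r) (\<lambda>x a. g n x (f n x a)) X = X \<otimes>\<^bsub>tensor C R (P n)\<^esub> tensor_bd P \<delta> n c"
      by (rule self_map_homotopy[OF P PP gf _ _ X]) (simp_all add: f g fc module_hom_closed[OF p(3)])
    then show "\<exists>c \<in> carrier (tensor C R (P (Suc n))). tensor_map C R (P n) (\<lambda>_ r. r) (g n)
        (tensor_map C R (Q n) (\<lambda>_ r. r) (f n) X) = X \<otimes>\<^bsub>tensor C R (P n)\<^esub> tensor_bd P \<delta> n c"
      using tensor_map_comp[OF p(2) q(2) p(2) f(1) g(1) gf carr[OF X]] by simp
  next
    fix n X assume X: "X \<in> cycles (tensor_cx Q) (tensor_bd Q \<delta>') n"
    have "\<exists>c \<in> carrier (tensor C R (Q (Suc n))).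
      tensor_map C R (Q n) (\<lambda>_ r. r) (\<lambda>x a. f n x (g n x a)) X = X \<otimes>\<^bsub>tensor C R (Q n)\<^esub> tensor_bd Q \<delta>' n c"
      by (rule self_map_homotopy[OF Q QQ fg _ _ X]) (simp_all add: f g gc module_hom_closed[OF q(3)])
    then show "\<exists>c \<in> carrier (tensor C R (Q (Suc n))). tensor_map C R (Q n) (\<lambda>_ r. r) (f n)
        (tensor_map C R (P n) (\<lambda>_ r. r) (g n) X) = X \<otimes>\<^bsub>tensor C R (Q n)\<^esub> tensor_bd Q \<delta>' n c"
      using tensor_map_comp[OF q(2) p(2) q(2) g(1) f(1) fg carr[OF X]] by simp
  qed
qed

end

section \<open>Fractions\<close>

context category
begin

definition env_inv :: "'m \<Rightarrow> ('o, 'm) fraction"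
  where "env_inv f = word_class C (tgt C f) [(f, False)] (src C f)"

lemma env_inv_Hom: "f \<in> Hom C x y \<Longrightarrow> env_inv f \<in> Hom (env_groupoid C) y x"
  and env_inv_right: "f \<in> Hom C x y \<Longrightarrow> cmp (env_groupoid C) (env_map C f) (env_inv f) = idn (env_groupoid C) x"
  and env_inv_left: "f \<in> Hom C x y \<Longrightarrow> cmp (env_groupoid C) (env_inv f) (env_map C f) = idn (env_groupoid C) y"
proof -
  assume f: "f \<in> Hom C x y"
  have i: "env_inv f = word_class C y [(f, False)] x" using f by (simp add: env_inv_def Hom_def)
  show "env_inv f \<in> Hom (env_groupoid C) y x"
    using zigzag_neg[OF f] by (auto simp: i env_Hom)
  show "cmp (env_groupoid C) (env_map C f) (env_inv f) = idn (env_groupoid C) x"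
    using word_class_eq[OF we_inv_right[OF _ f]] Hom_obj[OF f]
    by (simp add: i env_map_Hom[OF f] env_cmp[OF zigzag_pos[OF f] zigzag_neg[OF f]] env_idn)
  show "cmp (env_groupoid C) (env_inv f) (env_map C f) = idn (env_groupoid C) y"
    using word_class_eq[OF we_inv_left[OF _ f]] Hom_obj[OF f]
    by (simp add: i env_map_Hom[OF f] env_cmp[OF zigzag_neg[OF f] zigzag_pos[OF f]] env_idn)
qed

text \<open>\<open>track w k d\<close> holds if \<open>d\<close> is the product of \<open>k\<close> with the word \<open>w\<close>, computed inside the category
  letter by letter; cancellativity makes this a partial function of \<open>k\<close>.\<close>

fun track :: "'m word \<Rightarrow> 'm \<Rightarrow> 'm \<Rightarrow> bool" where
  "track [] k d \<longleftrightarrow> k = d"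
| "track ((f, True) # w) k d \<longleftrightarrow> track w (cmp C k f) d"
| "track ((f, False) # w) k d \<longleftrightarrow> (\<exists>k' \<in> Hom C (src C k) (src C f). cmp C k' f = k \<and> track w k' d)"

lemma track_append: "track (u @ w) k d \<longleftrightarrow> (\<exists>m. track u k m \<and> track w m d)"
  by (induction u k d rule: track.induct) auto

lemma track_Hom: "\<lbrakk>zigzag C x w y; k \<in> Hom C v x; track w k d\<rbrakk> \<Longrightarrow> d \<in> Hom C v y"
proof (induction arbitrary: k rule: zigzag.induct)
  case (zz_pos f x y w z)
  then show ?case using zz_pos(3)[OF cmp_Hom[OF zz_pos(4,1)]] by simp
next
  case (zz_neg f y x w z)
  then show ?case by (auto simp: Hom_def)
qed auto

text \<open>The accumulator represents the part of the product already computed: a letter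
  \<open>f\<close> multiplies it, an inverse letter writes it as \<open>k' f\<close> and continues
  with \<open>k'\<close>, and in the groupoid \<open>k' f\<close> followed by the inverse of
  \<open>f\<close> is \<open>k'\<close>.\<close>

lemma track_env:
  "\<lbrakk>zigzag C x w y; k \<in> Hom C v x; track w k d\<rbrakk>
    \<Longrightarrow> cmp (env_groupoid C) (env_map C k) (word_class C x w y) = env_map C d"
proof (induction arbitrary: k rule: zigzag.induct)
  case (zz_Nil x)
  interpret E: category "env_groupoid C" by (rule category_env)
  interpret I: cat_functor C "env_groupoid C" "\<lambda>x. x" "env_map C" by (rule env_map_functor)
  show ?case using zz_Nil E.idn_right[OF I.map_Hom[OF zz_Nil(2)]] by (simp add: env_idn[symmetric])
next
  case (zz_pos f x y w z)
  interpret E: category "env_groupoid C" by (rule category_env)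
  interpret I: cat_functor C "env_groupoid C" "\<lambda>x. x" "env_map C" by (rule env_map_functor)
  have W: "word_class C y w z \<in> Hom (env_groupoid C) y z" using zz_pos(2) by (auto simp: env_Hom)
  have "word_class C x ((f, True) # w) z = cmp (env_groupoid C) (env_map C f) (word_class C y w z)"
    using env_cmp[OF zigzag_pos[OF zz_pos(1)] zz_pos(2)] env_map_Hom[OF zz_pos(1)] by simp
  then show ?case
    using zz_pos(3)[OF cmp_Hom[OF zz_pos(4,1)]] zz_pos(5)
      E.cmp_assoc[OF I.map_Hom[OF zz_pos(4)] I.map_Hom[OF zz_pos(1)] W] I.map_cmp[OF zz_pos(4,1)] by simp
next
  case (zz_neg f y x w z)
  interpret E: category "env_groupoid C" by (rule category_env)
  interpret I: cat_functor C "env_groupoid C" "\<lambda>x. x" "env_map C" by (rule env_map_functor)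
  let ?W = "word_class C y w z"
  have W: "?W \<in> Hom (env_groupoid C) y z" using zz_neg(2) by (auto simp: env_Hom)
  have w: "word_class C x ((f, False) # w) z = cmp (env_groupoid C) (env_inv f) ?W"
    using env_cmp[OF zigzag_neg[OF zz_neg(1)] zz_neg(2)] zz_neg(1) by (simp add: env_inv_def Hom_def)
  obtain k' where k': "k' \<in> Hom C v y" "cmp C k' f = k" "track w k' d"
    using zz_neg(1,4,5) by (auto simp: Hom_def)
  note k'E = I.map_Hom[OF k'(1)] and fE = I.map_Hom[OF zz_neg(1)] and i = env_inv_Hom[OF zz_neg(1)]
  have "cmp (env_groupoid C) (env_map C k) (env_inv f) =
      cmp (env_groupoid C) (env_map C k') (cmp (env_groupoid C) (env_map C f) (env_inv f))"
    using I.map_cmp[OF k'(1) zz_neg(1)] E.cmp_assoc[OF k'E fE i] k'(2) by simp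
  also have "\<dots> = env_map C k'" using env_inv_right[OF zz_neg(1)] E.idn_right[OF k'E] by simp
  finally have "cmp (env_groupoid C) (env_map C k) (cmp (env_groupoid C) (env_inv f) ?W) =
      cmp (env_groupoid C) (env_map C k') ?W"
    using E.cmp_assoc[OF I.map_Hom[OF zz_neg(4)] i W] by simp
  also have "\<dots> = env_map C d" by (rule zz_neg(3)[OF k'(1,3)])
  finally show ?case using w by simp
qed

end

section \<open>Embedding of a left-Ore category into its groupoid, and left fractions\<close>

context left_ore
begin

interpretation E: category "env_groupoid C" by (rule category_env)
interpretation I: cat_functor C "env_groupoid C" "\<lambda>x. x" "env_map C" by (rule env_map_functor)

lemma track_unique: "\<lbrakk>zigzag C x w y; k \<in> Hom C v x; track w k d; track w k d'\<rbrakk> \<Longrightarrow> d = d'"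
proof (induction arbitrary: k rule: zigzag.induct)
  case (zz_pos f x y w z)
  then show ?case using zz_pos(3)[OF cmp_Hom[OF zz_pos(4,1)]] by simp
next
  case (zz_neg f y x w z)
  have s: "src C k = v" "src C f = y" using zz_neg(1,4) by (auto simp: Hom_def)
  obtain k1 k2 where k: "k1 \<in> Hom C v y" "cmp C k1 f = k" "track w k1 d" "k2 \<in> Hom C v y" "cmp C k2 f = k" "track w k2 d'"
    using zz_neg(5,6) unfolding track.simps s by blast
  have "k1 = k2" by (rule right_cancel[OF k(1,4) zz_neg(1)]) (simp add: k(2,5))
  then show ?case using zz_neg(3)[OF k(1,3)] k(6) by simp
qed auto

text \<open>Each step of a computation survives left multiplication of the accumulator. This moves a
  computation from \<open>k\<close> to a left multiple of \<open>k\<close>, where further words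
  become traceable.\<close>

lemma track_cmp:
  "\<lbrakk>zigzag C x w y; u \<in> Hom C v' v; k \<in> Hom C v x; track w k d\<rbrakk> \<Longrightarrow> track w (cmp C u k) (cmp C u d)"
proof (induction arbitrary: k rule: zigzag.induct)
  case (zz_pos f x y w z)
  then show ?case using cmp_Hom[OF zz_pos(5,1)] cmp_assoc[OF zz_pos(4,5,1)] by simp
next
  case (zz_neg f y x w z)
  have s: "src C k = v" "src C f = y" using zz_neg(1,5) by (auto simp: Hom_def)
  obtain k' where k': "k' \<in> Hom C v y" "cmp C k' f = k" "track w k' d"
    using zz_neg(6) unfolding track.simps s by blast
  have "cmp C (cmp C u k') f = cmp C u k" using cmp_assoc[OF zz_neg(4) k'(1) zz_neg(1)] k'(2) by simp
  moreover have "cmp C u k' \<in> Hom C (src C (cmp C u k)) (src C f)"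
    using cmp_Hom[OF zz_neg(4) k'(1)] cmp_Hom[OF zz_neg(4,5)] zz_neg(1) by (simp add: Hom_def)
  ultimately show ?case using zz_neg(3)[OF zz_neg(4) k'(1,3)] by auto
qed auto

text \<open>A word need not be traceable from \<open>k\<close>, but the only obstacle is a letter to
  be divided off, and a common left multiple of the accumulator and that letter removes it. The
  multipliers for successive letters accumulate in \<open>u\<close>.\<close>

lemma track_cofinal: "\<lbrakk>zigzag C x w y; k \<in> Hom C v x\<rbrakk> \<Longrightarrow> \<exists>v'. \<exists>u \<in> Hom C v' v. \<exists>d. track w (cmp C u k) d"
proof (induction arbitrary: k v rule: zigzag.induct)
  case (zz_Nil x)
  then show ?case using idn_Hom Hom_obj by force
next
  case (zz_pos f x y w z)
  obtain v' u d where "u \<in> Hom C v' v" "track w (cmp C u (cmp C k f)) d"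
    using zz_pos(3)[OF cmp_Hom[OF zz_pos(4,1)]] by blast
  then show ?case using cmp_assoc[OF _ zz_pos(4,1)] by auto
next
  case (zz_neg f y x w z)
  obtain v1 u1 k1 where 1: "u1 \<in> Hom C v1 v" "k1 \<in> Hom C v1 y" "cmp C u1 k = cmp C k1 f"
    using common_left_multiple[OF zz_neg(4,1)] by blast
  obtain v2 u2 d where 2: "u2 \<in> Hom C v2 v1" "track w (cmp C u2 k1) d"
    using zz_neg(3)[OF 1(2)] by blast
  have "cmp C (cmp C u2 u1) k = cmp C (cmp C u2 k1) f"
    using cmp_assoc[OF 2(1) 1(1) zz_neg(4)] cmp_assoc[OF 2(1) 1(2) zz_neg(1)] 1(3) by simp
  moreover have "cmp C u2 k1 \<in> Hom C v2 y" "src C (cmp C (cmp C u2 k1) f) = v2" "src C f = y"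
    using cmp_Hom[OF 2(1) 1(2)] cmp_Hom[OF cmp_Hom[OF 2(1) 1(2)] zz_neg(1)] zz_neg(1) by (auto simp: Hom_def)
  ultimately have "track ((f, False) # w) (cmp C (cmp C u2 u1) k) d" using 2(2) by auto
  then show ?case using cmp_Hom[OF 2(1) 1(1)] by blast
qed

text \<open>By induction over the congruence. Transitivity is the hard case: the middle word may be
  untraceable from \<open>k\<close>, so the comparison moves to a left multiple \<open>u k\<close>,
  and \<open>u\<close> is cancelled afterwards. Hence the start and its source vary in the
  induction.\<close>

lemma track_word_eq:
  "\<lbrakk>word_eq C x u w y; k \<in> Hom C v x; track u k d; track w k d'\<rbrakk> \<Longrightarrow> d = d'"
proof (induction arbitrary: k v d d' rule: word_eq.induct)
  case (we_refl x w y)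
  then show ?case by (rule track_unique)
next
  case (we_sym x u w y)
  then show ?case by blast
next
  case (we_trans x s t y r)
  have z: "zigzag C x s y" "zigzag C x t y" "zigzag C x r y"
    using word_eq_zigzag[OF we_trans(1)] word_eq_zigzag[OF we_trans(2)] by auto
  obtain v' u e where u: "u \<in> Hom C v' v" "track t (cmp C u k) e" using track_cofinal[OF z(2) we_trans(5)] by blast
  note k = cmp_Hom[OF u(1) we_trans(5)]
  have "cmp C u d = e" "e = cmp C u d'"
    using we_trans(3)[OF k track_cmp[OF z(1) u(1) we_trans(5,6)] u(2)]
      we_trans(4)[OF k u(2) track_cmp[OF z(3) u(1) we_trans(5,7)]] by auto
  then show ?case
    using left_cancel[OF u(1) track_Hom[OF z(1) we_trans(5,6)] track_Hom[OF z(3) we_trans(5,7)]] by simp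
next
  case (we_append x s s' y t t' z)
  obtain m m' where m: "track s k m" "track t m d" "track s' k m'" "track t' m' d'"
    using we_append(6,7) by (auto simp: track_append)
  have "m = m'" by (rule we_append(3)[OF we_append(5) m(1,3)])
  moreover have "m \<in> Hom C v y" using track_Hom[OF _ we_append(5) m(1)] word_eq_zigzag[OF we_append(1)] by blast
  ultimately show ?case using we_append(4) m by blast
next
  case (we_idn x)
  then show ?case using idn_right by auto
next
  case (we_cmp f x y g z)
  then show ?case using cmp_assoc by auto
next
  case (we_inv_right x f y)
  then obtain k' where "k' \<in> Hom C (src C (cmp C k f)) (src C f)" "cmp C k' f = cmp C k f" "d = k'" by auto
  moreover have "src C (cmp C k f) = v" "src C f = x"
    using we_inv_right cmp_Hom[of k v x f y] by (auto simp: Hom_def)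
  ultimately show ?case using right_cancel[of k' v x k f y] we_inv_right by auto
qed auto

text \<open>Tracing from the identity of \<open>x\<close>, the one-letter words have the values
  \<open>f\<close> and \<open>g\<close>.\<close>

lemma env_map_inj:
  assumes "f \<in> Hom C x y" "g \<in> Hom C x y" "env_map C f = env_map C g"
  shows "f = g"
proof -
  have "word_eq C x [(f, True)] [(g, True)] y"
    using assms we_refl[OF zigzag_pos[OF assms(2)]] by (simp add: env_map_Hom word_class_def set_eq_iff)
  moreover have "idn C x \<in> Hom C x x" using idn_Hom Hom_obj[OF assms(1)] by simp
  ultimately show ?thesis
    using track_word_eq[of x "[(f, True)]" "[(g, True)]" y "idn C x" x f g] idn_left[OF assms(1)] idn_left[OF assms(2)]
    by simp
qed

text \<open>Tracing a representing word from a suitable \<open>f\<close> into \<open>x\<close>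
  yields the numerator \<open>d\<close>. Thus every groupoid morphism is a left fraction, the
  inverse of \<open>f\<close> followed by \<open>d\<close>.\<close>

lemma env_numerator:
  assumes "g \<in> Hom (env_groupoid C) x y"
  obtains w f d where "f \<in> Hom C w x" "d \<in> Hom C w y" "cmp (env_groupoid C) (env_map C f) g = env_map C d"
proof -
  obtain w where w: "g = word_class C x w y" "zigzag C x w y" using assms by (auto simp: env_Hom)
  have i: "idn C x \<in> Hom C x x" using zigzag_obj[OF w(2)] idn_Hom by simp
  obtain v u d where u: "u \<in> Hom C v x" "track w (cmp C u (idn C x)) d" using track_cofinal[OF w(2) i] by blast
  have u': "track w u d" using u idn_right[OF u(1)] by simp
  show thesis using that[OF u(1) track_Hom[OF w(2) u(1) u'] track_env[OF w(2) u(1) u', folded w(1)]] .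
qed

lemma env_inv_cmp:
  assumes u: "u \<in> Hom C v w" and f: "f \<in> Hom C w x"
  shows "cmp (env_groupoid C) (env_inv (cmp C u f)) (env_map C u) = env_inv f"
proof -
  let ?c = "cmp (env_groupoid C)"
  note uf = cmp_Hom[OF u f]
  \<comment> \<open>Inserting \<open>f\<close> and its inverse on the right completes
    \<open>u\<close> to \<open>u f\<close>, which then cancels.\<close>
  have "?c (env_inv (cmp C u f)) (env_map C u) = ?c (?c (env_inv (cmp C u f)) (env_map C u)) (?c (env_map C f) (env_inv f))"
    using env_inv_right[OF f] E.idn_right[OF E.cmp_Hom[OF env_inv_Hom[OF uf] I.map_Hom[OF u]]] by simp
  also have "\<dots> = ?c (?c (?c (env_inv (cmp C u f)) (env_map C u)) (env_map C f)) (env_inv f)"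
    by (rule E.cmp_assoc[OF E.cmp_Hom[OF env_inv_Hom[OF uf] I.map_Hom[OF u]] I.map_Hom[OF f] env_inv_Hom[OF f], symmetric])
  also have "?c (?c (env_inv (cmp C u f)) (env_map C u)) (env_map C f) = ?c (env_inv (cmp C u f)) (env_map C (cmp C u f))"
    using E.cmp_assoc[OF env_inv_Hom[OF uf] I.map_Hom[OF u] I.map_Hom[OF f]] I.map_cmp[OF u f] by simp
  finally show ?thesis using env_inv_left[OF uf] E.idn_left[OF env_inv_Hom[OF f]] by simp
qed

end

section \<open>The induced module\<close>

context category
begin

interpretation E: category "env_groupoid C" by (rule category_env)
interpretation I: cat_functor C "env_groupoid C" "\<lambda>x. x" "env_map C" by (rule env_map_functor)

abbreviation ind_tens :: "('o, 'm, 'a) cmod \<Rightarrow> 'o \<Rightarrow> 'o \<Rightarrow> ('o, 'm) fraction \<Rightarrow> 'a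
    \<Rightarrow> ('o \<Rightarrow> ((('o, 'm) fraction \<Rightarrow>\<^sub>0 int) \<times> 'a \<Rightarrow>\<^sub>0 int) set) set"
  where "ind_tens M x z g b \<equiv> tens C (free_hom_module C x) M z (frag_of g) b"

lemma frag_of_free_hom: "g \<in> Hom (env_groupoid C) x z \<Longrightarrow> frag_of g \<in> carrier (val (free_hom_module C x) z)"
  by (simp add: free_hom_module_def)

context
  fixes M :: "('o, 'm, 'a) cmod"
  assumes M: "left_module C M"
begin

interpretation M: left_module C M by (rule M)

lemma ind_tens_closed:
  assumes "g \<in> Hom (env_groupoid C) x z" "b \<in> carrier (val M z)"
  shows "ind_tens M x z g b \<in> carrier (tensor C (free_hom_module C x) M)"
  using tens_closed[OF right_module_free_hom M _ frag_of_free_hom[OF assms(1)] assms(2)] E.Hom_obj[OF assms(1)] by simp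

lemma ind_tens_balanced:
  assumes g: "g \<in> Hom (env_groupoid C) x z" and d: "d \<in> Hom C z z'" and b: "b \<in> carrier (val M z')"
  shows "ind_tens M x z' (cmp (env_groupoid C) g (env_map C d)) b = ind_tens M x z g (act M d b)"
  using tens_balanced[OF right_module_free_hom M d frag_of_free_hom[OF g] b] E.Hom_obj[OF g]
  by (simp add: free_hom_module_def)

lemma induced_generated:
  assumes x: "x \<in> obj C" and H: "subgroup H (tensor C (free_hom_module C x) M)"
    and t: "\<And>z g b. \<lbrakk>g \<in> Hom (env_groupoid C) x z; b \<in> carrier (val M z)\<rbrakk> \<Longrightarrow> ind_tens M x z g b \<in> H"
  shows "carrier (tensor C (free_hom_module C x) M) \<subseteq> H"
proof (rule tensor_generated[OF right_module_free_hom[OF x] M H])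
  fix z c b assume z: "z \<in> obj C" and c: "c \<in> carrier (val (free_hom_module C x) z)" and b: "b \<in> carrier (val M z)"
  note R = right_module_free_hom[OF x]
  interpret H: subgroup H "tensor C (free_hom_module C x) M" by fact
  let ?q = "\<lambda>c. tens C (free_hom_module C x) M z c b"
  have q: "?q \<in> hom (free_Abelian_group (Hom (env_groupoid C) x z)) (tensor C (free_hom_module C x) M)"
    using tens_hom_left[OF R M z b] by (simp add: free_hom_module_def)
  have "Poly_Mapping.keys c \<subseteq> Hom (env_groupoid C) x z" using c by (simp add: free_hom_module_def)
  then show "?q c \<in> H"
  proof (rule free_Abelian_group_induct[where P="\<lambda>c. ?q c \<in> H"])
    show "?q 0 \<in> H"
      using hom_one[OF q group_free_Abelian_group group_tensor[OF R M]] H.one_closed by simp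
    fix c d assume *: "Poly_Mapping.keys c \<subseteq> Hom (env_groupoid C) x z" "Poly_Mapping.keys d \<subseteq> Hom (env_groupoid C) x z"
      "?q c \<in> H" "?q d \<in> H"
    show "?q (c - d) \<in> H"
      unfolding hom_free_diff[OF q group_tensor[OF R M] *(1,2)]
      by (rule H.m_closed[OF *(3) H.m_inv_closed[OF *(4)]])
  qed (rule t[OF _ b])
qed

lemma induced_hom_eqI:
  assumes x: "x \<in> obj C"
    and h: "h \<in> hom (tensor C (free_hom_module C x) M) T" "k \<in> hom (tensor C (free_hom_module C x) M) T" "group T"
    and t: "\<And>z g b. \<lbrakk>g \<in> Hom (env_groupoid C) x z; b \<in> carrier (val M z)\<rbrakk> \<Longrightarrow> h (ind_tens M x z g b) = k (ind_tens M x z g b)"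
    and X: "X \<in> carrier (tensor C (free_hom_module C x) M)"
  shows "h X = k X"
proof -
  interpret T: group T by fact
  interpret X: group "tensor C (free_hom_module C x) M" by (rule group_tensor[OF right_module_free_hom[OF x] M])
  interpret h: group_hom "tensor C (free_hom_module C x) M" T h using h by unfold_locales
  interpret k: group_hom "tensor C (free_hom_module C x) M" T k using h by unfold_locales
  have "subgroup {X \<in> carrier (tensor C (free_hom_module C x) M). h X = k X} (tensor C (free_hom_module C x) M)"
    by (rule X.subgroupI) (auto intro: exI[of _ "\<one>\<^bsub>tensor C (free_hom_module C x) M\<^esub>"])
  from induced_generated[OF x this] t ind_tens_closed X show ?thesis by blast
qed

text \<open>Data on basis elements \<open>g\<close> extend linearly over the free group on the
  morphisms from \<open>x\<close> to \<open>z\<close>; additivity in \<open>b\<close> and balancing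
  then only have to be checked on that basis.\<close>

lemma induced_lift:
  assumes x: "x \<in> obj C" and T: "comm_group T"
    and \<beta>: "\<And>z g. g \<in> Hom (env_groupoid C) x z \<Longrightarrow> \<beta> z g \<in> hom (val M z) T"
    and bal: "\<And>z z' g d b. \<lbrakk>g \<in> Hom (env_groupoid C) x z; d \<in> Hom C z z'; b \<in> carrier (val M z')\<rbrakk>
      \<Longrightarrow> \<beta> z' (cmp (env_groupoid C) g (env_map C d)) b = \<beta> z g (act M d b)"
  obtains h where "h \<in> hom (tensor C (free_hom_module C x) M) T"
    "\<And>z g b. \<lbrakk>g \<in> Hom (env_groupoid C) x z; b \<in> carrier (val M z)\<rbrakk> \<Longrightarrow> h (ind_tens M x z g b) = \<beta> z g b"
proof -
  interpret T: comm_group T by fact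
  let ?R = "free_hom_module C x"
  note R = right_module_free_hom[OF x]
  have val: "val ?R z = free_Abelian_group (Hom (env_groupoid C) x z)" for z by (simp add: free_hom_module_def)
  \<comment> \<open>One linear extension for each \<open>z\<close> and \<open>b\<close>, chosen as a
    function of both so that \<open>tensor_lift\<close> can be applied to it.\<close>
  define B where "B z b = (SOME h. h \<in> hom (free_Abelian_group (Hom (env_groupoid C) x z)) T \<and>
      (\<forall>g \<in> Hom (env_groupoid C) x z. h (frag_of g) = \<beta> z g b))" for z b
  have B: "B z b \<in> hom (free_Abelian_group (Hom (env_groupoid C) x z)) T"
    "g \<in> Hom (env_groupoid C) x z \<Longrightarrow> B z b (frag_of g) = \<beta> z g b" if b: "b \<in> carrier (val M z)" for z b g
  proof -
    have img: "(\<lambda>g. \<beta> z g b) ` Hom (env_groupoid C) x z \<subseteq> carrier T"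
      using hom_in_carrier[OF \<beta> b] by blast
    have "\<exists>h. h \<in> hom (free_Abelian_group (Hom (env_groupoid C) x z)) T \<and>
      (\<forall>g \<in> Hom (env_groupoid C) x z. h (frag_of g) = \<beta> z g b)"
      by (rule T.free_Abelian_group_universal[OF img]) blast
    from someI_ex[OF this] show "B z b \<in> hom (free_Abelian_group (Hom (env_groupoid C) x z)) T"
      "g \<in> Hom (env_groupoid C) x z \<Longrightarrow> B z b (frag_of g) = \<beta> z g b" unfolding B_def by blast+
  qed
  obtain h where h: "h \<in> hom (tensor C ?R M) T"
    "\<And>z a b. \<lbrakk>z \<in> obj C; a \<in> carrier (val ?R z); b \<in> carrier (val M z)\<rbrakk> \<Longrightarrow> h (tens C ?R M z a b) = B z b a"
  proof (rule tensor_lift[OF R M T, of "\<lambda>z a b. B z b a"])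
    show "B z b a \<in> carrier T" if "z \<in> obj C" "a \<in> carrier (val ?R z)" "b \<in> carrier (val M z)" for z a b
      using hom_in_carrier[OF B(1)[OF that(3)]] that(2) unfolding val .
    show "B z b (a \<otimes>\<^bsub>val ?R z\<^esub> a') = B z b a \<otimes>\<^bsub>T\<^esub> B z b a'"
      if "z \<in> obj C" "a \<in> carrier (val ?R z)" "a' \<in> carrier (val ?R z)" "b \<in> carrier (val M z)" for z a a' b
      using hom_mult[OF B(1)[OF that(4)]] that(2,3) unfolding val .
  next
    fix z a b b' assume z: "z \<in> obj C" and a: "a \<in> carrier (val ?R z)" and b: "b \<in> carrier (val M z)" "b' \<in> carrier (val M z)"
    have bb: "b \<otimes>\<^bsub>val M z\<^esub> b' \<in> carrier (val M z)"
      using M.val_comm_group[OF z] b by (simp add: comm_group_def comm_monoid_def monoid.m_closed)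
    show "B z (b \<otimes>\<^bsub>val M z\<^esub> b') a = B z b a \<otimes>\<^bsub>T\<^esub> B z b' a"
    proof (rule hom_free_eqI[OF B(1)[OF bb] T.hom_group_mult[OF B(1)[OF b(1)] B(1)[OF b(2)]] T.is_group])
      fix g assume "g \<in> Hom (env_groupoid C) x z"
      then show "B z (b \<otimes>\<^bsub>val M z\<^esub> b') (frag_of g) = B z b (frag_of g) \<otimes>\<^bsub>T\<^esub> B z b' (frag_of g)"
        using B(2) bb b hom_mult[OF \<beta>] by simp
    qed (use a in \<open>simp add: val\<close>)
  next
    fix d z z' a b assume d: "d \<in> Hom C z z'" and a: "a \<in> carrier (val ?R z)" and b: "b \<in> carrier (val M z')"
    have db: "act M d b \<in> carrier (val M z)" by (rule hom_in_carrier[OF M.act_hom[OF d] b])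
    have c: "B z' b \<circ> act ?R d \<in> hom (free_Abelian_group (Hom (env_groupoid C) x z)) T"
      by (rule hom_compose[OF right_module.act_hom[OF R d, unfolded val] B(1)[OF b]])
    have "(B z' b \<circ> act ?R d) a = B z (act M d b) a"
    proof (rule hom_free_eqI[OF c B(1)[OF db] T.is_group])
      fix g assume g: "g \<in> Hom (env_groupoid C) x z"
      have "act ?R d (frag_of g) = frag_of (cmp (env_groupoid C) g (env_map C d))" by (simp add: free_hom_module_def)
      then show "(B z' b \<circ> act ?R d) (frag_of g) = B z (act M d b) (frag_of g)"
        using B(2)[OF b E.cmp_Hom[OF g I.map_Hom[OF d]]] B(2)[OF db g] bal[OF g d b] by simp
    qed (use a in \<open>simp add: val\<close>)
    then show "B z' b (act ?R d a) = B z (act M d b) a" by simp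
  qed (rule that)
  show thesis
  proof (rule that[OF h(1)])
    show "h (ind_tens M x z g b) = \<beta> z g b" if g: "g \<in> Hom (env_groupoid C) x z" and b: "b \<in> carrier (val M z)" for z g b
      using h(2)[OF _ frag_of_free_hom[OF g] b] B(2)[OF b g] E.Hom_obj[OF g] by simp
  qed
qed

lemma induced_act_tens:
  assumes h: "h \<in> Hom (env_groupoid C) x y" and g: "g \<in> Hom (env_groupoid C) y z" and b: "b \<in> carrier (val M z)"
  shows "act (induced_module C M) h (ind_tens M y z g b) = ind_tens M x z (cmp (env_groupoid C) h g) b"
proof -
  have obj: "x \<in> obj C" "y \<in> obj C" "z \<in> obj C" using E.Hom_obj[OF h] E.Hom_obj[OF g] by auto
  let ?\<rho> = "\<lambda>_ :: 'o. frag_extend (\<lambda>g. frag_of (cmp (env_groupoid C) h g))"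
  have hom: "?\<rho> w \<in> hom (val (free_hom_module C y) w) (val (free_hom_module C x) w)" for w
    unfolding free_hom_module_def cmod.simps by (rule frag_extend_hom) (use E.cmp_Hom[OF h] in auto)
  have "?\<rho> w' (act (free_hom_module C y) d a) = act (free_hom_module C x) d (?\<rho> w a)"
    if d: "d \<in> Hom C w w'" and a: "a \<in> carrier (val (free_hom_module C y) w)" for w w' d a
  proof -
    have "frag_extend (\<lambda>g. frag_of (cmp (env_groupoid C) h (cmp (env_groupoid C) g (env_map C d)))) a =
      frag_extend (\<lambda>g. frag_of (cmp (env_groupoid C) (cmp (env_groupoid C) h g) (env_map C d))) a"
      by (rule frag_extend_eq) (use a E.cmp_assoc[OF h _ I.map_Hom[OF d]] in \<open>auto simp: free_hom_module_def\<close>)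
    then show ?thesis by (simp add: free_hom_module_def frag_extend_frag_extend)
  qed
  then have \<rho>: "right_module_hom C (free_hom_module C y) (free_hom_module C x) ?\<rho>"
    using hom unfolding right_module_hom_def by blast
  have id: "module_hom C M M (\<lambda>_ b. b)" by (auto simp: module_hom_def hom_def)
  have "src (env_groupoid C) h = x" using h by (simp add: Hom_def)
  then show ?thesis
    using tensor_map_tens[OF right_module_free_hom[OF obj(2)] M right_module_free_hom[OF obj(1)] M \<rho> id obj(3)
        frag_of_free_hom[OF g] b]
    by (simp add: induced_module_def)
qed

text \<open>The unit of the adjunction between induction and restriction along
  \<open>env_map\<close>: \<open>b\<close> goes to \<open>1 \<otimes> b\<close>.\<close>

definition ind_unit :: "'o \<Rightarrow> 'a \<Rightarrow> ('o \<Rightarrow> ((('o, 'm) fraction \<Rightarrow>\<^sub>0 int) \<times> 'a \<Rightarrow>\<^sub>0 int) set) set"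
  where "ind_unit z b = ind_tens M z z (idn (env_groupoid C) z) b"

lemma ind_unit_hom: "module_hom C M (restrict_module (\<lambda>x. x) (env_map C) (induced_module C M)) ind_unit"
proof -
  have "ind_unit z \<in> hom (val M z) (tensor C (free_hom_module C z) M)" if z: "z \<in> obj C" for z
    unfolding ind_unit_def using tens_hom_right[OF right_module_free_hom[OF z] M z frag_of_free_hom] E.idn_Hom z by simp
  moreover have "ind_unit x (act M f b) = act (induced_module C M) (env_map C f) (ind_unit y b)"
    if f: "f \<in> Hom C x y" and b: "b \<in> carrier (val M y)" for f x y b
  proof -
    note fE = I.map_Hom[OF f]
    have i: "idn (env_groupoid C) x \<in> Hom (env_groupoid C) x x" "idn (env_groupoid C) y \<in> Hom (env_groupoid C) y y"
      using E.Hom_obj[OF fE] E.idn_Hom by auto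
    show ?thesis unfolding ind_unit_def
      using ind_tens_balanced[OF i(1) f b] induced_act_tens[OF fE i(2) b] E.idn_left[OF fE] E.idn_right[OF fE] by simp
  qed
  ultimately show ?thesis by (simp add: module_hom_def restrict_module_def induced_module_def)
qed

text \<open>Hence homomorphisms out of the induced module are determined on the image of the
  unit.\<close>

lemma ind_tens_unit:
  assumes "g \<in> Hom (env_groupoid C) x z" "b \<in> carrier (val M z)"
  shows "ind_tens M x z g b = act (induced_module C M) g (ind_unit z b)"
  unfolding ind_unit_def using induced_act_tens[OF assms(1) E.idn_Hom assms(2)] E.idn_right[OF assms(1)] E.Hom_obj[OF assms(1)]
  by simp

text \<open>Existence in the adjunction: the extension of \<open>\<theta>\<close> has to send
  \<open>g \<otimes> b\<close> to the action of \<open>g\<close> on \<open>\<theta> z b\<close>, and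
  naturality of \<open>\<theta>\<close> along \<open>env_map\<close> is the balancing condition that
  makes this well defined.\<close>

lemma induced_extend:
  assumes A: "left_module (env_groupoid C) A" and \<theta>: "module_hom C M (restrict_module (\<lambda>x. x) (env_map C) A) \<theta>"
  obtains \<Theta> where "module_hom (env_groupoid C) (induced_module C M) A \<Theta>"
    "\<And>x z g b. \<lbrakk>g \<in> Hom (env_groupoid C) x z; b \<in> carrier (val M z)\<rbrakk> \<Longrightarrow> \<Theta> x (ind_tens M x z g b) = act A g (\<theta> z b)"
proof -
  interpret A: left_module "env_groupoid C" A by fact
  have \<theta>h: "\<theta> z \<in> hom (val M z) (val A z)" if "z \<in> obj C" for z
    using \<theta> that by (simp add: module_hom_def restrict_module_def)
  have "\<exists>h. h \<in> hom (tensor C (free_hom_module C x) M) (val A x) \<and>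
    (\<forall>z. \<forall>g \<in> Hom (env_groupoid C) x z. \<forall>b \<in> carrier (val M z). h (ind_tens M x z g b) = act A g (\<theta> z b))"
    if x: "x \<in> obj C" for x
  proof (rule induced_lift[OF x, of "val A x" "\<lambda>z g b. act A g (\<theta> z b)"])
    show "comm_group (val A x)" using A.val_comm_group x by simp
    show "(\<lambda>b. act A g (\<theta> z b)) \<in> hom (val M z) (val A x)" if g: "g \<in> Hom (env_groupoid C) x z" for z g
      using hom_compose[OF \<theta>h A.act_hom[OF g]] E.Hom_obj[OF g] by (simp add: comp_def)
    fix z z' g d b assume g: "g \<in> Hom (env_groupoid C) x z" and d: "d \<in> Hom C z z'" and b: "b \<in> carrier (val M z')"
    have "\<theta> z' b \<in> carrier (val A z')" using hom_in_carrier[OF \<theta>h b] Hom_obj[OF d] by simp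
    moreover have "\<theta> z (act M d b) = act A (env_map C d) (\<theta> z' b)"
      using \<theta> d b by (simp add: module_hom_def restrict_module_def)
    ultimately show "act A (cmp (env_groupoid C) g (env_map C d)) (\<theta> z' b) = act A g (\<theta> z (act M d b))"
      using A.act_cmp[OF g I.map_Hom[OF d]] by simp
  qed blast
  then obtain \<Theta> where \<Theta>: "\<And>x. x \<in> obj C \<Longrightarrow> \<Theta> x \<in> hom (tensor C (free_hom_module C x) M) (val A x)"
    "\<And>x z g b. \<lbrakk>x \<in> obj C; g \<in> Hom (env_groupoid C) x z; b \<in> carrier (val M z)\<rbrakk>
      \<Longrightarrow> \<Theta> x (ind_tens M x z g b) = act A g (\<theta> z b)"
    by metis
  interpret IM: left_module "env_groupoid C" "induced_module C M" by (rule left_module_induced[OF M])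
  have "\<Theta> x (act (induced_module C M) h X) = act A h (\<Theta> y X)"
    if h: "h \<in> Hom (env_groupoid C) x y" and X: "X \<in> carrier (tensor C (free_hom_module C y) M)" for h x y X
  proof -
    have obj: "x \<in> obj C" "y \<in> obj C" using E.Hom_obj[OF h] by auto
    have ah: "act (induced_module C M) h \<in> hom (tensor C (free_hom_module C y) M) (tensor C (free_hom_module C x) M)"
      using IM.act_hom[OF h] by (simp add: induced_module_def)
    have "(\<Theta> x \<circ> act (induced_module C M) h) X = (act A h \<circ> \<Theta> y) X"
    proof (rule induced_hom_eqI[OF obj(2) hom_compose[OF ah \<Theta>(1)[OF obj(1)]] hom_compose[OF \<Theta>(1)[OF obj(2)] A.act_hom[OF h]] _ _ X])
      show "Group.group (val A x)" using A.val_comm_group obj by (simp add: comm_group_def)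
      fix z g b assume g: "g \<in> Hom (env_groupoid C) y z" and b: "b \<in> carrier (val M z)"
      have "\<theta> z b \<in> carrier (val A z)" using hom_in_carrier[OF \<theta>h b] E.Hom_obj[OF g] by simp
      then show "(\<Theta> x \<circ> act (induced_module C M) h) (ind_tens M y z g b) = (act A h \<circ> \<Theta> y) (ind_tens M y z g b)"
        using induced_act_tens[OF h g b] \<Theta>(2)[OF obj(1) E.cmp_Hom[OF h g] b] \<Theta>(2)[OF obj(2) g b] A.act_cmp[OF h g]
        by simp
    qed
    then show ?thesis by simp
  qed
  with \<Theta>(1) have "module_hom (env_groupoid C) (induced_module C M) A \<Theta>"
    by (simp add: module_hom_def induced_module_def)
  then show thesis by (rule that) (use \<Theta>(2) E.Hom_obj in auto)
qed

end

section \<open>Functoriality of induction\<close>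

definition ind_map :: "('o, 'm, 'b) cmod \<Rightarrow> ('o \<Rightarrow> 'a \<Rightarrow> 'b) \<Rightarrow> 'o
    \<Rightarrow> ('o \<Rightarrow> ((('o, 'm) fraction \<Rightarrow>\<^sub>0 int) \<times> 'a \<Rightarrow>\<^sub>0 int) set) set \<Rightarrow> ('o \<Rightarrow> ((('o, 'm) fraction \<Rightarrow>\<^sub>0 int) \<times> 'b \<Rightarrow>\<^sub>0 int) set) set"
  where "ind_map N \<mu> x = tensor_map C (free_hom_module C x) N (\<lambda>_ r. r) \<mu>"

context
  fixes M :: "('o, 'm, 'a) cmod" and N :: "('o, 'm, 'b) cmod" and \<mu>
  assumes M: "left_module C M" and N: "left_module C N" and \<mu>: "module_hom C M N \<mu>"
begin

lemma ind_map_tens: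
  assumes "g \<in> Hom (env_groupoid C) x z" "b \<in> carrier (val M z)"
  shows "ind_map N \<mu> x (ind_tens M x z g b) = ind_tens N x z g (\<mu> z b)"
  unfolding ind_map_def
  using tensor_map_tens[OF right_module_free_hom M right_module_free_hom N right_module_hom_id \<mu> _
      frag_of_free_hom[OF assms(1)] assms(2)] E.Hom_obj[OF assms(1)] by simp

lemma ind_map_hom: "module_hom (env_groupoid C) (induced_module C M) (induced_module C N) (ind_map N \<mu>)"
proof -
  interpret IM: left_module "env_groupoid C" "induced_module C M" by (rule left_module_induced[OF M])
  interpret IN: left_module "env_groupoid C" "induced_module C N" by (rule left_module_induced[OF N])
  have h: "ind_map N \<mu> x \<in> hom (tensor C (free_hom_module C x) M) (tensor C (free_hom_module C x) N)"
    if "x \<in> obj C" for x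
    unfolding ind_map_def using right_module_free_hom[OF that]
    by (intro tensor_map_hom M N right_module_hom_id \<mu>)
  have "ind_map N \<mu> x (act (induced_module C M) h X) = act (induced_module C N) h (ind_map N \<mu> y X)"
    if k: "h \<in> Hom (env_groupoid C) x y" and X: "X \<in> carrier (tensor C (free_hom_module C y) M)" for h x y X
  proof -
    have obj: "x \<in> obj C" "y \<in> obj C" using E.Hom_obj[OF k] by auto
    have a: "act (induced_module C M) h \<in> hom (tensor C (free_hom_module C y) M) (tensor C (free_hom_module C x) M)"
      "act (induced_module C N) h \<in> hom (tensor C (free_hom_module C y) N) (tensor C (free_hom_module C x) N)"
      using IM.act_hom[OF k] IN.act_hom[OF k] by (simp_all add: induced_module_def)
    have "(ind_map N \<mu> x \<circ> act (induced_module C M) h) X = (act (induced_module C N) h \<circ> ind_map N \<mu> y) X"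
    proof (rule induced_hom_eqI[OF M obj(2) hom_compose[OF a(1) h[OF obj(1)]] hom_compose[OF h[OF obj(2)] a(2)]
          group_tensor[OF right_module_free_hom[OF obj(1)] N] _ X])
      fix z g b assume g: "g \<in> Hom (env_groupoid C) y z" and b: "b \<in> carrier (val M z)"
      have "\<mu> z b \<in> carrier (val N z)" using module_hom_closed[OF \<mu> _ b] E.Hom_obj[OF g] by simp
      then show "(ind_map N \<mu> x \<circ> act (induced_module C M) h) (ind_tens M y z g b) =
          (act (induced_module C N) h \<circ> ind_map N \<mu> y) (ind_tens M y z g b)"
        using induced_act_tens[OF M k g b] induced_act_tens[OF N k g] ind_map_tens[OF E.cmp_Hom[OF k g] b] ind_map_tens[OF g b]
        by simp
    qed
    then show ?thesis by simp
  qed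
  with h show ?thesis by (simp add: module_hom_def induced_module_def)
qed

end

end

section \<open>Exactness of induction\<close>

context left_ore
begin

interpretation E: category "env_groupoid C" by (rule category_env)
interpretation I: cat_functor C "env_groupoid C" "\<lambda>x. x" "env_map C" by (rule env_map_functor)

text \<open>Once \<open>f g\<close> has a numerator, so has \<open>u f g\<close> for every
  \<open>u\<close>: being defined is stable along left multiples, as germs require.\<close>

lemma env_numerator_cmp:
  assumes f: "f \<in> Hom C w x" and d: "d \<in> Hom C w y" and g: "g \<in> Hom (env_groupoid C) x y"
    and e: "cmp (env_groupoid C) (env_map C f) g = env_map C d" and u: "u \<in> Hom C v w"
  shows "cmp (env_groupoid C) (env_map C (cmp C u f)) g = env_map C (cmp C u d)"
  using E.cmp_assoc[OF I.map_Hom[OF u] I.map_Hom[OF f] g] I.map_cmp[OF u f] I.map_cmp[OF u d] e by simp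

context
  fixes M :: "('a, 'b, 'c) cmod"
  assumes M: "left_module C M"
begin

interpretation M: left_module C M by (rule M)

lemma val_group: "z \<in> obj C \<Longrightarrow> group (val M z)"
  using M.val_comm_group by (simp add: comm_group_def)

text \<open>Passing to a larger denominator: the inverse of \<open>f\<close> is the inverse of
  \<open>u f\<close> followed by \<open>u\<close>, and \<open>u\<close> moves across the tensor
  sign.\<close>

lemma fraction_expand:
  assumes u: "u \<in> Hom C v w" and f: "f \<in> Hom C w x" and a: "a \<in> carrier (val M w)"
  shows "ind_tens M x w (env_inv f) a = ind_tens M x v (env_inv (cmp C u f)) (act M u a)"
  using ind_tens_balanced[OF M env_inv_Hom[OF cmp_Hom[OF u f]] u a] env_inv_cmp[OF u f] by simp

lemma fraction_hom:
  assumes f: "f \<in> Hom C w x"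
  shows "ind_tens M x w (env_inv f) \<in> hom (val M w) (tensor C (free_hom_module C x) M)"
  using tens_hom_right[OF right_module_free_hom M _ frag_of_free_hom[OF env_inv_Hom[OF f]]] Hom_obj[OF f] by simp

text \<open>Single fractions are closed under products because two denominators into
  \<open>x\<close> have a common left multiple, and they contain each generator
  \<open>g \<otimes> b\<close> because \<open>g\<close> itself is a left fraction.\<close>

lemma induced_fraction:
  assumes x: "x \<in> obj C" and X: "X \<in> carrier (tensor C (free_hom_module C x) M)"
  obtains w f a where "f \<in> Hom C w x" "a \<in> carrier (val M w)" "X = ind_tens M x w (env_inv f) a"
proof -
  let ?T = "tensor C (free_hom_module C x) M"
  let ?H = "{ind_tens M x w (env_inv f) a | w f a. f \<in> Hom C w x \<and> a \<in> carrier (val M w)}"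
  interpret T: group ?T by (rule group_tensor[OF right_module_free_hom[OF x] M])
  note R = right_module_free_hom[OF x]
  have "subgroup ?H ?T"
  proof (rule T.subgroupI)
    show "?H \<subseteq> carrier ?T" using hom_in_carrier[OF fraction_hom] by blast
    have "\<one>\<^bsub>val M x\<^esub> \<in> carrier (val M x)" using val_group[OF x] by (simp add: group.is_monoid monoid.one_closed)
    then show "?H \<noteq> {}" using idn_Hom[OF x] by blast
  next
    fix Y assume "Y \<in> ?H"
    then obtain w f a where Y: "Y = ind_tens M x w (env_inv f) a" "f \<in> Hom C w x" "a \<in> carrier (val M w)" by blast
    interpret h: group_hom "val M w" ?T "ind_tens M x w (env_inv f)"
      using fraction_hom[OF Y(2)] val_group Hom_obj[OF Y(2)] T.is_group by (simp add: group_hom_def group_hom_axioms_def)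
    have "inv\<^bsub>?T\<^esub> Y = ind_tens M x w (env_inv f) (inv\<^bsub>val M w\<^esub> a)" using Y by simp
    then show "inv\<^bsub>?T\<^esub> Y \<in> ?H" using Y h.G.inv_closed by blast
  next
    fix Y Z assume "Y \<in> ?H" "Z \<in> ?H"
    then obtain w f a w' f' a' where Y: "Y = ind_tens M x w (env_inv f) a" "f \<in> Hom C w x" "a \<in> carrier (val M w)"
      and Z: "Z = ind_tens M x w' (env_inv f') a'" "f' \<in> Hom C w' x" "a' \<in> carrier (val M w')" by blast
    obtain v u u' where u: "u \<in> Hom C v w" "u' \<in> Hom C v w'" "cmp C u f = cmp C u' f'"
      using common_left_multiple[OF Y(2) Z(2)] by blast
    have ua: "act M u a \<in> carrier (val M v)" "act M u' a' \<in> carrier (val M v)"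
      using hom_in_carrier[OF M.act_hom[OF u(1)] Y(3)] hom_in_carrier[OF M.act_hom[OF u(2)] Z(3)] .
    have "Y \<otimes>\<^bsub>?T\<^esub> Z = ind_tens M x v (env_inv (cmp C u f)) (act M u a \<otimes>\<^bsub>val M v\<^esub> act M u' a')"
      using fraction_expand[OF u(1) Y(2,3)] fraction_expand[OF u(2) Z(2,3)] u(3) Y(1) Z(1)
        hom_mult[OF fraction_hom[OF cmp_Hom[OF u(1) Y(2)]] ua] by simp
    moreover have "act M u a \<otimes>\<^bsub>val M v\<^esub> act M u' a' \<in> carrier (val M v)"
      using ua val_group Hom_obj[OF u(1)] by (simp add: group.is_monoid monoid.m_closed)
    ultimately show "Y \<otimes>\<^bsub>?T\<^esub> Z \<in> ?H" using cmp_Hom[OF u(1) Y(2)] by blast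
  qed
  moreover have "ind_tens M x z g b \<in> ?H" if g: "g \<in> Hom (env_groupoid C) x z" and b: "b \<in> carrier (val M z)" for z g b
  proof -
    obtain w f d where f: "f \<in> Hom C w x" "d \<in> Hom C w z" "cmp (env_groupoid C) (env_map C f) g = env_map C d"
      by (rule env_numerator[OF g])
    have "cmp (env_groupoid C) (env_inv f) (env_map C d) = g"
      using E.cmp_assoc[OF env_inv_Hom[OF f(1)] I.map_Hom[OF f(1)] g] env_inv_left[OF f(1)] E.idn_left[OF g] f(3) by simp
    then have "ind_tens M x z g b = ind_tens M x w (env_inv f) (act M d b)"
      using ind_tens_balanced[OF M env_inv_Hom[OF f(1)] f(2) b] by simp
    then show ?thesis using f(1) hom_in_carrier[OF M.act_hom[OF f(2)] b] by blast
  qed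
  ultimately have "carrier ?T \<subseteq> ?H" by (rule induced_generated[OF M x])
  then show thesis using X that by blast
qed

text \<open>Trivial fractions are detected in a reduced product: a tensor \<open>g \<otimes> b\<close> is sent to the germ, along
  left multiples, of the function that maps a morphism \<open>k\<close> into \<open>x\<close> to \<open>(k g).b\<close> as soon as \<open>k g\<close> lies
  in the category.\<close>

lemma fraction_trivial:
  assumes f: "f \<in> Hom C w x" and a: "a \<in> carrier (val M w)"
    and 1: "ind_tens M x w (env_inv f) a = \<one>\<^bsub>tensor C (free_hom_module C x) M\<^esub>"
  shows "\<exists>v. \<exists>u \<in> Hom C v w. act M u a = \<one>\<^bsub>val M v\<^esub>"
proof -
  let ?c = "cmp (env_groupoid C)"
  have x: "x \<in> obj C" using Hom_obj[OF f] by simp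
  define K where "K = {k \<in> mor C. tgt C k = x}"
  define Pr where "Pr = product_group K (\<lambda>k. val M (src C k))"
  \<comment> \<open>The functions that are trivial on all left multiples of some morphism
    \<open>h\<close> into \<open>x\<close>. Common left multiples make these sets of arguments a
    filter base, so \<open>N\<close> is a subgroup and \<open>Pr Mod N\<close> is the group of
    germs.\<close>
  define N where "N = {\<phi> \<in> carrier Pr. \<exists>v. \<exists>h \<in> Hom C v x. \<forall>v'. \<forall>u \<in> Hom C v' v. \<phi> (cmp C u h) = \<one>\<^bsub>val M v'\<^esub>}"
  have K: "k \<in> K \<longleftrightarrow> k \<in> Hom C (src C k) x" for k by (auto simp: K_def Hom_def)
  have HomK: "k \<in> Hom C v x \<Longrightarrow> k \<in> K \<and> src C k = v" for k v by (simp add: K_def Hom_def)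
  have Kgr: "comm_group (val M (src C k))" if "k \<in> K" for k using M.val_comm_group Hom_obj that K by blast
  have Kgr': "group (val M (src C k))" if "k \<in> K" for k using Kgr[OF that] by (simp add: comm_group_def)
  have Pr: "comm_group Pr"
  proof (rule group.group_comm_groupI)
    show "group Pr" unfolding Pr_def using Kgr' by simp
    show "\<phi> \<otimes>\<^bsub>Pr\<^esub> \<psi> = \<psi> \<otimes>\<^bsub>Pr\<^esub> \<phi>" if "\<phi> \<in> carrier Pr" "\<psi> \<in> carrier Pr" for \<phi> \<psi>
      using that Kgr by (auto simp: Pr_def PiE_iff comm_group_def comm_monoid.m_comm intro!: restrict_ext)
  qed
  interpret Pr: comm_group Pr by (rule Pr)
  have at: "\<phi> k \<in> carrier (val M v)" if "\<phi> \<in> carrier Pr" "k \<in> Hom C v x" for \<phi> k v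
    using that HomK[OF that(2)] by (auto simp: Pr_def)
  have mult: "(\<phi> \<otimes>\<^bsub>Pr\<^esub> \<psi>) k = \<phi> k \<otimes>\<^bsub>val M v\<^esub> \<psi> k" if "k \<in> Hom C v x" for \<phi> \<psi> k v
    using HomK[OF that] by (auto simp: Pr_def)
  have inv: "(inv\<^bsub>Pr\<^esub> \<phi>) k = inv\<^bsub>val M v\<^esub> \<phi> k" if "\<phi> \<in> carrier Pr" "k \<in> Hom C v x" for \<phi> k v
    using HomK[OF that(2)] that(1) inv_product_group[of \<phi> K "\<lambda>k. val M (src C k)"] Kgr' by (auto simp: Pr_def)
  have objs: "v' \<in> obj C" if "u \<in> Hom C v' v" for u v' v using Hom_obj[OF that] by simp
  have N: "subgroup N Pr"
  proof (rule Pr.subgroupI)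
    have "\<one>\<^bsub>Pr\<^esub> (cmp C u (idn C x)) = \<one>\<^bsub>val M v'\<^esub>" if "u \<in> Hom C v' x" for u v'
      using HomK[OF cmp_Hom[OF that idn_Hom[OF x]]] by (simp add: Pr_def)
    then have "\<one>\<^bsub>Pr\<^esub> \<in> N" unfolding N_def using idn_Hom[OF x] Pr.one_closed by blast
    then show "N \<noteq> {}" by blast
  next
    fix \<phi> assume "\<phi> \<in> N"
    then obtain v h where h: "\<phi> \<in> carrier Pr" "h \<in> Hom C v x" "\<And>v' u. u \<in> Hom C v' v \<Longrightarrow> \<phi> (cmp C u h) = \<one>\<^bsub>val M v'\<^esub>"
      unfolding N_def by blast
    have "(inv\<^bsub>Pr\<^esub> \<phi>) (cmp C u h) = \<one>\<^bsub>val M v'\<^esub>" if "u \<in> Hom C v' v" for u v'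
      using inv[OF h(1) cmp_Hom[OF that h(2)]] h(3)[OF that] val_group[OF objs[OF that]]
      by (simp add: group.is_monoid monoid.inv_one)
    then show "inv\<^bsub>Pr\<^esub> \<phi> \<in> N" unfolding N_def using h(1,2) Pr.inv_closed by blast
  next
    fix \<phi> \<psi> assume "\<phi> \<in> N" "\<psi> \<in> N"
    then obtain v h v' h' where h: "\<phi> \<in> carrier Pr" "h \<in> Hom C v x" "\<And>s u. u \<in> Hom C s v \<Longrightarrow> \<phi> (cmp C u h) = \<one>\<^bsub>val M s\<^esub>"
      and h': "\<psi> \<in> carrier Pr" "h' \<in> Hom C v' x" "\<And>s u. u \<in> Hom C s v' \<Longrightarrow> \<psi> (cmp C u h') = \<one>\<^bsub>val M s\<^esub>"
      unfolding N_def by blast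
    obtain t r r' where r: "r \<in> Hom C t v" "r' \<in> Hom C t v'" "cmp C r h = cmp C r' h'"
      using common_left_multiple[OF h(2) h'(2)] by blast
    have "(\<phi> \<otimes>\<^bsub>Pr\<^esub> \<psi>) (cmp C u (cmp C r h)) = \<one>\<^bsub>val M s\<^esub>" if u: "u \<in> Hom C s t" for u s
      using mult[OF cmp_Hom[OF u cmp_Hom[OF r(1) h(2)]]] h(3)[OF cmp_Hom[OF u r(1)]] h'(3)[OF cmp_Hom[OF u r(2)]]
        cmp_assoc[OF u r(1) h(2)] cmp_assoc[OF u r(2) h'(2)] r(3) val_group[OF objs[OF u]]
      by (simp add: group.is_monoid monoid.one_closed monoid.l_one)
    then show "\<phi> \<otimes>\<^bsub>Pr\<^esub> \<psi> \<in> N" unfolding N_def using h(1) h'(1) cmp_Hom[OF r(1) h(2)] Pr.m_closed by blast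
  qed (auto simp: N_def)
  note proj = FactGroup_proj_hom[OF Pr N]
  have D: "comm_group (Pr Mod N)" by (rule Pr.abelian_FactGroup[OF N])
  interpret D: comm_group "Pr Mod N" by (rule D)
  interpret p: group_hom Pr "Pr Mod N" "\<lambda>\<phi>. N #>\<^bsub>Pr\<^esub> \<phi>" using proj(1) by unfold_locales
  have germ_eq: "N #>\<^bsub>Pr\<^esub> \<phi> = N #>\<^bsub>Pr\<^esub> \<psi>"
    if "\<phi> \<in> carrier Pr" "\<psi> \<in> carrier Pr" "h \<in> Hom C v x" "\<And>v' u. u \<in> Hom C v' v \<Longrightarrow> \<phi> (cmp C u h) = \<psi> (cmp C u h)" for \<phi> \<psi> h v
  proof -
    have "(\<phi> \<otimes>\<^bsub>Pr\<^esub> inv\<^bsub>Pr\<^esub> \<psi>) (cmp C u h) = \<one>\<^bsub>val M v'\<^esub>" if u: "u \<in> Hom C v' v" for u v'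
      using mult[OF cmp_Hom[OF u \<open>h \<in> Hom C v x\<close>]] inv[OF \<open>\<psi> \<in> carrier Pr\<close> cmp_Hom[OF u \<open>h \<in> Hom C v x\<close>]]
        \<open>\<And>v' u. u \<in> Hom C v' v \<Longrightarrow> \<phi> (cmp C u h) = \<psi> (cmp C u h)\<close>[OF u] at[OF \<open>\<psi> \<in> carrier Pr\<close> cmp_Hom[OF u \<open>h \<in> Hom C v x\<close>]]
        group.r_inv[OF val_group[OF objs[OF u]]] by simp
    then have "\<phi> \<otimes>\<^bsub>Pr\<^esub> inv\<^bsub>Pr\<^esub> \<psi> \<in> N" unfolding N_def using that by auto
    from proj(2)[OF this] show ?thesis
      using that(1,2) p.hom_mult[of \<phi> "inv\<^bsub>Pr\<^esub> \<psi>"] p.hom_inv[of \<psi>] D.mult_inv_eq_one_iff p.hom_closed by simp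
  qed
  \<comment> \<open>\<open>env_map_inj\<close> makes the numerator of \<open>k g\<close>
    unique.\<close>
  define num where "num g z k = (THE d. d \<in> Hom C (src C k) z \<and> ?c (env_map C k) g = env_map C d)" for g z k
  have num: "num g z k = d" if "d \<in> Hom C (src C k) z" "?c (env_map C k) g = env_map C d" for g z k d
    unfolding num_def by (rule the_equality) (use that env_map_inj in auto)
  \<comment> \<open>Where \<open>k g\<close> has no numerator the value is set to the unit. This
    choice does not affect the germ, since by \<open>env_numerator\<close> and
    \<open>env_numerator_cmp\<close> numerators exist on all left multiples of some morphism into
    \<open>x\<close>.\<close>
  define \<beta> where "\<beta> z g b = (\<lambda>k\<in>K. if \<exists>d \<in> Hom C (src C k) z. ?c (env_map C k) g = env_map C d
      then act M (num g z k) b else \<one>\<^bsub>val M (src C k)\<^esub>)" for z g b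
  have \<beta>_eq: "\<beta> z g b k = act M d b"
    if "k \<in> Hom C v x" "d \<in> Hom C v z" "?c (env_map C k) g = env_map C d" for z g b k d v
    using num[of d k z g] HomK[OF that(1)] that(2,3) by (auto simp: \<beta>_def)
  have \<beta>_hom: "\<beta> z g \<in> hom (val M z) Pr" for z g
  proof -
    \<comment> \<open>Whether a numerator exists does not depend on \<open>b\<close>, so each
      coordinate is either the action of one fixed \<open>d\<close> or trivial.\<close>
    have k_hom: "(\<lambda>b. \<beta> z g b k) \<in> hom (val M z) (val M (src C k))" if k: "k \<in> K" for k
    proof (cases "\<exists>d \<in> Hom C (src C k) z. ?c (env_map C k) g = env_map C d")
      case True
      then obtain d where d: "d \<in> Hom C (src C k) z" "?c (env_map C k) g = env_map C d" by blast
      then have "\<beta> z g b k = act M d b" for b using \<beta>_eq k K by blast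
      then show ?thesis using M.act_hom[OF d(1)] by simp
    next
      case False
      then show ?thesis using k Kgr'[OF k]
        by (auto simp: \<beta>_def hom_def group.is_monoid monoid.one_closed monoid.l_one)
    qed
    have ext: "\<beta> z g b \<in> extensional K" for b by (simp add: \<beta>_def)
    show ?thesis
    proof (rule homI)
      show "\<beta> z g b \<in> carrier Pr" if "b \<in> carrier (val M z)" for b
        using hom_in_carrier[OF k_hom that] ext by (auto simp: Pr_def PiE_iff)
      fix b b' assume b: "b \<in> carrier (val M z)" "b' \<in> carrier (val M z)"
      show "\<beta> z g (b \<otimes>\<^bsub>val M z\<^esub> b') = \<beta> z g b \<otimes>\<^bsub>Pr\<^esub> \<beta> z g b'"
        by (rule extensionalityI[OF ext]) (use hom_mult[OF k_hom b] in \<open>auto simp: Pr_def\<close>)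
    qed
  qed
  obtain h where h: "h \<in> hom (tensor C (free_hom_module C x) M) (Pr Mod N)"
    "\<And>z g b. \<lbrakk>g \<in> Hom (env_groupoid C) x z; b \<in> carrier (val M z)\<rbrakk> \<Longrightarrow> h (ind_tens M x z g b) = N #>\<^bsub>Pr\<^esub> \<beta> z g b"
  proof (rule induced_lift[OF M x D, of "\<lambda>z g b. N #>\<^bsub>Pr\<^esub> \<beta> z g b"])
    show "(\<lambda>b. N #>\<^bsub>Pr\<^esub> \<beta> z g b) \<in> hom (val M z) (Pr Mod N)" if "g \<in> Hom (env_groupoid C) x z" for z g
      using hom_compose[OF \<beta>_hom proj(1)] by (simp add: comp_def)
  next
    fix z z' g d b assume g: "g \<in> Hom (env_groupoid C) x z" and d: "d \<in> Hom C z z'" and b: "b \<in> carrier (val M z')"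
    \<comment> \<open>Over the left multiples \<open>u h\<close> of a denominator of
      \<open>g\<close>, both sides are computed by explicit numerators: \<open>u e\<close> for
      \<open>g\<close> and \<open>u e d\<close> for its composite with \<open>d\<close>.\<close>
    obtain v h e where h: "h \<in> Hom C v x" "e \<in> Hom C v z" "?c (env_map C h) g = env_map C e"
      by (rule env_numerator[OF g])
    have gd: "?c g (env_map C d) \<in> Hom (env_groupoid C) x z'" by (rule E.cmp_Hom[OF g I.map_Hom[OF d]])
    have ed: "?c (env_map C h) (?c g (env_map C d)) = env_map C (cmp C e d)"
      using E.cmp_assoc[OF I.map_Hom[OF h(1)] g I.map_Hom[OF d]] h(3) I.map_cmp[OF h(2) d] by simp
    show "N #>\<^bsub>Pr\<^esub> \<beta> z' (?c g (env_map C d)) b = N #>\<^bsub>Pr\<^esub> \<beta> z g (act M d b)"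
    proof (rule germ_eq[OF hom_in_carrier[OF \<beta>_hom b] hom_in_carrier[OF \<beta>_hom hom_in_carrier[OF M.act_hom[OF d] b]] h(1)])
      fix v' u assume u: "u \<in> Hom C v' v"
      have "\<beta> z' (?c g (env_map C d)) b (cmp C u h) = act M (cmp C u (cmp C e d)) b"
        by (rule \<beta>_eq[OF cmp_Hom[OF u h(1)] cmp_Hom[OF u cmp_Hom[OF h(2) d]]
              env_numerator_cmp[OF h(1) cmp_Hom[OF h(2) d] gd ed u]])
      also have "\<dots> = act M (cmp C u e) (act M d b)"
        using cmp_assoc[OF u h(2) d] M.act_cmp[OF cmp_Hom[OF u h(2)] d b] by simp
      also have "\<dots> = \<beta> z g (act M d b) (cmp C u h)"
        by (rule \<beta>_eq[OF cmp_Hom[OF u h(1)] cmp_Hom[OF u h(2)] env_numerator_cmp[OF h(1,2) g h(3) u], symmetric])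
      finally show "\<beta> z' (?c g (env_map C d)) b (cmp C u h) = \<beta> z g (act M d b) (cmp C u h)" .
    qed
  qed (rule that)
  have "N #>\<^bsub>Pr\<^esub> \<beta> w (env_inv f) a = \<one>\<^bsub>Pr Mod N\<^esub>"
    using h(2)[OF env_inv_Hom[OF f] a] 1 hom_one[OF h(1) group_tensor[OF right_module_free_hom[OF x] M] D.is_group] by simp
  then have "\<beta> w (env_inv f) a \<in> N" by (rule proj(3)[OF hom_in_carrier[OF \<beta>_hom a]])
  then obtain v h0 where h0: "h0 \<in> Hom C v x" "\<And>v' u. u \<in> Hom C v' v \<Longrightarrow> \<beta> w (env_inv f) a (cmp C u h0) = \<one>\<^bsub>val M v'\<^esub>"
    unfolding N_def by blast
  \<comment> \<open>A common left multiple of \<open>f\<close> and \<open>h0\<close> lies where the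
    function is known to be trivial, and there \<open>u f\<close> followed by the inverse of
    \<open>f\<close> has the numerator \<open>u\<close>, so the value of the function is also that
    of \<open>u\<close> acting on \<open>a\<close>.\<close>
  obtain s u u0 where u: "u \<in> Hom C s w" "u0 \<in> Hom C s v" "cmp C u f = cmp C u0 h0"
    using common_left_multiple[OF f h0(1)] by blast
  have "?c (env_map C (cmp C u f)) (env_inv f) = env_map C u"
    using E.cmp_assoc[OF I.map_Hom[OF u(1)] I.map_Hom[OF f] env_inv_Hom[OF f]] I.map_cmp[OF u(1) f]
      env_inv_right[OF f] E.idn_right[OF I.map_Hom[OF u(1)]] by simp
  from \<beta>_eq[OF cmp_Hom[OF u(1) f] u(1) this, of a]
  have "act M u a = \<one>\<^bsub>val M s\<^esub>" using h0(2)[OF u(2)] u(3) by simp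
  then show ?thesis using u(1) by blast
qed

end

text \<open>An element of the kernel is a single fraction with numerator \<open>a\<close>; since its
  image is trivial, some \<open>u\<close> makes \<open>\<nu>\<close> trivial on
  \<open>act M u a\<close>. Exactness at the source of \<open>u\<close> provides a preimage of
  \<open>act M u a\<close>, and the fraction is rewritten with the denominator
  \<open>u f\<close>.\<close>

lemma induced_exact:
  assumes L: "left_module C L" and M: "left_module C M" and N: "left_module C N"
    and \<mu>: "module_hom C L M \<mu>" and \<nu>: "module_hom C M N \<nu>"
    and ex: "\<And>x. x \<in> obj C \<Longrightarrow> \<mu> x ` carrier (val L x) = kernel (val M x) (val N x) (\<nu> x)" and x: "x \<in> obj C"
  shows "ind_map M \<mu> x ` carrier (val (induced_module C L) x) =
    kernel (val (induced_module C M) x) (val (induced_module C N) x) (ind_map N \<nu> x)"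
proof -
  have vL: "val (induced_module C L) x = tensor C (free_hom_module C x) L"
    and vM: "val (induced_module C M) x = tensor C (free_hom_module C x) M"
    and vN: "val (induced_module C N) x = tensor C (free_hom_module C x) N" by (simp_all add: induced_module_def)
  note closed = module_hom_closed[OF ind_map_hom[OF L M \<mu>], of x, unfolded vL vM]
  interpret M: left_module C M by fact
  interpret N: left_module C N by (rule N)
  note R = right_module_free_hom[OF x]
  show ?thesis unfolding vL vM vN
  proof (intro equalityI subsetI)
    fix Y assume "Y \<in> ind_map M \<mu> x ` carrier (tensor C (free_hom_module C x) L)"
    then obtain X where X: "X \<in> carrier (tensor C (free_hom_module C x) L)" "Y = ind_map M \<mu> x X" by blast
    obtain w f a where f: "f \<in> Hom C w x" "a \<in> carrier (val L w)" "X = ind_tens L x w (env_inv f) a"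
      by (rule induced_fraction[OF L x X(1)])
    have w: "w \<in> obj C" using Hom_obj[OF f(1)] by simp
    have ma: "\<mu> w a \<in> carrier (val M w)" by (rule module_hom_closed[OF \<mu> w f(2)])
    have "\<nu> w (\<mu> w a) = \<one>\<^bsub>val N w\<^esub>" using ex[OF w] f(2) by (auto simp: kernel_def)
    then have "ind_map N \<nu> x Y = \<one>\<^bsub>tensor C (free_hom_module C x) N\<^esub>"
      using ind_map_tens[OF L M \<mu> env_inv_Hom[OF f(1)] f(2)] ind_map_tens[OF M N \<nu> env_inv_Hom[OF f(1)] ma] f(3) X(2)
        tens_one_right[OF R N w frag_of_free_hom[OF env_inv_Hom[OF f(1)]]] by simp
    moreover have "Y \<in> carrier (tensor C (free_hom_module C x) M)" using closed X x by simp
    ultimately show "Y \<in> kernel (tensor C (free_hom_module C x) M) (tensor C (free_hom_module C x) N) (ind_map N \<nu> x)"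
      by (simp add: kernel_def)
  next
    fix Y assume "Y \<in> kernel (tensor C (free_hom_module C x) M) (tensor C (free_hom_module C x) N) (ind_map N \<nu> x)"
    then have Y: "Y \<in> carrier (tensor C (free_hom_module C x) M)" "ind_map N \<nu> x Y = \<one>\<^bsub>tensor C (free_hom_module C x) N\<^esub>"
      by (auto simp: kernel_def)
    obtain w f a where f: "f \<in> Hom C w x" "a \<in> carrier (val M w)" "Y = ind_tens M x w (env_inv f) a"
      by (rule induced_fraction[OF M x Y(1)])
    have w: "w \<in> obj C" using Hom_obj[OF f(1)] by simp
    have "ind_tens N x w (env_inv f) (\<nu> w a) = \<one>\<^bsub>tensor C (free_hom_module C x) N\<^esub>"
      using Y(2) ind_map_tens[OF M N \<nu> env_inv_Hom[OF f(1)] f(2)] f(3) by simp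
    from fraction_trivial[OF N f(1) module_hom_closed[OF \<nu> w f(2)] this]
    obtain v u where u: "u \<in> Hom C v w" "act N u (\<nu> w a) = \<one>\<^bsub>val N v\<^esub>" by blast
    have v: "v \<in> obj C" using Hom_obj[OF u(1)] by simp
    have ua: "act M u a \<in> carrier (val M v)" by (rule hom_in_carrier[OF M.act_hom[OF u(1)] f(2)])
    have "\<nu> v (act M u a) = \<one>\<^bsub>val N v\<^esub>" using \<nu> u f(2) by (simp add: module_hom_def)
    then have "act M u a \<in> \<mu> v ` carrier (val L v)" unfolding ex[OF v] using ua by (simp add: kernel_def)
    then obtain c where c: "c \<in> carrier (val L v)" "act M u a = \<mu> v c" by blast
    note uf = cmp_Hom[OF u(1) f(1)]
    have "Y = ind_map M \<mu> x (ind_tens L x v (env_inv (cmp C u f)) c)"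
      using fraction_expand[OF M u(1) f(1,2)] ind_map_tens[OF L M \<mu> env_inv_Hom[OF uf] c(1)] c(2) f(3) by simp
    then show "Y \<in> ind_map M \<mu> x ` carrier (tensor C (free_hom_module C x) L)"
      using ind_tens_closed[OF L env_inv_Hom[OF uf] c(1)] by blast
  qed
qed

lemma induced_epi:
  assumes L: "left_module C L" and M: "left_module C M" and \<mu>: "module_epi C L M \<mu>"
  shows "module_epi (env_groupoid C) (induced_module C L) (induced_module C M) (ind_map M \<mu>)"
proof -
  have \<mu>h: "module_hom C L M \<mu>" using \<mu> by (simp add: module_epi_def)
  note hom = ind_map_hom[OF L M \<mu>h]
  have "ind_map M \<mu> x ` carrier (val (induced_module C L) x) = carrier (val (induced_module C M) x)" if x: "x \<in> obj C" for x
  proof (intro equalityI subsetI)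
    fix Y assume "Y \<in> ind_map M \<mu> x ` carrier (val (induced_module C L) x)"
    then show "Y \<in> carrier (val (induced_module C M) x)" using module_hom_closed[OF hom] x by auto
  next
    fix Y assume "Y \<in> carrier (val (induced_module C M) x)"
    then have Y: "Y \<in> carrier (tensor C (free_hom_module C x) M)" by (simp add: induced_module_def)
    obtain w f a where f: "f \<in> Hom C w x" "a \<in> carrier (val M w)" "Y = ind_tens M x w (env_inv f) a"
      by (rule induced_fraction[OF M x Y])
    have "a \<in> \<mu> w ` carrier (val L w)" using \<mu> Hom_obj[OF f(1)] f(2) by (simp add: module_epi_def)
    then obtain c where c: "c \<in> carrier (val L w)" "a = \<mu> w c" by blast
    have "Y = ind_map M \<mu> x (ind_tens L x w (env_inv f) c)"
      using ind_map_tens[OF L M \<mu>h env_inv_Hom[OF f(1)] c(1)] f(3) c(2) by simp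
    then show "Y \<in> ind_map M \<mu> x ` carrier (val (induced_module C L) x)"
      using ind_tens_closed[OF L env_inv_Hom[OF f(1)] c(1)] by (simp add: induced_module_def)
  qed
  with hom show ?thesis by (simp add: module_epi_def)
qed

lemma induced_resolution:
  assumes P: "resolution C M P \<delta> \<epsilon>"
  shows "resolution (env_groupoid C) (induced_module C M) (\<lambda>n. induced_module C (P n))
     (\<lambda>n. ind_map (P n) (\<delta> n)) (ind_map M \<epsilon>)"
proof -
  note p = resolutionD[OF P]
  have "module_epi C (P 0) M \<epsilon>" using P by (simp add: resolution_def)
  moreover have "\<delta> 0 x ` carrier (val (P (Suc 0)) x) = kernel (val (P 0) x) (val M x) (\<epsilon> x)"
    "\<delta> (Suc n) x ` carrier (val (P (Suc (Suc n))) x) = kernel (val (P (Suc n)) x) (val (P n) x) (\<delta> n x)"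
    if "x \<in> obj C" for n x using P that by (simp_all add: resolution_def)
  ultimately show ?thesis
    unfolding resolution_def
    using left_module_induced[OF p(1)] left_module_induced[OF p(2)] ind_map_hom[OF p(2,2,3)] induced_epi[OF p(2,1)]
      induced_exact[OF p(2,2,1) p(3,4)] induced_exact[OF p(2,2,2) p(3,3)] by simp
qed

end

section \<open>Lifting properties\<close>

text \<open>Corestricting \<open>h\<close> to this submodule makes it an epimorphism, the form in
  which projectivity can be applied.\<close>

definition image_module ::
  "('o, 'm, 'a) cmod \<Rightarrow> ('o, 'm, 'b) cmod \<Rightarrow> ('o \<Rightarrow> 'a \<Rightarrow> 'b) \<Rightarrow> ('o, 'm, 'b) cmod"
  where "image_module A B h = \<lparr>val = (\<lambda>x. (val B x)\<lparr>carrier := h x ` carrier (val A x)\<rparr>), act = act B\<rparr>"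

lemma left_module_image:
  assumes A: "left_module C A" and B: "left_module C B" and h: "module_hom C A B h"
  shows "left_module C (image_module A B h)"
proof -
  interpret A: left_module C A by (rule A)
  interpret B: left_module C B by (rule B)
  have carr: "h x a \<in> carrier (val B x)" if "x \<in> obj C" "a \<in> carrier (val A x)" for x a
    by (rule module_hom_closed[OF h that])
  show ?thesis
  proof (intro left_module.intro left_module_axioms.intro)
    fix x assume x: "x \<in> obj C"
    have "subgroup (h x ` carrier (val A x)) (val B x)"
      using group_hom.img_is_subgroup[OF module_hom_group_hom[OF A B h x]] .
    then show "comm_group (val (image_module A B h) x)"
      using comm_group_restrict[OF B.val_comm_group[OF x]] by (simp add: image_module_def)
  next
    fix f x y assume f: "f \<in> Hom C x y"
    have xy: "x \<in> obj C" "y \<in> obj C" using A.Hom_obj[OF f] by auto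
    have im: "act B f (h y a) \<in> h x ` carrier (val A x)" if "a \<in> carrier (val A y)" for a
    proof -
      have "act B f (h y a) = h x (act A f a)" using h f that by (simp add: module_hom_def)
      then show ?thesis using hom_in_carrier[OF A.act_hom[OF f] that] by blast
    qed
    then show "act (image_module A B h) f \<in> hom (val (image_module A B h) y) (val (image_module A B h) x)"
      using hom_mult[OF B.act_hom[OF f]] carr[OF xy(2)] by (auto simp: image_module_def hom_def)
  next
    fix f g x y z a assume f: "f \<in> Hom C x y" and g: "g \<in> Hom C y z" and "a \<in> carrier (val (image_module A B h) z)"
    then have "a \<in> carrier (val B z)" using carr A.Hom_obj[OF g] by (auto simp: image_module_def)
    then show "act (image_module A B h) (cmp C f g) a = act (image_module A B h) f (act (image_module A B h) g a)"
      using B.act_cmp[OF f g] by (simp add: image_module_def)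
  qed (use A.category_axioms B.act_idn carr in \<open>auto simp: image_module_def\<close>)
qed

text \<open>\<open>projective_lift\<close> has already removed the bound on element types, so the
  property holds against modules of any type; this makes it usable for restrictions of groupoid
  modules.\<close>

lemma projective_lifts:
  assumes P: "projective C P" and A: "left_module C A" and B: "left_module C B"
  shows "lifts C P A B"
  unfolding lifts_def
proof (intro allI impI, elim conjE)
  fix h \<theta> assume h: "module_hom C A B h" and t: "module_hom C P B \<theta>"
    and im: "\<forall>x\<in>obj C. \<theta> x ` carrier (val P x) \<subseteq> h x ` carrier (val A x)"
  have "module_epi C A (image_module A B h) h"
    using h by (auto simp: module_epi_def module_hom_def image_module_def hom_def)
  moreover have "module_hom C P (image_module A B h) \<theta>"
    using t im by (auto simp: module_hom_def image_module_def hom_def)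
  ultimately obtain \<psi> where "module_hom C P A \<psi>"
    "\<And>x a. \<lbrakk>x \<in> obj C; a \<in> carrier (val P x)\<rbrakk> \<Longrightarrow> h x (\<psi> x a) = \<theta> x a"
    by (rule projective_lift[OF P A left_module_image[OF A B h]]) (rule that)
  then show "\<exists>\<psi>. module_hom C P A \<psi> \<and> (\<forall>x\<in>obj C. \<forall>a\<in>carrier (val P x). h x (\<psi> x a) = \<theta> x a)" by blast
qed

lemma projective_resolution_resolution:
  assumes "left_module C M" "projective_resolution C M P \<delta> \<epsilon>"
  shows "resolution C M P \<delta> \<epsilon>"
  using assms unfolding resolution_def projective_resolution_def projective_def by auto

lemma module_hom_restrict:
  assumes "cat_functor A B Fo Fm" "module_hom B M N \<theta>"
  shows "module_hom A (restrict_module Fo Fm M) (restrict_module Fo Fm N) (\<lambda>x. \<theta> (Fo x))"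
proof -
  interpret cat_functor A B Fo Fm by fact
  show ?thesis using assms(2) map_Hom map_obj by (auto simp: module_hom_def restrict_module_def)
qed

text \<open>The problem is restricted along the unit, solved over \<open>C\<close>, and the solution
  is extended by \<open>induced_extend\<close>. That the extension still solves it is checked on
  fractions, which are groupoid translates of the image of the unit.\<close>

lemma (in left_ore) induced_lifts:
  assumes P: "left_module C P" and A: "left_module (env_groupoid C) A" and B: "left_module (env_groupoid C) B"
    and l: "lifts C P (restrict_module (\<lambda>x. x) (env_map C) A) (restrict_module (\<lambda>x. x) (env_map C) B)"
  shows "lifts (env_groupoid C) (induced_module C P) A B"
  unfolding lifts_def
proof (intro allI impI, elim conjE)
  interpret E: category "env_groupoid C" by (rule category_env)
  interpret B: left_module "env_groupoid C" B by (rule B)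
  fix h \<theta> assume h: "module_hom (env_groupoid C) A B h" and t: "module_hom (env_groupoid C) (induced_module C P) B \<theta>"
    and im: "\<forall>x\<in>obj (env_groupoid C). \<theta> x ` carrier (val (induced_module C P) x) \<subseteq> h x ` carrier (val A x)"
  let ?r = "restrict_module (\<lambda>x. x) (env_map C)"
  note u = ind_unit_hom[OF P]
  have uc: "ind_unit P x b \<in> carrier (val (induced_module C P) x)" if "x \<in> obj C" "b \<in> carrier (val P x)" for x b
    using module_hom_closed[OF u that] by (simp add: restrict_module_def)
  have tu: "module_hom C P (?r B) (\<lambda>x b. \<theta> x (ind_unit P x b))"
    by (rule module_hom_compose[OF u module_hom_restrict[OF env_map_functor t] P])
  have rh: "module_hom C (?r A) (?r B) h"
    by (rule module_hom_restrict[OF env_map_functor h])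
  obtain \<psi> where psi: "module_hom C P (?r A) \<psi>"
    "\<And>x b. \<lbrakk>x \<in> obj C; b \<in> carrier (val P x)\<rbrakk> \<Longrightarrow> h x (\<psi> x b) = \<theta> x (ind_unit P x b)"
  proof (rule liftsE[OF l rh tu])
    show "\<theta> x (ind_unit P x b) \<in> h x ` carrier (val (?r A) x)" if "x \<in> obj C" "b \<in> carrier (val P x)" for x b
      using im uc[OF that] that(1) by (auto simp: restrict_module_def)
  qed (rule that)
  obtain \<Psi> where Psi: "module_hom (env_groupoid C) (induced_module C P) A \<Psi>"
    "\<And>x z g b. \<lbrakk>g \<in> Hom (env_groupoid C) x z; b \<in> carrier (val P z)\<rbrakk> \<Longrightarrow> \<Psi> x (ind_tens P x z g b) = act A g (\<psi> z b)"
    by (rule induced_extend[OF P A psi(1)]) (rule that)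
  have "h x (\<Psi> x X) = \<theta> x X" if x: "x \<in> obj C" and X: "X \<in> carrier (val (induced_module C P) x)" for x X
  proof -
    have X': "X \<in> carrier (tensor C (free_hom_module C x) P)" using X by (simp add: induced_module_def)
    obtain w f a where f: "f \<in> Hom C w x" "a \<in> carrier (val P w)" "X = ind_tens P x w (env_inv f) a"
      by (rule induced_fraction[OF P x X'])
    have w: "w \<in> obj C" using Hom_obj[OF f(1)] by simp
    note i = env_inv_Hom[OF f(1)]
    have "\<psi> w a \<in> carrier (val A w)" using module_hom_closed[OF psi(1) w f(2)] by (simp add: restrict_module_def)
    then have "h x (\<Psi> x X) = act B (env_inv f) (h w (\<psi> w a))"
      using h i Psi(2)[OF i f(2)] f(3) by (simp add: module_hom_def)
    also have "\<dots> = act B (env_inv f) (\<theta> w (ind_unit P w a))" using psi(2)[OF w f(2)] by simp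
    also have "\<dots> = \<theta> x (act (induced_module C P) (env_inv f) (ind_unit P w a))"
      using t i uc[OF w f(2)] by (simp add: module_hom_def)
    finally show ?thesis using ind_tens_unit[OF P i f(2)] f(3) by simp
  qed
  then show "\<exists>\<psi>. module_hom (env_groupoid C) (induced_module C P) A \<psi> \<and>
    (\<forall>x\<in>obj (env_groupoid C). \<forall>a\<in>carrier (val (induced_module C P) x). h x (\<psi> x a) = \<theta> x a)"
    using Psi(1) by auto
qed

section \<open>Coinvariants\<close>

definition const_module :: "'t monoid \<Rightarrow> ('o, 'm, 't) cmod"
  where "const_module T = \<lparr>val = (\<lambda>_. T), act = (\<lambda>_ a. a)\<rparr>"

lemma left_module_const: "\<lbrakk>category C; comm_group T\<rbrakk> \<Longrightarrow> left_module C (const_module T)"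
  by (intro left_module.intro left_module_axioms.intro) (auto simp: const_module_def hom_def)

text \<open>The universal homomorphism from \<open>P\<close> to a constant module.\<close>

definition coinv :: "('o, 'm) cat \<Rightarrow> ('o, 'm, 'a) cmod \<Rightarrow> 'o \<Rightarrow> 'a \<Rightarrow> ('o \<Rightarrow> (int \<times> 'a \<Rightarrow>\<^sub>0 int) set) set"
  where "coinv C P z b = tens C trivial_module P z 1 b"

context
  fixes C :: "('o, 'm) cat" and P :: "('o, 'm, 'a) cmod"
  assumes P: "left_module C P"
begin

interpretation P: left_module C P by (rule P)

lemma right_module_trivial_over: "right_module C trivial_module"
  by (rule right_module_trivial[OF P.category_axioms])

lemma trivial_carrier: "(n :: int) \<in> carrier (val trivial_module z)"
  by (simp add: trivial_module_def)

lemma coinv_hom: "module_hom C P (const_module (tensor C trivial_module P)) (coinv C P)"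
proof -
  have "coinv C P z \<in> hom (val P z) (tensor C trivial_module P)" if "z \<in> obj C" for z
    unfolding coinv_def by (rule tens_hom_right[OF right_module_trivial_over P that trivial_carrier])
  moreover have "coinv C P x (act P f b) = coinv C P y b" if "f \<in> Hom C x y" "b \<in> carrier (val P y)" for f x y b
    using tens_balanced[OF right_module_trivial_over P that(1) trivial_carrier that(2), of 1]
    by (simp add: coinv_def trivial_module_def)
  ultimately show ?thesis by (simp add: module_hom_def const_module_def)
qed

lemma coinv_closed: "\<lbrakk>z \<in> obj C; b \<in> carrier (val P z)\<rbrakk> \<Longrightarrow> coinv C P z b \<in> carrier (tensor C trivial_module P)"
  using module_hom_closed[OF coinv_hom] by (simp add: const_module_def)

text \<open>The integers are generated by 1, so linearity in the left factor expresses every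
  elementary tensor through \<open>coinv\<close>.\<close>

lemma tens_trivial:
  assumes z: "z \<in> obj C" and b: "b \<in> carrier (val P z)"
  shows "tens C trivial_module P z n b = coinv C P z b [^]\<^bsub>tensor C trivial_module P\<^esub> n"
proof -
  have "(\<lambda>n. tens C trivial_module P z n b) \<in> hom integer_group (tensor C trivial_module P)"
    using tens_hom_left[OF right_module_trivial_over P z b] by (simp add: trivial_module_def)
  from hom_int_pow[OF this, of 1 n] show ?thesis
    using group_tensor[OF right_module_trivial_over P] by (simp add: coinv_def)
qed

lemma coinv_hom_eqI:
  assumes h: "h \<in> hom (tensor C trivial_module P) T" and k: "k \<in> hom (tensor C trivial_module P) T" and T: "group T"
    and eq: "\<And>z b. \<lbrakk>z \<in> obj C; b \<in> carrier (val P z)\<rbrakk> \<Longrightarrow> h (coinv C P z b) = k (coinv C P z b)"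
    and X: "X \<in> carrier (tensor C trivial_module P)"
  shows "h X = k X"
proof (rule tensor_hom_eqI[OF right_module_trivial_over P h k T _ X])
  fix z n b assume z: "z \<in> obj C" and b: "b \<in> carrier (val P z)"
  show "h (tens C trivial_module P z n b) = k (tens C trivial_module P z n b)"
    unfolding tens_trivial[OF z b] using eq[OF z b] coinv_closed[OF z b] group_tensor[OF right_module_trivial_over P]
    by (simp add: hom_int_pow[OF h] hom_int_pow[OF k] T)
qed

lemma coinv_lift:
  assumes T: "comm_group T" and \<theta>: "module_hom C P (const_module T) \<theta>"
  obtains h where "h \<in> hom (tensor C trivial_module P) T"
    "\<And>z b. \<lbrakk>z \<in> obj C; b \<in> carrier (val P z)\<rbrakk> \<Longrightarrow> h (coinv C P z b) = \<theta> z b"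
proof -
  interpret T: comm_group T by fact
  have c: "\<theta> z b \<in> carrier T" if "z \<in> obj C" "b \<in> carrier (val P z)" for z b
    using module_hom_closed[OF \<theta> that] by (simp add: const_module_def)
  have m: "\<theta> z (b \<otimes>\<^bsub>val P z\<^esub> b') = \<theta> z b \<otimes>\<^bsub>T\<^esub> \<theta> z b'"
    if "z \<in> obj C" "b \<in> carrier (val P z)" "b' \<in> carrier (val P z)" for z b b'
    using \<theta> that by (simp add: module_hom_def const_module_def hom_def)
  obtain h where h: "h \<in> hom (tensor C trivial_module P) T"
    "\<And>z n b. \<lbrakk>z \<in> obj C; n \<in> carrier (val trivial_module z); b \<in> carrier (val P z)\<rbrakk>
      \<Longrightarrow> h (tens C trivial_module P z n b) = \<theta> z b [^]\<^bsub>T\<^esub> n"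
  \<comment> \<open>The integer factor acts by powers; balancing is the invariance of
    \<open>\<theta>\<close>, as its target is constant.\<close>
  proof (rule tensor_lift[OF right_module_trivial_over P T, of "\<lambda>z n b. \<theta> z b [^]\<^bsub>T\<^esub> n"])
    show "\<theta> z' b [^]\<^bsub>T\<^esub> act trivial_module d a = \<theta> z (act P d b) [^]\<^bsub>T\<^esub> a"
      if "d \<in> Hom C z z'" "b \<in> carrier (val P z')" for d z z' a b
      using \<theta> that by (simp add: module_hom_def const_module_def trivial_module_def)
  qed (use c m in \<open>auto simp: trivial_module_def T.int_pow_mult T.int_pow_distrib intro: that\<close>)
  show thesis
  proof (rule that[OF h(1)])
    show "h (coinv C P z b) = \<theta> z b" if "z \<in> obj C" "b \<in> carrier (val P z)" for z b
      unfolding coinv_def using h(2)[OF that(1) trivial_carrier that(2), of 1] c[OF that] by simp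
  qed
qed

end

lemma tensor_map_coinv:
  assumes P: "left_module C P" and Q: "left_module C Q" and \<mu>: "module_hom C P Q \<mu>"
    and "z \<in> obj C" "b \<in> carrier (val P z)"
  shows "tensor_map C trivial_module Q (\<lambda>_ r. r) \<mu> (coinv C P z b) = coinv C Q z (\<mu> z b)"
  unfolding coinv_def
  by (rule tensor_map_tens[OF right_module_trivial_over[OF P] P right_module_trivial_over[OF P] Q right_module_hom_id \<mu>
      assms(4) trivial_carrier[OF P] assms(5)])

lemma restrict_const: "restrict_module Fo Fm (const_module T) = const_module T"
  by (simp add: restrict_module_def const_module_def)

text \<open>\<open>\<eta>\<close> and \<open>\<Theta>\<close> induce homomorphisms between the
  coinvariants in opposite directions. One composite is the identity by
  \<open>\<Theta>\<eta>\<close>, the other because by \<open>gen\<close> the classes coming from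
  \<open>P\<close> already give all generators. Used with the unit for induction and with the
  identity for restriction.\<close>

lemma coinvariants_iso:
  assumes F: "cat_functor C D Fo Fm" and P: "left_module C P" and Q: "left_module D Q"
    and \<eta>: "module_hom C P (restrict_module Fo Fm Q) \<eta>"
    and \<Theta>: "module_hom D Q (const_module (tensor C trivial_module P)) \<Theta>"
    and \<Theta>\<eta>: "\<And>z b. \<lbrakk>z \<in> obj C; b \<in> carrier (val P z)\<rbrakk> \<Longrightarrow> \<Theta> (Fo z) (\<eta> z b) = coinv C P z b"
    and gen: "\<And>x a. \<lbrakk>x \<in> obj D; a \<in> carrier (val Q x)\<rbrakk>
      \<Longrightarrow> \<exists>z \<in> obj C. \<exists>b \<in> carrier (val P z). coinv D Q x a = coinv D Q (Fo z) (\<eta> z b)"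
  shows "\<exists>f \<in> iso (tensor C trivial_module P) (tensor D trivial_module Q).
    \<forall>z \<in> obj C. \<forall>b \<in> carrier (val P z). f (coinv C P z b) = coinv D Q (Fo z) (\<eta> z b)"
proof -
  interpret F: cat_functor C D Fo Fm by fact
  let ?S = "tensor C trivial_module P" and ?T = "tensor D trivial_module Q"
  have S: "comm_group ?S" by (rule comm_group_tensor[OF right_module_trivial_over[OF P] P])
  have T: "comm_group ?T" by (rule comm_group_tensor[OF right_module_trivial_over[OF Q] Q])
  have gr: "group ?S" "group ?T" using S T by (simp_all add: comm_group_def)
  have \<eta>c: "\<eta> z b \<in> carrier (val Q (Fo z))" if "z \<in> obj C" "b \<in> carrier (val P z)" for z b
    using module_hom_closed[OF \<eta> that] by (simp add: restrict_module_def)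
  have "module_hom C P (const_module ?T) (\<lambda>z b. coinv D Q (Fo z) (\<eta> z b))"
    using module_hom_compose[OF \<eta> module_hom_restrict[OF F coinv_hom[OF Q]] P] by (simp add: restrict_const)
  then obtain f where f: "f \<in> hom ?S ?T"
    "\<And>z b. \<lbrakk>z \<in> obj C; b \<in> carrier (val P z)\<rbrakk> \<Longrightarrow> f (coinv C P z b) = coinv D Q (Fo z) (\<eta> z b)"
    by (rule coinv_lift[OF P T]) (rule that)
  obtain g where g: "g \<in> hom ?T ?S"
    "\<And>x a. \<lbrakk>x \<in> obj D; a \<in> carrier (val Q x)\<rbrakk> \<Longrightarrow> g (coinv D Q x a) = \<Theta> x a"
    by (rule coinv_lift[OF Q S \<Theta>]) (rule that)
  have gf: "(g \<circ> f) X = id X" if "X \<in> carrier ?S" for X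
    by (rule coinv_hom_eqI[OF P hom_compose[OF f(1) g(1)] _ gr(1) _ that])
      (auto simp: f(2) g(2) F.map_obj \<eta>c \<Theta>\<eta> id_def hom_def)
  have fg: "(f \<circ> g) X = id X" if "X \<in> carrier ?T" for X
  proof (rule coinv_hom_eqI[OF Q hom_compose[OF g(1) f(1)] _ gr(2) _ that])
    fix x a assume x: "x \<in> obj D" and a: "a \<in> carrier (val Q x)"
    obtain z b where z: "z \<in> obj C" "b \<in> carrier (val P z)" "coinv D Q x a = coinv D Q (Fo z) (\<eta> z b)"
      using gen[OF x a] by blast
    show "(f \<circ> g) (coinv D Q x a) = id (coinv D Q x a)"
      unfolding z(3) using z(1,2) by (simp add: f(2) g(2) F.map_obj \<eta>c \<Theta>\<eta>)
  qed (auto simp: hom_def)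
  have "bij_betw f (carrier ?S) (carrier ?T)"
    by (rule bij_betw_byWitness[where f'=g]) (use f(1) g(1) gf fg in \<open>auto simp: hom_def\<close>)
  then show ?thesis using f by (intro bexI[of _ f]) (auto simp: iso_def)
qed

section \<open>From isomorphic coinvariants to isomorphic homology\<close>

lemma homology_iso_of_isos:
  assumes A: "chain_complex A d" and B: "chain_complex B e"
    and F: "\<And>n. F n \<in> iso (A n) (B n)" "\<And>n a. a \<in> carrier (A (Suc n)) \<Longrightarrow> F n (d n a) = e n (F (Suc n) a)"
  shows "homology_group A d n \<cong> homology_group B e n" and "homology_group B e n \<cong> homology_group A d n"
proof -
  have gr: "group (A n)" "group (B n)" for n
    using A B by (simp_all add: chain_complex_def comm_group_def)
  define G where "G n = inv_into (carrier (A n)) (F n)" for n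
  have G: "G n \<in> iso (B n) (A n)" for n
    unfolding G_def by (rule group.iso_set_sym[OF gr(1) F(1)])
  have bij: "bij_betw (F n) (carrier (A n)) (carrier (B n))" for n using F(1) by (simp add: iso_def)
  have GF: "G n (F n a) = a" if "a \<in> carrier (A n)" for n a
    unfolding G_def using bij_betw_inv_into_left[OF bij that] .
  have FG: "F n (G n b) = b" if "b \<in> carrier (B n)" for n b
    unfolding G_def using bij_betw_inv_into_right[OF bij that] .
  have Fc: "F n a \<in> carrier (B n)" if "a \<in> carrier (A n)" for n a using F(1) that by (auto simp: iso_def hom_def)
  have Gc: "G n b \<in> carrier (A n)" if "b \<in> carrier (B n)" for n b using G that by (auto simp: iso_def hom_def)
  have dc: "d n a \<in> carrier (A n)" if "a \<in> carrier (A (Suc n))" for n a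
    using A that by (auto simp: chain_complex_def hom_def)
  have Fm: "chain_map A d B e F" using F by (simp add: chain_map_def iso_def)
  have "G n (e n b) = d n (G (Suc n) b)" if b: "b \<in> carrier (B (Suc n))" for n b
  proof -
    have "G n (e n b) = G n (F n (d n (G (Suc n) b)))" using F(2)[OF Gc[OF b]] FG[OF b] by simp
    then show ?thesis using GF[OF dc[OF Gc[OF b]]] by simp
  qed
  then have Gm: "chain_map B e A d G" using G by (simp add: chain_map_def iso_def)
  have carr: "a \<in> carrier (A n)" if "a \<in> cycles A d n" for A :: "nat \<Rightarrow> 'x monoid" and d n a
    using that by (cases n) (auto simp: kernel_def)
  \<comment> \<open>\<open>homology_iso\<close> asks for a correcting boundary; here it is the
    boundary of the unit.\<close>
  have triv: "\<exists>c \<in> carrier (A (Suc n)). a = a \<otimes>\<^bsub>A n\<^esub> d n c"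
    if "chain_complex A d" "a \<in> carrier (A n)" for A :: "nat \<Rightarrow> 'x monoid" and d n a
  proof -
    interpret group_hom "A (Suc n)" "A n" "d n" by (rule chain_complex_group_hom[OF that(1)])
    show ?thesis using that(2) by (intro bexI[of _ "\<one>\<^bsub>A (Suc n)\<^esub>"]) simp_all
  qed
  show "homology_group A d n \<cong> homology_group B e n"
    by (rule homology_iso[OF A B Fm Gm]) (simp_all add: GF FG carr triv[OF A] triv[OF B])
  show "homology_group B e n \<cong> homology_group A d n"
    by (rule homology_iso[OF B A Gm Fm]) (simp_all add: GF FG carr triv[OF A] triv[OF B])
qed

abbreviation coinv_homology ::
  "('o, 'm) cat \<Rightarrow> (nat \<Rightarrow> ('o, 'm, 'p) cmod) \<Rightarrow> (nat \<Rightarrow> 'o \<Rightarrow> 'p \<Rightarrow> 'p) \<Rightarrow> nat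
    \<Rightarrow> ('o \<Rightarrow> (int \<times> 'p \<Rightarrow>\<^sub>0 int) set) set set monoid"
  where "coinv_homology C P \<delta> n \<equiv> homology_group (\<lambda>k. tensor C trivial_module (P k))
    (\<lambda>k. tensor_map C trivial_module (P k) (\<lambda>_ r. r) (\<delta> k)) n"

text \<open>The isomorphisms commute with the differentials because this can be tested on the
  classes \<open>coinv\<close>, where it is the naturality \<open>\<eta>\<delta>\<close>. Both
  directions are stated: the step to the groupoid uses one, the step to the group the other.\<close>

lemma coinvariants_homology_iso:
  assumes F: "cat_functor C D Fo Fm" and P: "resolution C M P \<delta> \<epsilon>" and Q: "resolution D N Q \<delta>' \<epsilon>'"
    and \<eta>: "\<And>n. module_hom C (P n) (restrict_module Fo Fm (Q n)) (\<eta> n)"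
    and \<eta>\<delta>: "\<And>n z b. \<lbrakk>z \<in> obj C; b \<in> carrier (val (P (Suc n)) z)\<rbrakk> \<Longrightarrow> \<eta> n z (\<delta> n z b) = \<delta>' n (Fo z) (\<eta> (Suc n) z b)"
    and iso: "\<And>n. \<exists>f \<in> iso (tensor C trivial_module (P n)) (tensor D trivial_module (Q n)).
      \<forall>z \<in> obj C. \<forall>b \<in> carrier (val (P n) z). f (coinv C (P n) z b) = coinv D (Q n) (Fo z) (\<eta> n z b)"
  shows "coinv_homology C P \<delta> n \<cong> coinv_homology D Q \<delta>' n" and "coinv_homology D Q \<delta>' n \<cong> coinv_homology C P \<delta> n"
proof -
  interpret F: cat_functor C D Fo Fm by fact
  note p = resolutionD[OF P] and q = resolutionD[OF Q]
  note RC = right_module_trivial_over[OF p(1)] and RD = right_module_trivial_over[OF q(1)]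
  have "\<forall>n. \<exists>f. f \<in> iso (tensor C trivial_module (P n)) (tensor D trivial_module (Q n)) \<and>
      (\<forall>z \<in> obj C. \<forall>b \<in> carrier (val (P n) z). f (coinv C (P n) z b) = coinv D (Q n) (Fo z) (\<eta> n z b))"
    using iso by blast
  from choice[OF this]
  obtain f where f: "\<And>n. f n \<in> iso (tensor C trivial_module (P n)) (tensor D trivial_module (Q n))"
      "\<And>n z b. \<lbrakk>z \<in> obj C; b \<in> carrier (val (P n) z)\<rbrakk> \<Longrightarrow> f n (coinv C (P n) z b) = coinv D (Q n) (Fo z) (\<eta> n z b)"
    by blast
  have fh: "f n \<in> hom (tensor C trivial_module (P n)) (tensor D trivial_module (Q n))" for n
    using f(1) by (simp add: iso_def)
  have comm: "f n (tensor_map C trivial_module (P n) (\<lambda>_ r. r) (\<delta> n) X) =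
      tensor_map D trivial_module (Q n) (\<lambda>_ r. r) (\<delta>' n) (f (Suc n) X)"
    if X: "X \<in> carrier (tensor C trivial_module (P (Suc n)))" for n X
  proof -
    have "(f n \<circ> tensor_map C trivial_module (P n) (\<lambda>_ r. r) (\<delta> n)) X =
      (tensor_map D trivial_module (Q n) (\<lambda>_ r. r) (\<delta>' n) \<circ> f (Suc n)) X"
    proof (rule coinv_hom_eqI[OF p(2) hom_compose[OF tensor_map_hom[OF RC p(2) RC p(2) right_module_hom_id p(3)] fh]
          hom_compose[OF fh tensor_map_hom[OF RD q(2) RD q(2) right_module_hom_id q(3)]] group_tensor[OF RD q(2)] _ X])
      fix z b assume z: "z \<in> obj C" and b: "b \<in> carrier (val (P (Suc n)) z)"
      have "\<eta> (Suc n) z b \<in> carrier (val (Q (Suc n)) (Fo z))"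
        using module_hom_closed[OF \<eta> z b] by (simp add: restrict_module_def)
      then show "(f n \<circ> tensor_map C trivial_module (P n) (\<lambda>_ r. r) (\<delta> n)) (coinv C (P (Suc n)) z b) =
          (tensor_map D trivial_module (Q n) (\<lambda>_ r. r) (\<delta>' n) \<circ> f (Suc n)) (coinv C (P (Suc n)) z b)"
        using tensor_map_coinv[OF p(2,2,3) z b] tensor_map_coinv[OF q(2,2,3) F.map_obj[OF z]]
          f(2)[OF z b] f(2)[OF z module_hom_closed[OF p(3) z b]] \<eta>\<delta>[OF z b] by simp
    qed
    then show ?thesis by simp
  qed
  note cx = chain_complex_tensor[OF RC P] chain_complex_tensor[OF RD Q]
  show "coinv_homology C P \<delta> n \<cong> coinv_homology D Q \<delta>' n"
    by (rule homology_iso_of_isos(1)[OF cx, where F=f]) (fact f(1) comm)+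
  show "coinv_homology D Q \<delta>' n \<cong> coinv_homology C P \<delta> n"
    by (rule homology_iso_of_isos(2)[OF cx, where F=f]) (fact f(1) comm)+
qed

text \<open>\<open>cat_homology\<close> refers to one chosen resolution with elements in
  \<open>univ\<close>. The hypotheses give the three kinds of lift that \<open>Q\<close> needs:
  against the chosen resolution, into its degree 0 over \<open>M\<close>, and against
  \<open>Q\<close> itself for the homotopy. The lifts in the other direction come from projectivity
  of the chosen resolution.\<close>

theorem resolution_computes_homology:
  fixes M :: "('o, 'm, 'a) cmod"
  assumes Q: "resolution C M Q \<delta> \<epsilon>"
    and l: "\<And>n (A :: ('o, 'm, 'a) umod) (B :: ('o, 'm, 'a) umod). \<lbrakk>left_module C A; left_module C B\<rbrakk> \<Longrightarrow> lifts C (Q n) A B"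
    and l0: "\<And>n (A :: ('o, 'm, 'a) umod). left_module C A \<Longrightarrow> lifts C (Q n) A M"
    and lQ: "\<And>n. lifts C (Q n) (Q (Suc n)) (Q n)"
  shows "coinv_homology C Q \<delta> n \<cong> cat_homology n C M"
proof -
  note q = resolutionD[OF Q]
  obtain P \<delta>' \<epsilon>' where c: "chosen_resolution C M = (P, \<delta>')" and P: "projective_resolution C M P \<delta>' \<epsilon>'"
    by (rule chosen_resolution[OF q(1)])
  have pr: "projective C (P n)" for n using P by (simp add: projective_resolution_def)
  have P': "resolution C M P \<delta>' \<epsilon>'" by (rule projective_resolution_resolution[OF q(1) P])
  note p = resolutionD[OF P']
  show ?thesis
    unfolding cat_homology_def Tor_def c prod.case
    by (rule tensor_homology_comparison[OF right_module_trivial_over[OF q(1)] Q P'])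
      (intro l l0 lQ projective_lifts pr p(1,2) q(2))+
qed

section \<open>Equivalences\<close>

lemma natural_isoD:
  assumes "natural_iso A B Fo Fm Go Gm \<eta>" "x \<in> obj A"
  shows "\<eta> x \<in> Hom B (Fo x) (Go x)"
    "\<exists>h \<in> Hom B (Go x) (Fo x). cmp B (\<eta> x) h = idn B (Fo x) \<and> cmp B h (\<eta> x) = idn B (Go x)"
  using assms by (auto simp: natural_iso_def)

text \<open>By naturality, morphisms with equal images under \<open>Hm\<close> agree after
  composition with the invertible \<open>\<eta> y\<close>. A functor isomorphic to the identity is
  thus faithful; \<open>counit_faithful\<close> treats the opposite orientation.\<close>

lemma unit_faithful:
  assumes A: "category A" and \<eta>: "natural_iso A A (\<lambda>x. x) (\<lambda>f. f) Ho Hm \<eta>"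
    and f: "f \<in> Hom A x y" "g \<in> Hom A x y" "Hm f = Hm g"
  shows "f = g"
proof -
  interpret category A by fact
  have y: "y \<in> obj A" using Hom_obj[OF f(1)] by simp
  obtain h where h: "h \<in> Hom A (Ho y) y" "cmp A (\<eta> y) h = idn A y" using natural_isoD(2)[OF \<eta> y] by blast
  note e = natural_isoD(1)[OF \<eta> y]
  have "cmp A f (\<eta> y) = cmp A g (\<eta> y)" using \<eta> f by (auto simp: natural_iso_def)
  then have "cmp A (cmp A f (\<eta> y)) h = cmp A (cmp A g (\<eta> y)) h" by simp
  then show ?thesis using cmp_assoc[OF f(1) e h(1)] cmp_assoc[OF f(2) e h(1)] h(2) idn_right f by simp
qed

lemma counit_faithful:
  assumes B: "category B" and \<epsilon>: "natural_iso B B Ho Hm (\<lambda>x. x) (\<lambda>f. f) \<epsilon>"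
    and f: "f \<in> Hom B x y" "g \<in> Hom B x y" "Hm f = Hm g"
  shows "f = g"
proof -
  interpret category B by fact
  have x: "x \<in> obj B" using Hom_obj[OF f(1)] by simp
  obtain h where h: "h \<in> Hom B x (Ho x)" "cmp B h (\<epsilon> x) = idn B x" using natural_isoD(2)[OF \<epsilon> x] by blast
  note e = natural_isoD(1)[OF \<epsilon> x]
  have "cmp B (\<epsilon> x) f = cmp B (\<epsilon> x) g" using \<epsilon> f unfolding natural_iso_def by metis
  then have "cmp B h (cmp B (\<epsilon> x) f) = cmp B h (cmp B (\<epsilon> x) g)" by simp
  then show ?thesis using cmp_assoc[OF h(1) e f(1)] cmp_assoc[OF h(1) e f(2)] h(2) idn_left f by simp
qed

lemma cat_equivalence_full_faithful:
  assumes eq: "cat_equivalence A B Fo Fm" and x: "x \<in> obj A" and y: "y \<in> obj A"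
  shows "bij_betw Fm (Hom A x y) (Hom B (Fo x) (Fo y))"
proof -
  obtain Go Gm \<eta> \<epsilon> where F: "cat_functor A B Fo Fm" and G: "cat_functor B A Go Gm"
    and \<eta>: "natural_iso A A (\<lambda>x. x) (\<lambda>f. f) (Go \<circ> Fo) (Gm \<circ> Fm) \<eta>"
    and \<epsilon>: "natural_iso B B (Fo \<circ> Go) (Fm \<circ> Gm) (\<lambda>x. x) (\<lambda>f. f) \<epsilon>"
    using eq by (auto simp: cat_equivalence_def)
  interpret F: cat_functor A B Fo Fm by fact
  interpret G: cat_functor B A Go Gm by fact
  have inj: "inj_on Fm (Hom A x y)"
    by (rule inj_onI) (rule unit_faithful[OF F.A.category_axioms \<eta>], auto)
  have "g \<in> Fm ` Hom A x y" if g: "g \<in> Hom B (Fo x) (Fo y)" for g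
  proof -
    obtain k where k: "k \<in> Hom A (Go (Fo y)) y" "cmp A (\<eta> y) k = idn A y" "cmp A k (\<eta> y) = idn A (Go (Fo y))"
      using natural_isoD(2)[OF \<eta> y] by auto
    obtain h where h: "h \<in> Hom A (Go (Fo x)) x" "cmp A (\<eta> x) h = idn A x" "cmp A h (\<eta> x) = idn A (Go (Fo x))"
      using natural_isoD(2)[OF \<eta> x] by auto
    have e: "\<eta> x \<in> Hom A x (Go (Fo x))" "\<eta> y \<in> Hom A y (Go (Fo y))"
      using natural_isoD(1)[OF \<eta> x] natural_isoD(1)[OF \<eta> y] by auto
    note Gg = G.map_Hom[OF g]
    \<comment> \<open>Conjugating \<open>Gm g\<close> by the unit isomorphisms gives the preimage;
      naturality of \<open>\<eta>\<close> then yields \<open>Gm (Fm ?f) = Gm g\<close>.\<close>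
    let ?f = "cmp A (\<eta> x) (cmp A (Gm g) k)"
    have gk: "cmp A (Gm g) k \<in> Hom A (Go (Fo x)) y" by (rule F.A.cmp_Hom[OF Gg k(1)])
    have f: "?f \<in> Hom A x y" by (rule F.A.cmp_Hom[OF e(1) gk])
    note Gf = G.map_Hom[OF F.map_Hom[OF f]]
    have "cmp A (\<eta> x) (Gm (Fm ?f)) = cmp A ?f (\<eta> y)"
      using \<eta> f by (simp add: natural_iso_def)
    also have "\<dots> = cmp A (\<eta> x) (Gm g)"
      using F.A.cmp_assoc[OF e(1) gk e(2)] F.A.cmp_assoc[OF Gg k(1) e(2)] k(3) F.A.idn_right[OF Gg] by simp
    finally have "cmp A h (cmp A (\<eta> x) (Gm (Fm ?f))) = cmp A h (cmp A (\<eta> x) (Gm g))" by simp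
    then have "Gm (Fm ?f) = Gm g"
      using F.A.cmp_assoc[OF h(1) e(1) Gf] F.A.cmp_assoc[OF h(1) e(1) Gg] h(3) F.A.idn_left[OF Gf] F.A.idn_left[OF Gg] by simp
    \<comment> \<open>Equality after \<open>Gm\<close> gives equality after
      \<open>Fm \<circ> Gm\<close>, which is faithful by the counit.\<close>
    then have "Fm ?f = g"
      using counit_faithful[OF F.B.category_axioms \<epsilon> F.map_Hom[OF f] g] by simp
    then show ?thesis using f by (intro image_eqI[of _ _ ?f]) simp_all
  qed
  then show ?thesis using inj F.map_Hom by (auto simp: bij_betw_def)
qed

lemma cat_equivalence_essentially_surjective:
  assumes eq: "cat_equivalence A B Fo Fm" and y: "y \<in> obj B"
  shows "\<exists>x \<in> obj A. \<exists>t \<in> Hom B (Fo x) y. \<exists>r \<in> Hom B y (Fo x). cmp B t r = idn B (Fo x) \<and> cmp B r t = idn B y"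
proof -
  obtain Go Gm \<epsilon> where G: "cat_functor B A Go Gm"
    and \<epsilon>: "natural_iso B B (Fo \<circ> Go) (Fm \<circ> Gm) (\<lambda>x. x) (\<lambda>f. f) \<epsilon>"
    using eq by (auto simp: cat_equivalence_def)
  have "Go y \<in> obj A" using cat_functor.map_obj[OF G y] .
  then show ?thesis using natural_isoD[OF \<epsilon> y] by auto
qed

text \<open>A one-object equivalence with chosen isomorphisms \<open>t x\<close> from the base object to each object, the one
  to the base object itself being the identity. This normalisation makes \<open>ext_module\<close> a strict
  section of restriction.\<close>

locale group_equivalence = cat_functor "group_cat G" D Fo Fm
  for G :: "'g monoid" and D :: "('p, 'n) cat" and Fo :: "unit \<Rightarrow> 'p" and Fm :: "'g \<Rightarrow> 'n" +
  fixes t r :: "'p \<Rightarrow> 'n"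
  assumes Fm_bij: "bij_betw Fm (carrier G) (Hom D (Fo ()) (Fo ()))"
    and t_Hom: "x \<in> obj D \<Longrightarrow> t x \<in> Hom D (Fo ()) x" and r_Hom: "x \<in> obj D \<Longrightarrow> r x \<in> Hom D x (Fo ())"
    and t_r: "x \<in> obj D \<Longrightarrow> cmp D (t x) (r x) = idn D (Fo ())" and r_t: "x \<in> obj D \<Longrightarrow> cmp D (r x) (t x) = idn D x"
    and t_base: "t (Fo ()) = idn D (Fo ())"
begin

lemma group_Hom [simp]: "Hom (group_cat G) x y = carrier G"
  by (auto simp: Hom_def group_cat_def)

lemma group_obj [simp]: "x \<in> obj (group_cat G)"
  by (simp add: group_cat_def)

lemma base_obj: "Fo () \<in> obj D"
  by (rule map_obj) simp

lemma r_base: "r (Fo ()) = idn D (Fo ())"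
  using t_r[OF base_obj] t_base B.idn_left[OF r_Hom[OF base_obj]] by simp

text \<open>The quasi-inverse on morphisms: \<open>t\<close> and \<open>r\<close> turn
  \<open>h\<close> into an endomorphism of the base object, which comes from a unique element of
  \<open>G\<close>.\<close>

definition pull :: "'n \<Rightarrow> 'g"
  where "pull h = inv_into (carrier G) Fm (cmp D (t (src D h)) (cmp D h (r (tgt D h))))"

lemma pull:
  assumes h: "h \<in> Hom D x y"
  shows "pull h \<in> carrier G" "Fm (pull h) = cmp D (t x) (cmp D h (r y))"
proof -
  have xy: "x \<in> obj D" "y \<in> obj D" using B.Hom_obj[OF h] by auto
  have "src D h = x" "tgt D h = y" using h by (auto simp: Hom_def)
  moreover have "cmp D (t x) (cmp D h (r y)) \<in> Hom D (Fo ()) (Fo ())"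
    by (intro B.cmp_Hom[OF t_Hom[OF xy(1)]] B.cmp_Hom[OF h] r_Hom xy)
  then have "cmp D (t x) (cmp D h (r y)) \<in> Fm ` carrier G" using Fm_bij by (simp add: bij_betw_def)
  ultimately show "pull h \<in> carrier G" "Fm (pull h) = cmp D (t x) (cmp D h (r y))"
    unfolding pull_def by (auto intro: inv_into_into f_inv_into_f)
qed

lemma pull_eqI: "\<lbrakk>h \<in> Hom D x y; g \<in> carrier G; Fm g = cmp D (t x) (cmp D h (r y))\<rbrakk> \<Longrightarrow> pull h = g"
  using pull[of h x y] Fm_bij inj_onD[of Fm "carrier G" "pull h" g] by (simp add: bij_betw_def)

lemma pull_idn:
  assumes x: "x \<in> obj D" shows "pull (idn D x) = idn (group_cat G) ()"
proof (rule pull_eqI[OF B.idn_Hom[OF x]])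
  show "idn (group_cat G) () \<in> carrier G" using A.idn_Hom[of "()"] by simp
  show "Fm (idn (group_cat G) ()) = cmp D (t x) (cmp D (idn D x) (r x))"
    using map_idn[of "()"] t_r[OF x] B.idn_left[OF r_Hom[OF x]] by simp
qed

lemma pull_cmp:
  assumes h: "h \<in> Hom D x y" and k: "k \<in> Hom D y z"
  shows "pull (cmp D h k) = cmp (group_cat G) (pull h) (pull k)"
proof (rule pull_eqI[OF B.cmp_Hom[OF h k]])
  have xyz: "x \<in> obj D" "y \<in> obj D" "z \<in> obj D" using B.Hom_obj[OF h] B.Hom_obj[OF k] by auto
  show "cmp (group_cat G) (pull h) (pull k) \<in> carrier G"
    using A.cmp_Hom[of "pull h" "()" "()" "pull k" "()"] pull(1)[OF h] pull(1)[OF k] by simp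
  note kr = B.cmp_Hom[OF k r_Hom[OF xyz(3)]] and hr = B.cmp_Hom[OF h r_Hom[OF xyz(2)]]
  note tkr = B.cmp_Hom[OF t_Hom[OF xyz(2)] kr]
  have "Fm (cmp (group_cat G) (pull h) (pull k)) =
      cmp D (cmp D (t x) (cmp D h (r y))) (cmp D (t y) (cmp D k (r z)))"
    using map_cmp[of "pull h" "()" "()" "pull k" "()"] pull[OF h] pull[OF k] by simp
  also have "\<dots> = cmp D (t x) (cmp D (cmp D h (r y)) (cmp D (t y) (cmp D k (r z))))"
    by (rule B.cmp_assoc[OF t_Hom[OF xyz(1)] hr tkr])
  also have "cmp D (cmp D h (r y)) (cmp D (t y) (cmp D k (r z))) = cmp D h (cmp D (r y) (cmp D (t y) (cmp D k (r z))))"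
    by (rule B.cmp_assoc[OF h r_Hom[OF xyz(2)] tkr])
  also have "cmp D (r y) (cmp D (t y) (cmp D k (r z))) = cmp D k (r z)"
    using B.cmp_assoc[OF r_Hom[OF xyz(2)] t_Hom[OF xyz(2)] kr] r_t[OF xyz(2)] B.idn_left[OF kr] by simp
  also have "cmp D h (cmp D k (r z)) = cmp D (cmp D h k) (r z)"
    by (rule B.cmp_assoc[OF h k r_Hom[OF xyz(3)], symmetric])
  finally show "Fm (cmp (group_cat G) (pull h) (pull k)) = cmp D (t x) (cmp D (cmp D h k) (r z))" .
qed

text \<open>Holds exactly, not only up to conjugation, because \<open>t\<close> and \<open>r\<close>
  are identities at the base object.\<close>

lemma pull_Fm: "g \<in> carrier G \<Longrightarrow> pull (Fm g) = g"
  using map_Hom[of g "()" "()"] by (intro pull_eqI) (auto simp: t_base r_base B.idn_left B.idn_right)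

definition ext_module :: "(unit, 'g, 'a) cmod \<Rightarrow> ('p, 'n, 'a) cmod"
  where "ext_module A = \<lparr>val = (\<lambda>_. val A ()), act = (\<lambda>h. act A (pull h))\<rparr>"

lemma left_module_ext:
  assumes "left_module (group_cat G) A" shows "left_module D (ext_module A)"
proof -
  interpret A: left_module "group_cat G" A by fact
  show ?thesis
  proof (intro left_module.intro left_module_axioms.intro)
    show "act (ext_module A) f \<in> hom (val (ext_module A) y) (val (ext_module A) x)" if "f \<in> Hom D x y" for f x y
      using A.act_hom[of "pull f" "()" "()"] pull(1)[OF that] by (simp add: ext_module_def)
    show "act (ext_module A) (cmp D f g) a = act (ext_module A) f (act (ext_module A) g a)"
      if "f \<in> Hom D x y" "g \<in> Hom D y z" "a \<in> carrier (val (ext_module A) z)" for f g x y z a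
      using A.act_cmp[of "pull f" "()" "()" "pull g" "()" a] pull(1)[OF that(1)] pull(1)[OF that(2)] that(3)
      by (simp add: ext_module_def pull_cmp[OF that(1,2)])
  qed (simp_all add: ext_module_def A.val_comm_group A.act_idn pull_idn B.category_axioms)
qed

text \<open>One direction of the adjunction between restriction and \<open>ext_module\<close>: every
  value of \<open>P\<close> is carried by \<open>t x\<close> to the base object, where
  \<open>\<theta>\<close> is defined, and the conjugation in \<open>pull\<close> makes this
  natural.\<close>

lemma ext_hom:
  assumes P: "left_module D P" and \<theta>: "module_hom (group_cat G) (restrict_module Fo Fm P) A \<theta>"
  shows "module_hom D P (ext_module A) (\<lambda>x a. \<theta> () (act P (t x) a))"
proof -
  interpret P: left_module D P by fact
  have \<theta>h: "\<theta> () \<in> hom (val P (Fo ())) (val A ())" using \<theta> by (simp add: module_hom_def restrict_module_def)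
  have "\<theta> () (act P (t x) (act P f a)) = act A (pull f) (\<theta> () (act P (t y) a))"
    if f: "f \<in> Hom D x y" and a: "a \<in> carrier (val P y)" for f x y a
  proof -
    have xy: "x \<in> obj D" "y \<in> obj D" using B.Hom_obj[OF f] by auto
    note fr = B.cmp_Hom[OF f r_Hom[OF xy(2)]]
    have ta: "act P (t y) a \<in> carrier (val P (Fo ()))" by (rule hom_in_carrier[OF P.act_hom[OF t_Hom[OF xy(2)]] a])
    have "act A (pull f) (\<theta> () (act P (t y) a)) = \<theta> () (act P (Fm (pull f)) (act P (t y) a))"
      using \<theta> pull(1)[OF f] ta by (simp add: module_hom_def restrict_module_def)
    also have "act P (Fm (pull f)) (act P (t y) a) = act P (t x) (act P (cmp D f (r y)) (act P (t y) a))"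
      unfolding pull(2)[OF f] by (rule P.act_cmp[OF t_Hom[OF xy(1)] fr ta])
    also have "act P (cmp D f (r y)) (act P (t y) a) = act P f (act P (r y) (act P (t y) a))"
      by (rule P.act_cmp[OF f r_Hom[OF xy(2)] ta])
    also have "act P (r y) (act P (t y) a) = a"
      using P.act_cmp[OF r_Hom[OF xy(2)] t_Hom[OF xy(2)] a] r_t[OF xy(2)] P.act_idn[OF xy(2) a] by simp
    finally show ?thesis by simp
  qed
  moreover have "(\<lambda>a. \<theta> () (act P (t x) a)) \<in> hom (val P x) (val A ())" if "x \<in> obj D" for x
    using hom_compose[OF P.act_hom[OF t_Hom[OF that]] \<theta>h] by (simp add: comp_def)
  ultimately show ?thesis by (simp add: module_hom_def ext_module_def)
qed

text \<open>A lifting problem over \<open>G\<close> is turned into one over \<open>D\<close> by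
  \<open>ext_hom\<close>, and its solution is read off at the base object, where \<open>t\<close> is
  the identity.\<close>

lemma restrict_lifts:
  assumes P: "left_module D P" and l: "lifts D P (ext_module A) (ext_module B)"
  shows "lifts (group_cat G) (restrict_module Fo Fm P) A B"
  unfolding lifts_def
proof (intro allI impI, elim conjE)
  interpret P: left_module D P by fact
  fix h \<theta> assume h: "module_hom (group_cat G) A B h" and \<theta>: "module_hom (group_cat G) (restrict_module Fo Fm P) B \<theta>"
    and im: "\<forall>x\<in>obj (group_cat G). \<theta> x ` carrier (val (restrict_module Fo Fm P) x) \<subseteq> h x ` carrier (val A x)"
  have h': "module_hom D (ext_module A) (ext_module B) (\<lambda>_. h ())"
    using h pull(1) by (auto simp: module_hom_def ext_module_def)
  obtain \<psi> where psi: "module_hom D P (ext_module A) \<psi>"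
    "\<And>x a. \<lbrakk>x \<in> obj D; a \<in> carrier (val P x)\<rbrakk> \<Longrightarrow> h () (\<psi> x a) = \<theta> () (act P (t x) a)"
  proof (rule liftsE[OF l h' ext_hom[OF P \<theta>]])
    show "\<theta> () (act P (t x) a) \<in> h () ` carrier (val (ext_module A) x)" if "x \<in> obj D" "a \<in> carrier (val P x)" for x a
      using bspec[OF im group_obj, of "()"] hom_in_carrier[OF P.act_hom[OF t_Hom[OF that(1)]] that(2)]
      by (auto simp: ext_module_def restrict_module_def)
  qed (rule that)
  have "\<psi> (Fo ()) (act P (Fm g) a) = act A g (\<psi> (Fo ()) a)" if g: "g \<in> carrier G" and a: "a \<in> carrier (val P (Fo ()))" for g a
  proof -
    have "Fm g \<in> Hom D (Fo ()) (Fo ())" using map_Hom[of g "()" "()"] g by simp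
    then have "\<psi> (Fo ()) (act P (Fm g) a) = act (ext_module A) (Fm g) (\<psi> (Fo ()) a)"
      using psi(1) a unfolding module_hom_def by blast
    then show ?thesis using pull_Fm[OF g] by (simp add: ext_module_def)
  qed
  then have "module_hom (group_cat G) (restrict_module Fo Fm P) A (\<lambda>_. \<psi> (Fo ()))"
    using psi(1) base_obj by (simp add: module_hom_def restrict_module_def ext_module_def)
  moreover have "h () (\<psi> (Fo ()) a) = \<theta> () a" if "a \<in> carrier (val P (Fo ()))" for a
    using psi(2)[OF base_obj that] t_base P.act_idn[OF base_obj that] by simp
  ultimately show "\<exists>\<psi>. module_hom (group_cat G) (restrict_module Fo Fm P) A \<psi> \<and>
     (\<forall>x\<in>obj (group_cat G). \<forall>a\<in>carrier (val (restrict_module Fo Fm P) x). h x (\<psi> x a) = \<theta> x a)"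
    by (auto simp: restrict_module_def)
qed

lemma restrict_coinvariants_iso:
  assumes Q: "left_module D Q"
  shows "\<exists>f \<in> iso (tensor (group_cat G) trivial_module (restrict_module Fo Fm Q)) (tensor D trivial_module Q).
    \<forall>z \<in> obj (group_cat G). \<forall>b \<in> carrier (val (restrict_module Fo Fm Q) z).
      f (coinv (group_cat G) (restrict_module Fo Fm Q) z b) = coinv D Q (Fo z) b"
proof -
  interpret Q: left_module D Q by fact
  let ?R = "restrict_module Fo Fm Q"
  note R = left_module_restrict[OF cat_functor_axioms Q]
  show ?thesis
  proof (rule coinvariants_iso[OF cat_functor_axioms R Q])
    show "module_hom (group_cat G) ?R ?R (\<lambda>_ b. b)" by (auto simp: module_hom_def hom_def)
    \<comment> \<open>A constant module is unchanged by \<open>ext_module\<close>, so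
      \<open>ext_hom\<close> turns the universal map of the restriction into a map on
      \<open>Q\<close>.\<close>
    have "ext_module (const_module (tensor (group_cat G) trivial_module ?R)) = const_module (tensor (group_cat G) trivial_module ?R)"
      by (simp add: ext_module_def const_module_def)
    then show "module_hom D Q (const_module (tensor (group_cat G) trivial_module ?R)) (\<lambda>x a. coinv (group_cat G) ?R () (act Q (t x) a))"
      using ext_hom[OF Q coinv_hom[OF R]] by simp
    show "coinv (group_cat G) ?R () (act Q (t (Fo z)) b) = coinv (group_cat G) ?R z b" if "b \<in> carrier (val ?R z)" for z b
      using that Q.act_idn[OF base_obj] by (simp add: t_base restrict_module_def)
  next
    fix x a assume x: "x \<in> obj D" and a: "a \<in> carrier (val Q x)"
    have "act Q (t x) a \<in> carrier (val ?R ())"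
      using hom_in_carrier[OF Q.act_hom[OF t_Hom[OF x]] a] by (simp add: restrict_module_def)
    \<comment> \<open>\<open>t x\<close> acts trivially on coinvariants, so every class is
      represented at the base object.\<close>
    moreover have "coinv D Q x a = coinv D Q (Fo ()) (act Q (t x) a)"
      using coinv_hom[OF Q] t_Hom[OF x] a by (simp add: module_hom_def const_module_def)
    ultimately show "\<exists>z\<in>obj (group_cat G). \<exists>b\<in>carrier (val ?R z). coinv D Q x a = coinv D Q (Fo z) b"
      using group_obj by blast
  qed
qed

end

lemma group_equivalence_exists:
  assumes eq: "cat_equivalence (group_cat G) D Fo Fm"
  obtains t r where "group_equivalence G D Fo Fm t r"
proof -
  interpret cat_functor "group_cat G" D Fo Fm using eq by (simp add: cat_equivalence_def)
  have hom: "Hom (group_cat G) () () = carrier G" by (auto simp: Hom_def group_cat_def)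
  have base: "Fo () \<in> obj D" by (rule map_obj) (simp add: group_cat_def)
  have "\<exists>t r. t \<in> Hom D (Fo ()) x \<and> r \<in> Hom D x (Fo ()) \<and> cmp D t r = idn D (Fo ()) \<and> cmp D r t = idn D x \<and>
      (x = Fo () \<longrightarrow> t = idn D (Fo ()))" if x: "x \<in> obj D" for x
  \<comment> \<open>The base object gets the identity, to meet the normalisation; elsewhere the
    isomorphism comes from essential surjectivity, as \<open>Fo\<close> has only one value.\<close>
  proof (cases "x = Fo ()")
    case True
    then show ?thesis using B.idn_Hom[OF base] B.idn_left[OF B.idn_Hom[OF base]] by blast
  next
    case False
    then show ?thesis using cat_equivalence_essentially_surjective[OF eq x] by (metis old.unit.exhaust)
  qed
  then obtain t r where tr: "\<And>x. x \<in> obj D \<Longrightarrow> t x \<in> Hom D (Fo ()) x \<and> r x \<in> Hom D x (Fo ()) \<and>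
      cmp D (t x) (r x) = idn D (Fo ()) \<and> cmp D (r x) (t x) = idn D x \<and> (x = Fo () \<longrightarrow> t x = idn D (Fo ()))"
    by metis
  have "bij_betw Fm (carrier G) (Hom D (Fo ()) (Fo ()))"
    using cat_equivalence_full_faithful[OF eq, of "()" "()"] hom by (simp add: group_cat_def)
  then have "group_equivalence G D Fo Fm t r"
    by unfold_locales (use tr base in blast)+
  then show thesis by (rule that)
qed

section \<open>Assembling the comparison for the groupoid and for the group\<close>

lemma restrict_resolution:
  assumes F: "cat_functor A D Fo Fm" and Q: "resolution D N Q \<delta> \<epsilon>"
  shows "resolution A (restrict_module Fo Fm N) (\<lambda>n. restrict_module Fo Fm (Q n)) (\<lambda>n x. \<delta> n (Fo x)) (\<lambda>x. \<epsilon> (Fo x))"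
proof -
  interpret F: cat_functor A D Fo Fm by fact
  note q = resolutionD[OF Q]
  show ?thesis
    using Q left_module_restrict[OF F q(1)] left_module_restrict[OF F q(2)] module_hom_restrict[OF F q(3)]
      module_hom_restrict[OF F q(4)] F.map_obj
    unfolding resolution_def module_epi_def by (simp add: restrict_module_def)
qed

text \<open>The extension of \<open>coinv C P\<close> along the unit is the backward map that
  \<open>coinvariants_iso\<close> asks for.\<close>

lemma (in left_ore) induced_coinvariants_iso:
  assumes P: "left_module C P"
  shows "\<exists>f \<in> iso (tensor C trivial_module P) (tensor (env_groupoid C) trivial_module (induced_module C P)).
    \<forall>z \<in> obj C. \<forall>b \<in> carrier (val P z). f (coinv C P z b) = coinv (env_groupoid C) (induced_module C P) z (ind_unit P z b)"
proof -
  interpret E: category "env_groupoid C" by (rule category_env)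
  note IP = left_module_induced[OF P]
  let ?T = "tensor C trivial_module P"
  have T: "left_module (env_groupoid C) (const_module ?T)"
    by (rule left_module_const[OF category_env comm_group_tensor[OF right_module_trivial_over[OF P] P]])
  obtain \<Theta> where Theta: "module_hom (env_groupoid C) (induced_module C P) (const_module ?T) \<Theta>"
    "\<And>x z g b. \<lbrakk>g \<in> Hom (env_groupoid C) x z; b \<in> carrier (val P z)\<rbrakk>
      \<Longrightarrow> \<Theta> x (ind_tens P x z g b) = act (const_module ?T) g (coinv C P z b)"
    by (rule induced_extend[OF P T, unfolded restrict_const, OF coinv_hom[OF P]]) (rule that, assumption, simp add: const_module_def)
  show ?thesis
  proof (rule coinvariants_iso[OF env_map_functor P IP ind_unit_hom[OF P] Theta(1)])
    show "\<Theta> z (ind_unit P z b) = coinv C P z b" if "z \<in> obj C" "b \<in> carrier (val P z)" for z b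
      using Theta(2)[OF E.idn_Hom that(2)] that(1) by (simp add: ind_unit_def[OF P] const_module_def)
  next
    fix x X assume "x \<in> obj (env_groupoid C)" and X: "X \<in> carrier (val (induced_module C P) x)"
    then have x: "x \<in> obj C" by simp
    have X': "X \<in> carrier (tensor C (free_hom_module C x) P)" using X by (simp add: induced_module_def)
    obtain w f a where f: "f \<in> Hom C w x" "a \<in> carrier (val P w)" "X = ind_tens P x w (env_inv f) a"
      by (rule induced_fraction[OF P x X'])
    have w: "w \<in> obj C" using Hom_obj[OF f(1)] by simp
    have "ind_unit P w a \<in> carrier (val (induced_module C P) w)"
      using module_hom_closed[OF ind_unit_hom[OF P] w f(2)] by (simp add: restrict_module_def)
    \<comment> \<open>The inverse of \<open>f\<close> acts trivially on coinvariants, so the class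
      of the fraction is that of \<open>1 \<otimes> a\<close>.\<close>
    then have "coinv (env_groupoid C) (induced_module C P) x X = coinv (env_groupoid C) (induced_module C P) w (ind_unit P w a)"
      using coinv_hom[OF IP] env_inv_Hom[OF f(1)] f(3) ind_tens_unit[OF P env_inv_Hom[OF f(1)] f(2)]
      by (simp add: module_hom_def const_module_def)
    then show "\<exists>z\<in>obj C. \<exists>b\<in>carrier (val P z). coinv (env_groupoid C) (induced_module C P) x X =
        coinv (env_groupoid C) (induced_module C P) z (ind_unit P z b)"
      using w f(2) by blast
  qed
qed

lemma homology_env_groupoid:
  assumes C: "left_ore C" and M: "left_module C M"
  shows "cat_homology n C M \<cong> cat_homology n (env_groupoid C) (induced_module C M)"
proof -
  interpret left_ore C by (rule C)
  obtain P \<delta> \<epsilon> where c: "chosen_resolution C M = (P, \<delta>)" and P: "projective_resolution C M P \<delta> \<epsilon>"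
    by (rule chosen_resolution[OF M])
  have pr: "projective C (P n)" for n using P by (simp add: projective_resolution_def)
  note PM = projective_resolution_resolution[OF M P]
  note p = resolutionD[OF PM]
  note R = induced_resolution[OF PM]
  \<comment> \<open>No element types are imposed on \<open>A\<close> and \<open>B\<close>: the
    property is applied to \<open>univ\<close> modules, to the induced module of \<open>M\<close>
    and to the induced resolution.\<close>
  have l: "lifts (env_groupoid C) (induced_module C (P n)) A B"
    if "left_module (env_groupoid C) A" "left_module (env_groupoid C) B" for n A B
    by (rule induced_lifts[OF p(2) that projective_lifts[OF pr left_module_restrict[OF env_map_functor that(1)]
        left_module_restrict[OF env_map_functor that(2)]]])
  \<comment> \<open>Naturality of the unit, so that the isomorphisms of coinvariants commute with
    the differentials.\<close>
  have u: "ind_unit (P n) z (\<delta> n z b) = ind_map (P n) (\<delta> n) z (ind_unit (P (Suc n)) z b)"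
    if "z \<in> obj C" "b \<in> carrier (val (P (Suc n)) z)" for n z b
    using ind_map_tens[OF p(2,2,3) category.idn_Hom[OF category_env] that(2)] that(1)
    by (simp add: ind_unit_def[OF p(2)])
  have "cat_homology n C M = coinv_homology C P \<delta> n"
    by (simp add: cat_homology_def Tor_def c)
  also have "\<dots> \<cong> coinv_homology (env_groupoid C) (\<lambda>n. induced_module C (P n)) (\<lambda>n. ind_map (P n) (\<delta> n)) n"
    by (rule coinvariants_homology_iso(1)[OF env_map_functor PM R ind_unit_hom[OF p(2)] u induced_coinvariants_iso[OF p(2)]])
  also have "\<dots> \<cong> cat_homology n (env_groupoid C) (induced_module C M)"
    by (rule resolution_computes_homology[OF R]) (rule l; (assumption | rule left_module_induced p(1,2))+)+
  finally show ?thesis .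
qed

text \<open>Restriction keeps exactness objectwise, so the equivalence enters through the lifting
  property and the coinvariants; on the latter, the connecting map is the identity on
  elements.\<close>

lemma homology_group_equivalence:
  assumes eq: "cat_equivalence (group_cat G) D Fo Fm" and N: "left_module D N"
  shows "cat_homology n D N \<cong> cat_homology n (group_cat G) (restrict_module Fo Fm N)"
proof -
  obtain t r where ge: "group_equivalence G D Fo Fm t r" by (rule group_equivalence_exists[OF eq])
  interpret group_equivalence G D Fo Fm t r by (rule ge)
  obtain Q \<delta> \<epsilon> where c: "chosen_resolution D N = (Q, \<delta>)" and Q: "projective_resolution D N Q \<delta> \<epsilon>"
    by (rule chosen_resolution[OF N])
  have pr: "projective D (Q n)" for n using Q by (simp add: projective_resolution_def)
  note QN = projective_resolution_resolution[OF N Q]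
  note q = resolutionD[OF QN]
  note R = restrict_resolution[OF cat_functor_axioms QN]
  have l: "lifts (group_cat G) (restrict_module Fo Fm (Q n)) A B"
    if "left_module (group_cat G) A" "left_module (group_cat G) B" for n A B
    by (rule restrict_lifts[OF q(2) projective_lifts[OF pr left_module_ext[OF that(1)] left_module_ext[OF that(2)]]])
  have id: "module_hom (group_cat G) X X (\<lambda>_ b. b)" for X by (auto simp: module_hom_def hom_def)
  have "cat_homology n D N = coinv_homology D Q \<delta> n"
    by (simp add: cat_homology_def Tor_def c)
  also have "\<dots> \<cong> coinv_homology (group_cat G) (\<lambda>n. restrict_module Fo Fm (Q n)) (\<lambda>n x. \<delta> n (Fo x)) n"
    by (rule coinvariants_homology_iso(2)[OF cat_functor_axioms R QN id refl restrict_coinvariants_iso[OF q(2)]])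
  also have "\<dots> \<cong> cat_homology n (group_cat G) (restrict_module Fo Fm N)"
    by (rule resolution_computes_homology[OF R])
      (rule l; (assumption | rule left_module_restrict[OF cat_functor_axioms] q(1,2))+)+
  finally show ?thesis .
qed

theorem mainTheorem1:
  fixes C :: "('o, 'm) cat" and M :: "('o, 'm, 'a) cmod"
  assumes "left_ore C" and "left_module C M"
  shows "(\<forall>n. cat_homology n C M \<cong> cat_homology n (env_groupoid C) (induced_module C M)) \<and>
    (\<forall>(G :: 'g monoid) \<phi>o \<phi>m.
       group G \<longrightarrow> cat_equivalence (group_cat G) (env_groupoid C) \<phi>o \<phi>m \<longrightarrow>
       (\<forall>n. cat_homology n C M \<cong> cat_homology n (group_cat G) (restrict_module \<phi>o \<phi>m (induced_module C M))))"
proof (intro conjI allI impI)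
  interpret left_ore C by fact
  note 1 = homology_env_groupoid[OF assms]
  show "cat_homology n C M \<cong> cat_homology n (env_groupoid C) (induced_module C M)" for n by (rule 1)
  show "cat_homology n C M \<cong> cat_homology n (group_cat G) (restrict_module \<phi>o \<phi>m (induced_module C M))"
    if "cat_equivalence (group_cat G) (env_groupoid C) \<phi>o \<phi>m" for G :: "'g monoid" and \<phi>o \<phi>m n
    by (rule iso_trans[OF 1 homology_group_equivalence[OF that left_module_induced[OF assms(2)]]])
qed

end
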